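(* There is a quantum query algorithm that, for all integers $1\le d\le n$ and every function $f:\{0,\dots,n-1\}\times\{0,\dots,n-1\}\to\{0,1\}$, solves the problem $LRECW(f,n,d)$ (find an empty rectangle of width $d$ of the largest area) with query complexity $O(n\sqrt{d}\,\log n\,\log\log n\cdot T_f)$ (as $n\to\infty$, uniformly in $d$) and error probability $0.1$, where $T_f$ is the query complexity of computing $f$.
   Context: Given $f:\{0,\dots,n-1\}^2\to\{0,1\}$, a quadruple $(x_1,y_1,x_2,y_2)$ with $0\le x_1\le x_2\le n-1$ and $0\le y_1\le y_2\le n-1$ is an empty rectangle if $f(i,j)=0$ for all $x_1\le i\le x_2$, $y_1\le j\le y_2$. Its width is $x_2-x_1+1$ and its size (area) is $(x_2-x_1+1)(y_2-y_1+1)$. Problem $LRECW(f,n,d)$ (Largest Empty Rectangle with a Fixed Width): output an empty rectangle of width exactly $d$, i.e. of the form $(x_1,y_1,x_1+d-1,y_2)$, such that no empty rectangle of width $d$ has larger size (if there is no empty rectangle of width $d$, output $(NULL,NULL,NULL,NULL)$). Quantum query model: the input is accessed through the unitary $|i\rangle|z\rangle|w\rangle\mapsto|i\rangle|z+x_i \bmod 2\rangle|w\rangle$, where $x_i$ is the input value with index $i$. An algorithm alternates input-independent unitaries with applications of the query unitary and ends with a measurement; its query complexity is the number of applications of the query unitary. The error probability is the maximum over inputs of the probability that the output is not correct (error probability $0.1$ means at most $0.1$). $T_f$ denotes the query complexity of computing $f$: the number of queries used for one (coherent) evaluation $(i,j)\mapsto f(i,j)$; $T_f=1$ if $f$ itself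 is the queried input. *)

theory Defs
  imports Complex_Main "Jordan_Normal_Form.Schur_Decomposition"
begin

section \<open>Empty rectangles\<close>

text \<open>
  A function \<open>f : {0,...,n-1} \<times> {0,...,n-1} \<rightarrow> {0,1}\<close> is a \<open>bool\<close>-valued function of two
  natural numbers, with \<open>False\<close> for 0; its values outside the \<open>n \<times> n\<close> square play no role.
\<close>

type_synonym rect = "nat \<times> nat \<times> nat \<times> nat"

fun empty_rectangle :: "nat \<Rightarrow> (nat \<Rightarrow> nat \<Rightarrow> bool) \<Rightarrow> rect \<Rightarrow> bool" where
  "empty_rectangle n f (x1, y1, x2, y2) \<longleftrightarrow>
     x1 \<le> x2 \<and> x2 < n \<and> y1 \<le> y2 \<and> y2 < n \<and>
     (\<forall>i\<in>{x1..x2}. \<forall>j\<in>{y1..y2}. \<not> f i j)"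

fun rect_width :: "rect \<Rightarrow> nat" where
  "rect_width (x1, y1, x2, y2) = x2 - x1 + 1"

fun rect_area :: "rect \<Rightarrow> nat" where
  "rect_area (x1, y1, x2, y2) = (x2 - x1 + 1) * (y2 - y1 + 1)"

text \<open>The answer \<open>(NULL,NULL,NULL,NULL)\<close> is \<^const>\<open>None\<close>.\<close>

fun solves_lrecw :: "nat \<Rightarrow> (nat \<Rightarrow> nat \<Rightarrow> bool) \<Rightarrow> nat \<Rightarrow> rect option \<Rightarrow> bool" where
  "solves_lrecw n f d None \<longleftrightarrow> (\<nexists>R. empty_rectangle n f R \<and> rect_width R = d)"
| "solves_lrecw n f d (Some R) \<longleftrightarrow>
     empty_rectangle n f R \<and> rect_width R = d \<and>
     (\<forall>R'. empty_rectangle n f R' \<and> rect_width R' = d \<longrightarrow> rect_area R' \<le> rect_area R)"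


section \<open>Quantum query circuits\<close>

definition unitary_mat :: "nat \<Rightarrow> complex mat \<Rightarrow> bool" where
  "unitary_mat N U \<longleftrightarrow>
     U \<in> carrier_mat N N \<and> mat_adjoint U * U = 1\<^sub>m N \<and> U * mat_adjoint U = 1\<^sub>m N"

text \<open>
  A circuit querying an input of \<open>inputs\<close> bits works on three registers \<open>|i\<rangle>|z\<rangle>|w\<rangle>\<close> with
  \<open>i < inputs\<close>, \<open>z < 2\<close>, \<open>w < workdim\<close>. It applies \<open>init_op\<close>, and then, for every \<open>U\<close> in \<open>step_ops\<close>
  in turn, one query followed by \<open>U\<close>.
\<close>

record qcircuit =
  inputs :: nat
  workdim :: nat
  init_op :: "complex mat"
  step_ops :: "complex mat list"

definition state_dim :: "'a qcircuit_scheme \<Rightarrow> nat" where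
  "state_dim A = inputs A * 2 * workdim A"

definition basis_index :: "'a qcircuit_scheme \<Rightarrow> nat \<Rightarrow> nat \<Rightarrow> nat \<Rightarrow> nat" where
  "basis_index A i z w = (i * 2 + z) * workdim A + w"

definition ket :: "'a qcircuit_scheme \<Rightarrow> nat \<Rightarrow> nat \<Rightarrow> nat \<Rightarrow> complex vec" where
  "ket A i z w = unit_vec (state_dim A) (basis_index A i z w)"

definition wf_qcircuit :: "'a qcircuit_scheme \<Rightarrow> bool" where
  "wf_qcircuit A \<longleftrightarrow>
     0 < inputs A \<and> 0 < workdim A \<and>
     unitary_mat (state_dim A) (init_op A) \<and>
     (\<forall>U \<in> set (step_ops A). unitary_mat (state_dim A) U)"

definition num_queries :: "'a qcircuit_scheme \<Rightarrow> nat" where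
  "num_queries A = length (step_ops A)"

text \<open>
  The query permutes the basis by \<open>|i\<rangle>|z\<rangle>|w\<rangle> \<mapsto> |i\<rangle>|(z + x i) mod 2\<rangle>|w\<rangle>\<close>; \<open>query_image\<close> is this
  permutation on basis indices, decoding an index \<open>b\<close> into its three registers.
\<close>

definition query_image :: "'a qcircuit_scheme \<Rightarrow> (nat \<Rightarrow> bool) \<Rightarrow> nat \<Rightarrow> nat" where
  "query_image A x b =
     (let i = b div (2 * workdim A); z = b div workdim A mod 2; w = b mod workdim A
      in basis_index A i ((z + of_bool (x i)) mod 2) w)"

definition query_mat :: "'a qcircuit_scheme \<Rightarrow> (nat \<Rightarrow> bool) \<Rightarrow> complex mat" where
  "query_mat A x =
     mat (state_dim A) (state_dim A) (\<lambda>(r, c). if r = query_image A x c then 1 else 0)"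

definition run :: "'a qcircuit_scheme \<Rightarrow> (nat \<Rightarrow> bool) \<Rightarrow> complex vec \<Rightarrow> complex vec" where
  "run A x v = foldl (\<lambda>u U. U *\<^sub>v (query_mat A x *\<^sub>v u)) (init_op A *\<^sub>v v) (step_ops A)"


section \<open>Algorithms that end with a measurement\<close>

text \<open>
  An algorithm starts in \<open>|0\<rangle>|0\<rangle>|0\<rangle>\<close>, ends with a measurement in the computational basis, and
  returns the value that \<open>outcome\<close> attaches to the measured basis index. Any other measurement is
  one of this kind after a change of the workspace and of the last unitary.
\<close>

record 'r qalgorithm = qcircuit +
  outcome :: "nat \<Rightarrow> 'r"

definition error_prob :: "'r qalgorithm \<Rightarrow> (nat \<Rightarrow> bool) \<Rightarrow> ('r \<Rightarrow> bool) \<Rightarrow> real" where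
  "error_prob A x correct =
     (\<Sum>b | b < state_dim A \<and> \<not> correct (outcome A b). (cmod (run A x (ket A 0 0 0) $ b))\<^sup>2)"


section \<open>Coherent evaluation of f\<close>

text \<open>
  In general \<open>f\<close> is not the queried input itself but is computed from an input \<open>x\<close> by a circuit
  \<open>E\<close>, and \<open>T\<^sub>f\<close> is the number of queries of \<open>E\<close>. The workspace of \<open>E\<close> holds \<open>|i\<rangle>|j\<rangle>|y\<rangle>|a\<rangle>\<close> with
  \<open>i, j < n\<close>, \<open>y < 2\<close>, \<open>a < anc\<close>, and \<open>E\<close> maps \<open>|i\<rangle>|j\<rangle>|y\<rangle>\<close> to \<open>|i\<rangle>|j\<rangle>|(y + f i j) mod 2\<rangle>\<close>
  exactly, starting from and returning to zeros in the query registers and in the ancilla \<open>a\<close>.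
\<close>

definition evaluates :: "nat \<Rightarrow> 'a qcircuit_scheme \<Rightarrow> (nat \<Rightarrow> bool) \<Rightarrow> (nat \<Rightarrow> nat \<Rightarrow> bool) \<Rightarrow> bool" where
  "evaluates n E x f \<longleftrightarrow>
     (\<exists>anc>0. workdim E = n * n * 2 * anc \<and>
       (\<forall>i<n. \<forall>j<n. \<forall>y<2.
          run E x (ket E 0 0 (((i * n + j) * 2 + y) * anc)) =
          ket E 0 0 (((i * n + j) * 2 + (y + of_bool (f i j)) mod 2) * anc)))"


section \<open>If f itself is the input, one query suffices\<close>

definition swap_mat :: "nat \<Rightarrow> complex mat" where
  "swap_mat D = mat (D * D) (D * D) (\<lambda>(r, c). if r = c mod D * D + c div D then 1 else 0)"

lemma map_mat_unit_vec:
  assumes "c < N" "g c < N"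
  shows "mat N N (\<lambda>(r, c). if r = g c then 1 else 0) *\<^sub>v unit_vec N c = (unit_vec N (g c) :: complex vec)"
  using assms by (intro eq_vecI) (auto simp: scalar_prod_def if_distrib[where f="\<lambda>z. _ * z"] unit_vec_def cong: if_cong)

lemma swap_lt:
  fixes a b :: nat
  assumes "a < D" "b < D"
  shows "a * D + b < D * D"
proof -
  have "a * D + b < Suc a * D" using assms by simp
  also have "\<dots> \<le> D * D" using assms by (intro mult_right_mono) auto
  finally show ?thesis .
qed

lemma bit_lt: "p < q \<Longrightarrow> z < 2 \<Longrightarrow> p * 2 + z < q * 2" for p q z :: nat
  by linarith

lemma unitary_swap_mat: "unitary_mat (D * D) (swap_mat D)"
proof (cases "D = 0")
  case True
  then show ?thesis
    by (auto simp: unitary_mat_def swap_mat_def mat_adjoint_def)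
next
  case D: False
  let ?g = "\<lambda>c. c mod D * D + c div D"
  have lt: "?g c < D * D" if "c < D * D" for c
    using that D by (intro swap_lt) (auto simp: less_mult_imp_div_less)
  have inv: "?g (?g c) = c" if "c < D * D" for c
    using that D by (simp add: less_mult_imp_div_less)
  have sym: "(r = ?g c) = (c = ?g r)" if "r < D * D" "c < D * D" for r c
    using that inv by metis
  have c: "swap_mat D \<in> carrier_mat (D*D) (D*D)" by (simp add: swap_mat_def)
  have adj: "mat_adjoint (swap_mat D) = swap_mat D"
  proof (rule eq_matI)
    fix i j assume "i < dim_row (swap_mat D)" "j < dim_col (swap_mat D)"
    then have ij: "i < D * D" "j < D * D" by (auto simp: swap_mat_def)
    have "(j = ?g i) = (i = ?g j)" using sym ij by blast
    then show "mat_adjoint (swap_mat D) $$ (i, j) = swap_mat D $$ (i, j)"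
      using ij by (simp add: mat_adjoint_def swap_mat_def mat_of_rows_def)
  qed (auto simp: mat_adjoint_def swap_mat_def)
  have "swap_mat D * swap_mat D = 1\<^sub>m (D * D)"
  proof (rule mat_col_eqI)
    fix j assume "j < dim_col (1\<^sub>m (D * D) :: complex mat)"
    then have j: "j < D * D" by simp
    have "col (swap_mat D * swap_mat D) j = swap_mat D *\<^sub>v col (swap_mat D) j"
      by (rule col_mult2[OF c c j])
    also have "col (swap_mat D) j = unit_vec (D * D) (?g j)"
      using j by (intro eq_vecI) (auto simp: swap_mat_def unit_vec_def)
    also have "swap_mat D *\<^sub>v \<dots> = unit_vec (D * D) (?g (?g j))"
      unfolding swap_mat_def by (rule map_mat_unit_vec[where g = ?g, OF lt[OF j] lt[OF lt[OF j]]])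
    also have "?g (?g j) = j" by (rule inv[OF j])
    finally show "col (swap_mat D * swap_mat D) j = col (1\<^sub>m (D * D)) j" using j by simp
  qed (auto simp: swap_mat_def)
  then show ?thesis using c adj by (simp add: unitary_mat_def)
qed

lemma swap_mat_unit_vec:
  assumes "a < D" "b < D"
  shows "swap_mat D *\<^sub>v unit_vec (D * D) (a * D + b) = unit_vec (D * D) (b * D + a)"
proof -
  have "(a * D + b) mod D * D + (a * D + b) div D = b * D + a"
    using assms by (simp add: div_mult_self3)
  then show ?thesis
    unfolding swap_mat_def
    using map_mat_unit_vec[where g = "\<lambda>c. c mod D * D + c div D" and c = "a * D + b" and N = "D * D"]
      swap_lt[OF assms] swap_lt[OF assms(2,1)] by simp
qed

text \<open>Here \<open>f i j\<close> is the input bit with index \<open>i * n + j\<close>.\<close>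

lemma direct_evaluator:
  assumes "0 < n"
  shows "\<exists>E :: qcircuit. wf_qcircuit E \<and> inputs E = n * n \<and> num_queries E = 1 \<and>
    (\<forall>f. evaluates n E (\<lambda>k. f (k div n) (k mod n)) f)"
proof -
  define D where "D = n * n * 2"
  define E where "E = \<lparr>inputs = n * n, workdim = D, init_op = swap_mat D, step_ops = [swap_mat D]\<rparr>"
  have D: "0 < D" using assms by (simp add: D_def)
  have dim: "state_dim E = D * D" unfolding state_dim_def E_def by (simp add: D_def)
  have wf: "wf_qcircuit E"
    unfolding wf_qcircuit_def dim using assms D unitary_swap_mat[of D] by (simp add: E_def)
  have "evaluates n E (\<lambda>k. f (k div n) (k mod n)) f" for f
  proof -
    let ?x = "\<lambda>k. f (k div n) (k mod n)"
    have *: "run E ?x (ket E 0 0 ((i * n + j) * 2 + y)) =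
          ket E 0 0 ((i * n + j) * 2 + (y + of_bool (f i j)) mod 2)"
      if ij: "i < n" "j < n" and y: "y < 2" for i j y
    proof -
      define p where "p = i * n + j"
      define y' where "y' = (y + of_bool (f i j)) mod 2"
      have p: "p < n * n" unfolding p_def using ij by (rule swap_lt)
      have "y' < 2" by (simp add: y'_def)
      then have w: "p * 2 + y < D" and w': "p * 2 + y' < D"
        unfolding D_def using bit_lt[OF p] y by blast+
      have x: "?x p = f i j" using ij by (simp add: p_def)
      have d1: "(p * 2 + y) * D div D = p * 2 + y" using D by simp
      have "(p * 2 + y) * D div (2 * D) = (p * 2 + y) * D div D div 2"
        by (simp add: div_mult2_eq mult.commute)
      also have "\<dots> = p" unfolding d1 using y by simp
      finally have "query_image E ?x ((p * 2 + y) * D) = (p * 2 + y') * D"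
        unfolding query_image_def basis_index_def Let_def using d1 y
        by (simp add: E_def x y'_def)
      moreover have "(p * 2 + y) * D < D * D" "(p * 2 + y') * D < D * D"
        using w w' D by simp_all
      ultimately have q: "query_mat E ?x *\<^sub>v unit_vec (D * D) ((p * 2 + y) * D) =
          unit_vec (D * D) ((p * 2 + y') * D)"
        unfolding query_mat_def dim
        using map_mat_unit_vec[of "(p * 2 + y) * D" "D * D" "query_image E ?x"] by metis
      have "run E ?x (ket E 0 0 (p * 2 + y)) =
        swap_mat D *\<^sub>v (query_mat E ?x *\<^sub>v (swap_mat D *\<^sub>v unit_vec (D * D) (0 * D + (p * 2 + y))))"
        unfolding run_def ket_def dim basis_index_def by (simp add: E_def)
      also have "\<dots> = unit_vec (D * D) (0 * D + (p * 2 + y'))"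
        unfolding swap_mat_unit_vec[OF D w] add_0_right q
        using swap_mat_unit_vec[OF w' D] by (simp only: add_0_right)
      also have "\<dots> = ket E 0 0 (p * 2 + y')"
        unfolding ket_def dim basis_index_def by simp
      finally show ?thesis by (simp only: p_def y'_def)
    qed
    have "workdim E = n * n * 2 * 1" by (simp add: E_def D_def)
    with * show ?thesis unfolding evaluates_def
      by (intro exI[of _ 1]) (simp only: mult_1_right, simp)
  qed
  moreover have "inputs E = n * n" "num_queries E = 1" by (simp_all add: E_def num_queries_def)
  ultimately show ?thesis using wf by blast
qed

end

theory Submission
  imports Defs "HOL-Analysis.L2_Norm"
begin

text \<open>
  No search subroutines are composed; the algorithm comes from an explicit solution of the dual
  adversary bound. Vectors \<open>\<alpha> x, \<beta> x\<close> of squared norm at most \<open>W\<close>, indexed by labelled queries, with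
  \<open>\<Sum>\<close> of \<open>\<alpha> x q * \<beta> y q\<close> over the \<open>q\<close> on which \<open>x\<close> and \<open>y\<close> differ equal to 1 whenever their answers
  differ, give an algorithm with \<open>O(W)\<close> queries. Let \<open>U\<close> be an input-independent reflection followed
  by an input-dependent diagonal one. The initial state splits into \<open>v\<^sub>+\<close>, which is close to a vector
  fixed by \<open>U\<close>, and \<open>v\<^sub>- = (w - U w) / 2\<close> with \<open>w\<close> of norm \<open>O(W)\<close>. The mean of \<open>U\<^sup>t v\<^sub>-\<close> over \<open>t < K\<close>
  telescopes to \<open>(w - U\<^sup>K w) / (2 K)\<close>, so it is small for \<open>K\<close> a multiple of \<open>W\<close> and no spectral
  analysis is needed: reflecting a clock register about its uniform state flips the sign of \<open>v\<^sub>+\<close>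
  only. All sets of answers are tried in superposition, and the resulting signs determine the answer.

  The answer is the largest code \<open>(h * n + r) * n + y\<close> of an empty rectangle of height \<open>h\<close>
  with corner \<open>(r, y)\<close>, found along the path of a binary search with \<open>O(log n)\<close> thresholds \<open>t\<close>. Let \<open>H\<close>
  be the height belonging to \<open>t\<close>. Whether \<open>t\<close> is attained is the disjunction of \<open>n * (n div H)\<close>
  instances, one for each row range and each column \<open>b * H\<close>: scan from this column to the left and
  then to the right, up to distance \<open>H\<close> each, until a nonempty cell stops the scan. A scan has \<open>2 H d\<close>
  vertices at most and at most two of them carry a 1, which allows weights of squared norm
  \<open>O(sqrt (H d))\<close> for one instance and \<open>O(sqrt (n\<^sup>2 / H) * sqrt (H d)) = O(n * sqrt d)\<close> for the disjunction.
\<close>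

section \<open>Orthogonal operators on real functions\<close>

text \<open>Vectors are total functions vanishing off \<open>I\<close>. Thus any finite set can
  index a basis, in particular sums and products of registers.\<close>

definition supp :: "'i set \<Rightarrow> ('i \<Rightarrow> real) set" where
  "supp I = {p. \<forall>i. i \<notin> I \<longrightarrow> p i = 0}"

definition ip :: "'i set \<Rightarrow> ('i \<Rightarrow> real) \<Rightarrow> ('i \<Rightarrow> real) \<Rightarrow> real" where
  "ip I p q = (\<Sum>i\<in>I. p i * q i)"

definition lin :: "(('i \<Rightarrow> real) \<Rightarrow> 'j \<Rightarrow> real) \<Rightarrow> bool" where
  "lin T \<longleftrightarrow> (\<forall>a b p q. T (\<lambda>i. a * p i + b * q i) = (\<lambda>i. a * T p i + b * T q i))"

text \<open>Linearity is asked for everywhere, preservation of norms only on \<open>supp I\<close>.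
  In finite dimension an isometry is already orthogonal; inner products follow in
  \<open>orth_ip\<close>.\<close>

definition orth :: "'i set \<Rightarrow> (('i \<Rightarrow> real) \<Rightarrow> 'i \<Rightarrow> real) \<Rightarrow> bool" where
  "orth I T \<longleftrightarrow> lin T \<and> (\<forall>p \<in> supp I. T p \<in> supp I \<and> ip I (T p) (T p) = ip I p p)"

definition delta :: "'i \<Rightarrow> 'i \<Rightarrow> real" where
  "delta i = (\<lambda>j. of_bool (j = i))"

lemma linD: "lin T \<Longrightarrow> T (\<lambda>i. a * p i + b * q i) = (\<lambda>i. a * T p i + b * T q i)"
  by (simp add: lin_def)

lemma lin_add: "lin T \<Longrightarrow> T (\<lambda>i. p i + q i) = (\<lambda>i. T p i + T q i)"
  using linD[of T 1 p 1 q] by simp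

lemma lin_diff: "lin T \<Longrightarrow> T (\<lambda>i. p i - q i) = (\<lambda>i. T p i - T q i)"
  using linD[of T 1 p "-1" q] by simp

lemma lin_scale: "lin T \<Longrightarrow> T (\<lambda>i. a * p i) = (\<lambda>i. a * T p i)"
  using linD[of T a p 0 p] by simp

lemma lin_zero: "lin T \<Longrightarrow> T (\<lambda>i. 0) = (\<lambda>i. 0)"
  using linD[of T 0 "\<lambda>_. 0" 0 "\<lambda>_. 0"] by simp

lemma lin_sum: "lin T \<Longrightarrow> T (\<lambda>i. \<Sum>s\<in>S. p s i) = (\<lambda>i. \<Sum>s\<in>S. T (p s) i)"
proof (induction S rule: infinite_finite_induct)
  case (insert x F)
  then show ?case using lin_add[of T "p x" "\<lambda>i. \<Sum>s\<in>F. p s i"] by simp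
qed (simp_all add: lin_zero)

lemma ip_comm: "ip I p q = ip I q p"
  by (simp add: ip_def mult.commute)

lemma ip_lin: "ip I (\<lambda>i. a * p i + b * q i) r = a * ip I p r + b * ip I q r"
  by (simp add: ip_def sum.distrib sum_distrib_left algebra_simps)

lemma ip_diff: "ip I (\<lambda>i. p i - q i) r = ip I p r - ip I q r"
  by (simp add: ip_def sum_subtractf algebra_simps)

lemma ip_add: "ip I (\<lambda>i. p i + q i) r = ip I p r + ip I q r"
  by (simp add: ip_def sum.distrib algebra_simps)

lemma ip_scale: "ip I (\<lambda>i. a * p i) r = a * ip I p r"
  by (simp add: ip_def sum_distrib_left algebra_simps)

lemma ip_lin2: "ip I r (\<lambda>i. a * p i + b * q i) = a * ip I r p + b * ip I r q"
  and ip_diff2: "ip I r (\<lambda>i. p i - q i) = ip I r p - ip I r q"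
  and ip_add2: "ip I r (\<lambda>i. p i + q i) = ip I r p + ip I r q"
  and ip_scale2: "ip I r (\<lambda>i. a * p i) = a * ip I r p"
  by (simp_all add: ip_comm[of I r] ip_lin ip_diff ip_add ip_scale)

section \<open>Orthogonal projections and reflections\<close>

lemma ip_self_eq_0:
  assumes "finite I" "p \<in> supp I" "ip I p p = 0"
  shows "p = (\<lambda>i. 0)"
proof
  fix i
  have "\<forall>i\<in>I. p i * p i = 0"
    using assms(1,3) unfolding ip_def by (subst (asm) sum_nonneg_eq_0_iff) auto
  then show "p i = 0" using assms(2) by (auto simp: supp_def)
qed

text \<open>Gram-Schmidt: \<open>P\<close> is the orthogonal projection onto the span of
  \<open>Y\<close>. The span is never mentioned; the last two clauses pin it down, since
  \<open>P\<close> fixes \<open>Y\<close> and kills whatever is orthogonal to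
  \<open>Y\<close>.\<close>

lemma projection_exists:
  fixes I :: "'i set"
  assumes "finite I" "finite Y" "Y \<subseteq> supp I"
  shows "\<exists>P :: ('i \<Rightarrow> real) \<Rightarrow> 'i \<Rightarrow> real. lin P \<and> (\<forall>p. P p \<in> supp I) \<and> (\<forall>p q. ip I (P p) q = ip I p (P q)) \<and>
    (\<forall>p. P (P p) = P p) \<and> (\<forall>y\<in>Y. P y = y) \<and>
    (\<forall>p. (\<forall>y\<in>Y. ip I p y = 0) \<longrightarrow> P p = (\<lambda>i. 0))"
  using assms(2,3)
proof (induction Y rule: finite_induct)
  case empty
  show ?case
    by (rule exI[of _ "\<lambda>p i. 0"]) (auto simp: lin_def supp_def ip_def)
next
  case (insert y Y)
  have "Y \<subseteq> supp I" using insert.prems by simp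
  from insert.IH[OF this] obtain P :: "('i \<Rightarrow> real) \<Rightarrow> 'i \<Rightarrow> real"
    where P: "lin P" "\<forall>p. P p \<in> supp I" "\<forall>p q. ip I (P p) q = ip I p (P q)"
      "\<forall>p. P (P p) = P p" "\<forall>y\<in>Y. P y = y"
      "\<forall>p. (\<forall>y\<in>Y. ip I p y = 0) \<longrightarrow> P p = (\<lambda>i. 0)"
    by (elim exE conjE) (rule that)
  note l = P(1) and s = P(2)[rule_format] and sa = P(3)[rule_format] and id = P(4)[rule_format]
    and fix_ = P(5)[rule_format] and ker = P(6)[rule_format]
  \<comment> \<open>The part of \<open>y\<close> orthogonal to the earlier vectors. If it vanishes,
    \<open>P\<close> fixes \<open>y\<close> already; otherwise the rank-one projection onto
    \<open>y'\<close> is added to \<open>P\<close>.\<close>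
  define y' where "y' = (\<lambda>i. y i - P y i)"
  have y's: "y' \<in> supp I" using s[of y] insert.prems by (auto simp: y'_def supp_def)
  have Py': "P y' = (\<lambda>i. 0)" unfolding y'_def lin_diff[OF l] id by simp
  define c where "c = ip I y' y'"
  have P0: "ip I (P p) y' = 0" for p unfolding sa Py' by (simp add: ip_def)
  show ?case
  proof (cases "c = 0")
    case True
    have "y' = (\<lambda>i. 0)" by (rule ip_self_eq_0[OF assms(1) y's]) (use True c_def in simp)
    then have "P y = y" unfolding y'_def by (auto simp: fun_eq_iff)
    then show ?thesis using l s sa id fix_ ker by (intro exI[of _ P]) blast
  next
    case False
    define Q where "Q = (\<lambda>p i. P p i + ip I p y' / c * y' i)"
    have lQ: "lin Q"
      unfolding lin_def Q_def linD[OF l] ip_lin by (auto simp: fun_eq_iff algebra_simps add_divide_distrib)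
    have sQ: "Q p \<in> supp I" for p using s[of p] y's by (auto simp: Q_def supp_def)
    have saQ: "ip I (Q p) q = ip I p (Q q)" for p q
      unfolding Q_def ip_add ip_add2 ip_scale ip_scale2 sa by (simp add: ip_comm[of I y' q])
    have idQ: "Q (Q p) = Q p" for p
    proof -
      have "P (Q p) = P p" unfolding Q_def lin_add[OF l] lin_scale[OF l] id Py' by simp
      moreover have "ip I (Q p) y' = ip I p y'"
        unfolding Q_def ip_add ip_scale P0 using False c_def by simp
      ultimately show ?thesis by (simp add: Q_def[of] fun_eq_iff)
    qed
    have ipy: "ip I y y' = c"
      using P0[of y] by (simp add: c_def y'_def ip_diff)
    have fY: "Q z = z" if "z \<in> Y" for z
      using fix_[OF that] P0[of z] by (simp add: Q_def)
    have fy: "Q y = y" using ipy False by (simp add: Q_def y'_def)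
    have kQ: "Q p = (\<lambda>i. 0)" if "\<forall>z\<in>insert y Y. ip I p z = 0" for p
    proof -
      have "P p = (\<lambda>i. 0)" using that by (intro ker) simp
      moreover have "ip I p y' = 0"
        unfolding y'_def ip_diff2 sa[symmetric] calculation using that by (simp add: ip_def)
      ultimately show ?thesis by (simp add: Q_def)
    qed
    show ?thesis using lQ sQ saQ idQ fY fy kQ by (intro exI[of _ Q]) simp
  qed
qed

text \<open>The reflection is \<open>1 - 2 P\<close> for the projection \<open>P\<close> onto the
  span of \<open>Y\<close>.\<close>

lemma reflection_exists:
  fixes I :: "'i set"
  assumes "finite I" "finite Y" "Y \<subseteq> supp I"
  obtains R :: "('i \<Rightarrow> real) \<Rightarrow> 'i \<Rightarrow> real"
  where "orth I R" "\<And>p. R (R p) = p" "\<And>y. y \<in> Y \<Longrightarrow> R y = (\<lambda>i. - y i)"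
    "\<forall>p. (\<forall>y\<in>Y. ip I p y = 0) \<longrightarrow> R p = p"
proof -
  obtain P :: "('i \<Rightarrow> real) \<Rightarrow> 'i \<Rightarrow> real"
    where P: "lin P" "\<forall>p. P p \<in> supp I" "\<forall>p q. ip I (P p) q = ip I p (P q)"
      "\<forall>p. P (P p) = P p" "\<forall>y\<in>Y. P y = y"
      "\<forall>p. (\<forall>y\<in>Y. ip I p y = 0) \<longrightarrow> P p = (\<lambda>i. 0)"
    using projection_exists[OF assms] by (elim exE conjE) (rule that)
  note l = P(1) and s = P(2)[rule_format] and sa = P(3)[rule_format] and id = P(4)[rule_format]
    and fix_ = P(5)[rule_format] and ker = P(6)[rule_format]
  define R where "R = (\<lambda>p i. p i - 2 * P p i)"
  have lR: "lin R" unfolding lin_def R_def linD[OF l] by (auto simp: algebra_simps)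
  have "ip I (R p) (R p) = ip I p p" for p
    unfolding R_def ip_diff ip_diff2 ip_scale ip_scale2 sa id by simp
  moreover have "R p \<in> supp I" if "p \<in> supp I" for p
    using that s[of p] by (auto simp: R_def supp_def)
  ultimately have o: "orth I R" using lR by (simp add: orth_def)
  have inv: "R (R p) = p" for p
    unfolding R_def lin_diff[OF l] lin_scale[OF l] id by simp
  show ?thesis
    by (rule that[OF o inv]) (auto simp: R_def fix_ ker)
qed

text \<open>Reflect along all differences \<open>p j - q j\<close>. The two hypotheses on inner
  products say together that each sum \<open>p j + q j\<close> is orthogonal to each difference. So
  sums are fixed while differences are negated, which exchanges \<open>p j\<close> and
  \<open>q j\<close>.\<close>

lemma swap_exists:
  fixes I :: "'i set" and p q :: "'j \<Rightarrow> 'i \<Rightarrow> real"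
  assumes "finite I" "finite J" "\<And>j. j \<in> J \<Longrightarrow> p j \<in> supp I" "\<And>j. j \<in> J \<Longrightarrow> q j \<in> supp I"
    and "\<And>j k. j \<in> J \<Longrightarrow> k \<in> J \<Longrightarrow> ip I (p j) (p k) = ip I (q j) (q k)"
    and "\<And>j k. j \<in> J \<Longrightarrow> k \<in> J \<Longrightarrow> ip I (p j) (q k) = ip I (q j) (p k)"
  obtains R where "orth I R" "\<And>p. R (R p) = p" "\<And>j. j \<in> J \<Longrightarrow> R (p j) = q j"
proof -
  have "(\<lambda>j i. p j i - q j i) ` J \<subseteq> supp I" using assms(3,4) by (auto simp: supp_def)
  note * = reflection_exists[OF assms(1) finite_imageI[OF assms(2)] this]
  obtain R :: "('i \<Rightarrow> real) \<Rightarrow> 'i \<Rightarrow> real"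
    where o: "orth I R" and inv: "\<And>p. R (R p) = p"
      and neg: "\<And>y. y \<in> (\<lambda>j i. p j i - q j i) ` J \<Longrightarrow> R y = (\<lambda>i. - y i)"
      and "\<forall>p'. (\<forall>y\<in>(\<lambda>j i. p j i - q j i) ` J. ip I p' y = 0) \<longrightarrow> R p' = p'"
    by (rule *) (rule that)
  note fix_ = this(4)[rule_format]
  have l: "lin R" using o by (simp add: orth_def)
  have "R (p j) = q j" if j: "j \<in> J" for j
  proof -
    have a: "R (\<lambda>i. p j i - q j i) = (\<lambda>i. - (p j i - q j i))"
      using j by (intro neg) auto
    have b: "R (\<lambda>i. p j i + q j i) = (\<lambda>i. p j i + q j i)"
      using assms(5,6)[OF j] by (intro fix_) (auto simp: ip_add ip_diff2)
    have "R (p j) i = q j i" for i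
      using fun_cong[OF a[unfolded lin_diff[OF l]], of i] fun_cong[OF b[unfolded lin_add[OF l]], of i]
      by linarith
    then show ?thesis by auto
  qed
  then show ?thesis by (rule that[OF o inv])
qed

lemma orth_comp: "orth I S \<Longrightarrow> orth I T \<Longrightarrow> orth I (\<lambda>p. S (T p))"
  by (auto simp: orth_def lin_def)

text \<open>Polarisation: the norms of \<open>p\<close>, \<open>q\<close> and \<open>p + q\<close>
  determine the inner product.\<close>

lemma orth_ip:
  assumes "orth I T" "p \<in> supp I" "q \<in> supp I"
  shows "ip I (T p) (T q) = ip I p q"
proof -
  have l: "lin T" using assms by (simp add: orth_def)
  have "(\<lambda>i. p i + q i) \<in> supp I" using assms by (auto simp: supp_def)
  then have "ip I (T (\<lambda>i. p i + q i)) (T (\<lambda>i. p i + q i)) = ip I (\<lambda>i. p i + q i) (\<lambda>i. p i + q i)"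
    using assms(1) by (auto simp: orth_def)
  moreover have "ip I (T p) (T p) = ip I p p" "ip I (T q) (T q) = ip I q q"
    using assms by (auto simp: orth_def)
  ultimately show ?thesis
    unfolding lin_add[OF l] ip_add ip_add2 by (simp add: ip_comm[of I q p] ip_comm[of I "T q" "T p"])
qed

lemma delta_supp: "i \<in> I \<Longrightarrow> delta i \<in> supp I"
  by (auto simp: delta_def supp_def)

lemma ip_delta: "finite I \<Longrightarrow> i \<in> I \<Longrightarrow> ip I (delta i) p = p i"
  by (simp add: ip_def delta_def if_distrib[where f="\<lambda>z. z * _"] of_bool_def cong: if_cong)

lemma delta_expand: "finite I \<Longrightarrow> p \<in> supp I \<Longrightarrow> p = (\<lambda>k. \<Sum>i\<in>I. p i * delta i k)"
  by (auto simp: delta_def supp_def fun_eq_iff of_bool_def if_distrib[where f="\<lambda>z. _ * z"] cong: if_cong)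

lemma lin_expand:
  assumes "lin T" "finite I" "p \<in> supp I"
  shows "T p = (\<lambda>k. \<Sum>i\<in>I. p i * T (delta i) k)"
  by (subst delta_expand[OF assms(2,3)]) (simp only: lin_sum[OF assms(1)] lin_scale[OF assms(1)])

section \<open>Orthogonal operators as unitary matrices\<close>

definition orth_mat :: "nat \<Rightarrow> ((nat \<Rightarrow> real) \<Rightarrow> nat \<Rightarrow> real) \<Rightarrow> complex mat" where
  "orth_mat N T = mat N N (\<lambda>(r, c). complex_of_real (T (delta c) r))"

lemma orth_mat_unitary:
  assumes "orth {..<N} T"
  shows "unitary_mat N (orth_mat N T)"
proof -
  have c: "orth_mat N T \<in> carrier_mat N N" by (simp add: orth_mat_def)
  have ca: "mat_adjoint (orth_mat N T) \<in> carrier_mat N N"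
    by (auto simp: mat_adjoint_def orth_mat_def)
  have "mat_adjoint (orth_mat N T) * orth_mat N T = 1\<^sub>m N"
  proof (rule eq_matI)
    fix i j assume "i < dim_row (1\<^sub>m N :: complex mat)" "j < dim_col (1\<^sub>m N :: complex mat)"
    then have ij: "i < N" "j < N" by auto
    have "(mat_adjoint (orth_mat N T) * orth_mat N T) $$ (i, j) =
      complex_of_real (ip {..<N} (T (delta i)) (T (delta j)))"
      using ij by (auto simp: mat_adjoint_def orth_mat_def scalar_prod_def ip_def mat_of_rows_def atLeast0LessThan)
    also have "\<dots> = complex_of_real (ip {..<N} (delta i) (delta j))"
      using ij by (subst orth_ip[OF assms]) (auto intro: delta_supp)
    also have "\<dots> = 1\<^sub>m N $$ (i, j)"
      using ij by (simp add: ip_delta) (simp add: delta_def)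
    finally show "(mat_adjoint (orth_mat N T) * orth_mat N T) $$ (i, j) = 1\<^sub>m N $$ (i, j)" .
  qed (use c ca in auto)
  then show ?thesis
    using c mat_mult_left_right_inverse[OF ca c] by (simp add: unitary_mat_def)
qed

definition rvec :: "nat \<Rightarrow> (nat \<Rightarrow> real) \<Rightarrow> complex vec" where
  "rvec N p = vec N (\<lambda>i. complex_of_real (p i))"

lemma orth_mat_mult:
  assumes "orth {..<N} T" "p \<in> supp {..<N}"
  shows "orth_mat N T *\<^sub>v rvec N p = rvec N (T p)"
proof -
  have "T p = (\<lambda>k. \<Sum>i<N. p i * T (delta i) k)"
    using assms by (intro lin_expand) (auto simp: orth_def)
  then show ?thesis
    by (intro eq_vecI) (auto simp: orth_mat_def rvec_def scalar_prod_def atLeast0LessThan mult.commute)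
qed

section \<open>Phase query algorithms and the clock register\<close>

definition nrm :: "'i set \<Rightarrow> ('i \<Rightarrow> real) \<Rightarrow> real" where
  "nrm I p = sqrt (ip I p p)"

lemma nrm_L2_set: "nrm I p = L2_set p I"
  by (simp add: nrm_def ip_def L2_set_def power2_eq_square)

lemma nrm_ge_0: "0 \<le> nrm I p"
  by (simp add: nrm_L2_set)

lemma nrm_triangle: "nrm I (\<lambda>i. p i + q i) \<le> nrm I p + nrm I q"
  by (simp add: nrm_L2_set L2_set_triangle_ineq)

lemma nrm_scale: "nrm I (\<lambda>i. a * p i) = \<bar>a\<bar> * nrm I p"
  by (simp add: nrm_def ip_scale ip_scale2 real_sqrt_mult mult.assoc[symmetric])

lemma nrm_diff: "nrm I (\<lambda>i. p i - q i) \<le> nrm I p + nrm I q"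
  using nrm_triangle[of I p "\<lambda>i. -1 * q i"] nrm_scale[of I "-1" q] by simp

lemma nrm_orth: "orth I T \<Longrightarrow> p \<in> supp I \<Longrightarrow> nrm I (T p) = nrm I p"
  by (simp add: nrm_def orth_def)

lemma supp_lin: "p \<in> supp I \<Longrightarrow> q \<in> supp I \<Longrightarrow> (\<lambda>i. a * p i + b * q i) \<in> supp I"
  by (simp add: supp_def)

lemma supp_diff: "p \<in> supp I \<Longrightarrow> q \<in> supp I \<Longrightarrow> (\<lambda>i. p i - q i) \<in> supp I"
  by (simp add: supp_def)

lemma supp_scale: "p \<in> supp I \<Longrightarrow> (\<lambda>i. a * p i) \<in> supp I"
  by (simp add: supp_def)

lemma orth_supp: "orth I T \<Longrightarrow> p \<in> supp I \<Longrightarrow> T p \<in> supp I"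
  by (simp add: orth_def)

lemma orth_lin: "orth I T \<Longrightarrow> lin T"
  by (simp add: orth_def)

lemma orth_funpow: "orth I T \<Longrightarrow> orth I (T ^^ t)"
proof (induction t)
  case 0
  then show ?case by (simp add: orth_def lin_def)
next
  case (Suc t)
  then show ?case using orth_comp[of I T "T ^^ t"] by (simp add: comp_def)
qed

text \<open>An intermediate language with phase queries in place of bit queries: amplitudes stay
  real, and each basis state selects its own input bit, or none. The translation into circuits is
  \<open>qalgorithm_of_steps\<close>.\<close>

datatype ('i, 'l) step = Op "('i \<Rightarrow> real) \<Rightarrow> 'i \<Rightarrow> real" | Qry "'i \<Rightarrow> 'l option"

definition phase :: "('i \<Rightarrow> 'l option) \<Rightarrow> ('l \<Rightarrow> bool) \<Rightarrow> ('i \<Rightarrow> real) \<Rightarrow> 'i \<Rightarrow> real" where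
  "phase lab x p = (\<lambda>i. case lab i of None \<Rightarrow> p i | Some l \<Rightarrow> if x l then - p i else p i)"

primrec exec_step :: "('l \<Rightarrow> bool) \<Rightarrow> ('i, 'l) step \<Rightarrow> ('i \<Rightarrow> real) \<Rightarrow> 'i \<Rightarrow> real" where
  "exec_step x (Op T) = T"
| "exec_step x (Qry lab) = phase lab x"

definition exec :: "('l \<Rightarrow> bool) \<Rightarrow> ('i, 'l) step list \<Rightarrow> ('i \<Rightarrow> real) \<Rightarrow> 'i \<Rightarrow> real" where
  "exec x ss p = fold (exec_step x) ss p"

primrec wf_step :: "'i set \<Rightarrow> 'l set \<Rightarrow> ('i, 'l) step \<Rightarrow> bool" where
  "wf_step I L (Op T) \<longleftrightarrow> orth I T"
| "wf_step I L (Qry lab) \<longleftrightarrow> (\<forall>i\<in>I. \<forall>l. lab i = Some l \<longrightarrow> l \<in> L)"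

primrec step_cost :: "('i, 'l) step \<Rightarrow> nat" where
  "step_cost (Op T) = 0"
| "step_cost (Qry lab) = 1"

lemma orth_phase: "orth I (phase lab x)"
proof -
  have "phase lab x p i * phase lab x p i = p i * p i" for p i
    by (simp add: phase_def split: option.split)
  then show ?thesis
    by (auto simp: orth_def lin_def supp_def ip_def) (auto simp: phase_def fun_eq_iff split: option.split)
qed

lemma phase_phase: "phase lab x (phase lab x p) = p"
  by (auto simp: phase_def fun_eq_iff split: option.split)

text \<open>\<open>Inr (t, b)\<close> is basis state \<open>b\<close> at clock reading
  \<open>t\<close>. The additional states \<open>Inl c\<close> with \<open>c < M\<close> hold the
  final answers, and \<open>Inl M\<close> is the start state.\<close>

definition clock_index :: "nat \<Rightarrow> nat \<Rightarrow> 'b set \<Rightarrow> (nat + nat \<times> 'b) set" where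
  "clock_index M K B = Inl ` {..M} \<union> Inr ` ({..<K} \<times> B)"

text \<open>Used for all \<open>s < K - 1\<close> in turn: a branch with reading
  \<open>t < K\<close> is hit at the times \<open>s < t\<close>, so it receives
  \<open>T ^^ t\<close>.\<close>

definition controlled :: "nat \<Rightarrow> (('b \<Rightarrow> real) \<Rightarrow> 'b \<Rightarrow> real) \<Rightarrow> (nat + nat \<times> 'b \<Rightarrow> real) \<Rightarrow> nat + nat \<times> 'b \<Rightarrow> real" where
  "controlled s T p = (\<lambda>i. case i of Inl c \<Rightarrow> p (Inl c)
     | Inr (t, b) \<Rightarrow> if s < t then T (\<lambda>b. p (Inr (t, b))) b else p (Inr (t, b)))"

definition spread :: "nat \<Rightarrow> ('b \<Rightarrow> real) \<Rightarrow> nat + nat \<times> 'b \<Rightarrow> real" where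
  "spread K v = (\<lambda>i. case i of Inl c \<Rightarrow> 0 | Inr (t, b) \<Rightarrow> if t < K then v b / sqrt K else 0)"

text \<open>The reflection that negates the component uniform in the clock and fixes its orthogonal
  complement.\<close>

definition clock_reflection :: "nat \<Rightarrow> (nat + nat \<times> 'b \<Rightarrow> real) \<Rightarrow> nat + nat \<times> 'b \<Rightarrow> real" where
  "clock_reflection K p = (\<lambda>i. case i of Inl c \<Rightarrow> p (Inl c)
     | Inr (t, b) \<Rightarrow> if t < K then p (Inr (t, b)) - 2 / K * (\<Sum>t'<K. p (Inr (t', b))) else p (Inr (t, b)))"

lemma finite_clock_index: "finite B \<Longrightarrow> finite (clock_index M K B)"
  by (simp add: clock_index_def)

lemma ip_clock_index:
  assumes "finite B"
  shows "ip (clock_index M K B) p q = (\<Sum>c\<le>M. p (Inl c) * q (Inl c))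
    + (\<Sum>t<K. ip B (\<lambda>b. p (Inr (t, b))) (\<lambda>b. q (Inr (t, b))))"
  unfolding ip_def clock_index_def using assms
  by (subst sum.union_disjoint) (auto simp: sum.reindex sum.cartesian_product)

lemma orth_controlled:
  assumes "orth B T" "finite B"
  shows "orth (clock_index M K B) (controlled s T)"
proof -
  have l: "lin T" using assms by (simp add: orth_def)
  have "lin (controlled s T)"
    unfolding lin_def
  proof (intro allI ext)
    fix a b and p q :: "nat + nat \<times> 'a \<Rightarrow> real" and i
    show "controlled s T (\<lambda>i. a * p i + b * q i) i = a * controlled s T p i + b * controlled s T q i"
    proof (cases i)
      case (Inr tb)
      obtain t b' where "tb = (t, b')" by force
      then show ?thesis
        using Inr linD[OF l, of a "\<lambda>b. p (Inr (t, b))" b "\<lambda>b. q (Inr (t, b))"]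
        by (simp add: controlled_def)
    qed (simp add: controlled_def)
  qed
  moreover have "controlled s T p \<in> supp (clock_index M K B) \<and> ip (clock_index M K B) (controlled s T p) (controlled s T p) = ip (clock_index M K B) p p"
    if p: "p \<in> supp (clock_index M K B)" for p
  proof -
    have s: "(\<lambda>b. p (Inr (t, b))) \<in> supp B" for t
      using p by (auto simp: supp_def clock_index_def)
    have z: "(\<lambda>b. p (Inr (t, b))) = (\<lambda>b. 0)" if "\<not> t < K" for t
      using p that by (auto simp: supp_def clock_index_def)
    have 1: "controlled s T p i = 0" if "i \<notin> clock_index M K B" for i
    proof (cases i)
      case (Inl c)
      then show ?thesis using p that by (auto simp: supp_def controlled_def)
    next
      case (Inr tb)
      obtain t b where tb: "tb = (t, b)" by force
      show ?thesis
      proof (cases "t < K")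
        case True
        then have "b \<notin> B" using that Inr tb by (auto simp: clock_index_def)
        moreover have "T (\<lambda>b. p (Inr (t, b))) \<in> supp B" using assms(1) s by (simp add: orth_def)
        ultimately show ?thesis using s[of t] Inr tb by (simp add: controlled_def supp_def)
      next
        case False
        then show ?thesis using z[OF False] lin_zero[OF l] fun_cong[OF z[OF False], of b] Inr tb by (simp add: controlled_def)
      qed
    qed
    have "ip B (\<lambda>b. controlled s T p (Inr (t, b))) (\<lambda>b. controlled s T p (Inr (t, b))) =
       ip B (\<lambda>b. p (Inr (t, b))) (\<lambda>b. p (Inr (t, b)))" for t
      using assms(1) s[of t] by (cases "s < t") (simp_all add: controlled_def orth_def)
    then have 2: "ip (clock_index M K B) (controlled s T p) (controlled s T p) = ip (clock_index M K B) p p"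
      unfolding ip_clock_index[OF assms(2)] by (simp add: controlled_def)
    show ?thesis using 1 2 by (auto simp: supp_def)
  qed
  ultimately show ?thesis by (simp add: orth_def)
qed

lemma controlled_comp: "controlled s S (controlled s T p) = controlled s (\<lambda>p. S (T p)) p"
  by (auto simp: controlled_def fun_eq_iff split: sum.split)

lemma controlled_id: "(\<And>p. S (T p) = p) \<Longrightarrow> controlled s S (controlled s T p) = p"
  unfolding controlled_comp by (auto simp: controlled_def fun_eq_iff split: sum.split)

lemma spread_supp: "v \<in> supp B \<Longrightarrow> spread K v \<in> supp (clock_index M K B)"
  by (auto simp: spread_def supp_def clock_index_def image_iff split: sum.split)

lemma lin_spread: "lin (spread K)"
  by (auto simp: spread_def lin_def fun_eq_iff add_divide_distrib split: sum.split)

lemma ip_spread: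
  assumes "finite B" "0 < K"
  shows "ip (clock_index M K B) (spread K v) (spread K w) = ip B v w"
proof -
  have "ip B (\<lambda>b. spread K v (Inr (t, b))) (\<lambda>b. spread K w (Inr (t, b))) = ip B v w / K" if "t < K" for t
    using that by (simp add: spread_def ip_def sum_divide_distrib)
  then show ?thesis unfolding ip_clock_index[OF assms(1)] using assms(2) by (simp add: spread_def)
qed

lemma nrm_spread: "finite B \<Longrightarrow> 0 < K \<Longrightarrow> nrm (clock_index M K B) (spread K v) = nrm B v"
  by (simp add: nrm_def ip_spread)

lemma orth_clock_reflection:
  assumes "finite B" "0 < K"
  shows "orth (clock_index M K B) (clock_reflection K)"
proof -
  have "lin (clock_reflection K :: (nat + nat \<times> 'a \<Rightarrow> real) \<Rightarrow> _)"
    unfolding lin_def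
  proof (intro allI ext)
    fix a b and p q :: "nat + nat \<times> 'a \<Rightarrow> real" and i
    show "clock_reflection K (\<lambda>i. a * p i + b * q i) i = a * clock_reflection K p i + b * clock_reflection K q i"
      by (auto simp: clock_reflection_def sum.distrib sum_distrib_left[symmetric] algebra_simps add_divide_distrib split: sum.split)
  qed
  moreover have "clock_reflection K p \<in> supp (clock_index M K B)" if "p \<in> supp (clock_index M K B)" for p
    using that by (auto simp: clock_reflection_def supp_def clock_index_def image_iff split: sum.split)
  moreover have "ip (clock_index M K B) (clock_reflection K p) (clock_reflection K p) = ip (clock_index M K B) p p" for p :: "nat + nat \<times> 'a \<Rightarrow> real"
  proof -
    have "(\<Sum>t<K. clock_reflection K p (Inr (t, b)) * clock_reflection K p (Inr (t, b))) = (\<Sum>t<K. p (Inr (t, b)) * p (Inr (t, b)))" for b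
    proof -
      \<comment> \<open>After squaring, the cross terms sum to \<open>- 4 S^2 / K\<close> and the
        constant terms to \<open>4 S^2 / K\<close>, so they cancel.\<close>
      define S where "S = (\<Sum>t<K. p (Inr (t, b)))"
      have "(\<Sum>t<K. clock_reflection K p (Inr (t, b)) * clock_reflection K p (Inr (t, b))) =
        (\<Sum>t<K. p (Inr (t, b)) * p (Inr (t, b)) - 4 / K * S * p (Inr (t, b)) + 4 / K * S * (S / K))"
        by (intro sum.cong refl) (simp add: clock_reflection_def S_def[symmetric] field_simps)
      also have "\<dots> = (\<Sum>t<K. p (Inr (t, b)) * p (Inr (t, b))) - 4 / K * S * S + K * (4 / K * S * (S / K))"
        unfolding sum.distrib sum_subtractf sum_distrib_left[symmetric] S_def[symmetric] by simp
      finally show ?thesis using assms(2) by simp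
    qed
    then have "(\<Sum>t<K. ip B (\<lambda>b. clock_reflection K p (Inr (t, b))) (\<lambda>b. clock_reflection K p (Inr (t, b)))) =
       (\<Sum>t<K. ip B (\<lambda>b. p (Inr (t, b))) (\<lambda>b. p (Inr (t, b))))"
      unfolding ip_def by (subst (1 2) sum.swap) simp
    then show ?thesis unfolding ip_clock_index[OF assms(1)] by (simp add: clock_reflection_def)
  qed
  ultimately show ?thesis by (simp add: orth_def)
qed

lemma fold_controlled_Inr:
  "fold (\<lambda>s. controlled s U) [0..<m] p (Inr (t, b)) = (U ^^ min t m) (\<lambda>b. p (Inr (t, b))) b"
proof (induction m arbitrary: b)
  case (Suc m)
  show ?case
  proof (cases "m < t")
    case True
    then have "min t (Suc m) = Suc (min t m)" by simp
    then show ?thesis using True Suc by (simp add: controlled_def)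
  next
    case False
    then show ?thesis using Suc by (simp add: controlled_def)
  qed
qed simp

lemma fold_controlled_Inl: "fold (\<lambda>s. controlled s U) [0..<m] p (Inl c) = p (Inl c)"
  by (induction m) (simp_all add: controlled_def)

lemma fold_controlled_inverse:
  assumes "\<And>p. V (U p) = p"
  shows "fold (\<lambda>s. controlled s V) (rev [0..<m]) (fold (\<lambda>s. controlled s U) [0..<m] p) = p"
  by (induction m) (simp_all add: controlled_id assms)

lemma orth_fold: "(\<And>s. s \<in> set ss \<Longrightarrow> orth I (T s)) \<Longrightarrow> orth I (fold T ss)"
proof (induction ss)
  case Nil
  then show ?case by (simp add: orth_def lin_def)
next
  case (Cons s ss)
  then show ?case using orth_comp[of I "fold T ss" "T s"] by (simp add: comp_def)
qed

text \<open>\<open>G\<close> applies the clocked powers of \<open>U\<close>, reflects the clock and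
  undoes the powers through \<open>V\<close>. The fixed vector \<open>\<phi>\<close> remains uniform
  in the clock and is negated exactly. \<open>vm\<close> survives up to twice its average over the
  powers of \<open>U\<close>, which telescopes. The error \<open>\<eta>\<close> enters twice,
  directly and through the isometry \<open>G\<close>.\<close>

lemma kickback:
  fixes U V :: "('b \<Rightarrow> real) \<Rightarrow> 'b \<Rightarrow> real" and \<phi> \<eta> w vm :: "'b \<Rightarrow> real"
  assumes B: "finite B" and K: "0 < K" and U: "orth B U" and V: "orth B V"
    and VU: "\<And>p. V (U p) = p"
    and supp: "\<phi> \<in> supp B" "\<eta> \<in> supp B" "w \<in> supp B"
    and \<phi>: "U \<phi> = \<phi>" and w: "U w = (\<lambda>b. w b - 2 * vm b)"
  defines "G \<equiv> \<lambda>p. fold (\<lambda>s. controlled s V) (rev [0..<K-1]) (clock_reflection K (fold (\<lambda>s. controlled s U) [0..<K-1] p))"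
  shows "\<exists>e \<in> supp (clock_index M K B).
    G (spread K (\<lambda>b. \<phi> b - \<eta> b + vm b)) = (\<lambda>i. spread K (\<lambda>b. vm b - (\<phi> b - \<eta> b)) i + e i) \<and>
    nrm (clock_index M K B) e \<le> 2 * nrm B \<eta> + 2 * nrm B w / K"
proof -
  define I where "I = clock_index M K B"
  define \<Lambda> where "\<Lambda> = fold (\<lambda>s. controlled s U) [0..<K-1]"
  define \<Lambda>' where "\<Lambda>' = fold (\<lambda>s. controlled s V) (rev [0..<K-1])"
  define avg where "avg = (\<lambda>u b. (1 / K) * (\<Sum>t<K. (U ^^ t) u b))"
  have G: "G p = \<Lambda>' (clock_reflection K (\<Lambda> p))" for p by (simp add: G_def \<Lambda>_def \<Lambda>'_def)
  have o\<Lambda>: "orth I \<Lambda>" and o\<Lambda>': "orth I \<Lambda>'"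
    unfolding \<Lambda>_def \<Lambda>'_def I_def by (rule orth_fold, rule orth_controlled[OF _ B], rule U V)+
  have oG: "orth I G"
    unfolding G[abs_def] by (rule orth_comp[OF o\<Lambda>' orth_comp[OF orth_clock_reflection[OF B K, of M, folded I_def] o\<Lambda>]])
  have inv: "\<Lambda>' (\<Lambda> p) = p" for p
    unfolding \<Lambda>_def \<Lambda>'_def by (rule fold_controlled_inverse, rule VU)
  have lU: "lin (U ^^ t)" for t using orth_funpow[OF U] by (rule orth_lin)
  have \<Lambda>spread: "\<Lambda> (spread K u) (Inr (t, b)) = (if t < K then (U ^^ t) u b / sqrt K else 0)" for u t b
  proof (cases "t < K")
    case True
    then have "min t (K - 1) = t" by simp
    then have "\<Lambda> (spread K u) (Inr (t, b)) = (U ^^ t) (\<lambda>b. (1 / sqrt K) * u b) b"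
      unfolding \<Lambda>_def fold_controlled_Inr using True by (simp add: spread_def)
    then show ?thesis using True unfolding lin_scale[OF lU] by simp
  next
    case False
    then show ?thesis
      unfolding \<Lambda>_def fold_controlled_Inr by (simp add: spread_def lin_zero[OF lU])
  qed
  have clock_reflection\<Lambda>: "clock_reflection K (\<Lambda> (spread K u)) = (\<lambda>i. \<Lambda> (spread K u) i - 2 * spread K (avg u) i)" for u
  proof
    fix i
    show "clock_reflection K (\<Lambda> (spread K u)) i = \<Lambda> (spread K u) i - 2 * spread K (avg u) i"
    proof (cases i)
      case (Inl c)
      then show ?thesis by (simp add: clock_reflection_def spread_def)
    next
      case (Inr tb)
      obtain t b where tb: "tb = (t, b)" by force
      have "(\<Sum>t'<K. \<Lambda> (spread K u) (Inr (t', b))) = (\<Sum>t'<K. (U ^^ t') u b) / sqrt K"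
        by (simp add: \<Lambda>spread sum_divide_distrib)
      then show ?thesis using Inr tb K by (simp add: clock_reflection_def spread_def avg_def)
    qed
  qed
  \<comment> \<open>The reflection only subtracts twice the clock average; undoing the powers
    restores everything else.\<close>
  have Gs: "G (spread K u) = (\<lambda>i. spread K u i - 2 * \<Lambda>' (spread K (avg u)) i)" for u
    unfolding G clock_reflection\<Lambda> lin_diff[OF orth_lin[OF o\<Lambda>']] lin_scale[OF orth_lin[OF o\<Lambda>']] inv ..
  have U\<phi>: "(U ^^ t) \<phi> = \<phi>" for t by (induction t) (simp_all add: \<phi>)
  have "\<Lambda> (spread K \<phi>) = spread K \<phi>"
  proof
    fix i show "\<Lambda> (spread K \<phi>) i = spread K \<phi> i"
    proof (cases i)
      case (Inl c)
      then show ?thesis by (simp add: \<Lambda>_def fold_controlled_Inl)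
    next
      case (Inr tb)
      obtain t b where "tb = (t, b)" by force
      then show ?thesis unfolding Inr by (simp only: \<Lambda>spread U\<phi>) (simp add: spread_def)
    qed
  qed
  then have \<Lambda>'\<phi>: "\<Lambda>' (spread K \<phi>) = spread K \<phi>" using inv by metis
  have avg\<phi>: "avg \<phi> = \<phi>" unfolding avg_def U\<phi> using K by (simp add: fun_eq_iff)
  have G\<phi>: "G (spread K \<phi>) = (\<lambda>i. - spread K \<phi> i)" unfolding Gs avg\<phi> \<Lambda>'\<phi> by auto
  \<comment> \<open>Solving the hypothesis on \<open>w\<close> for \<open>vm\<close> turns
    \<open>(U ^^ t) vm\<close> into half the difference of consecutive iterates of
    \<open>w\<close>.\<close>
  have vm: "vm = (\<lambda>b. 1/2 * w b - 1/2 * U w b)" unfolding w by (auto simp: field_simps)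
  have Uvm: "(U ^^ t) vm b = 1/2 * (U ^^ t) w b - 1/2 * (U ^^ Suc t) w b" for t b
    unfolding vm lin_diff[OF lU] lin_scale[OF lU] by (simp add: funpow_swap1)
  have sUvm: "(\<Sum>t<K. (U ^^ t) vm b) = 1/2 * (w b - (U ^^ K) w b)" for b
    using sum_lessThan_telescope'[of "\<lambda>t. (U ^^ t) w b" K]
    unfolding Uvm right_diff_distrib[symmetric] sum_distrib_left[symmetric] by simp
  have avg_vm: "avg vm = (\<lambda>b. (1 / (2 * K)) * (w b - (U ^^ K) w b))"
    unfolding avg_def sUvm by (simp add: mult.commute)
  have Us: "(U ^^ K) w \<in> supp B" using orth_supp[OF orth_funpow[OF U] supp(3)] .
  have avs: "avg vm \<in> supp B"
    unfolding avg_vm by (intro supp_scale supp_diff supp(3) Us)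
  have "nrm B (avg vm) \<le> (1 / (2 * K)) * (nrm B w + nrm B ((U ^^ K) w))"
    unfolding avg_vm nrm_scale by (simp add: divide_right_mono nrm_diff)
  also have "\<dots> = nrm B w / K"
    using nrm_orth[OF orth_funpow[OF U] supp(3), of K] by simp
  finally have avn: "nrm B (avg vm) \<le> nrm B w / K" .
  \<comment> \<open>Since \<open>G\<close> is linear, the state becomes \<open>- \<phi>\<close>,
    minus \<open>G\<close> of \<open>\<eta>\<close>, plus \<open>vm\<close> minus twice the average.
    Subtracting the desired \<open>vm - \<phi> + \<eta>\<close> leaves \<open>e\<close>.\<close>
  define e where "e = (\<lambda>i. - 1 * (spread K \<eta> i + G (spread K \<eta>) i) + (- 2) * \<Lambda>' (spread K (avg vm)) i)"
  have sp: "spread K \<eta> \<in> supp I" "spread K (avg vm) \<in> supp I"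
    unfolding I_def by (intro spread_supp supp avs)+
  have "e \<in> supp I"
    unfolding e_def using sp(1) orth_supp[OF oG sp(1)] orth_supp[OF o\<Lambda>' sp(2)] by (simp add: supp_def)
  moreover have "G (spread K (\<lambda>b. \<phi> b - \<eta> b + vm b)) = (\<lambda>i. spread K (\<lambda>b. vm b - (\<phi> b - \<eta> b)) i + e i)"
    unfolding lin_add[OF lin_spread] lin_diff[OF lin_spread] lin_add[OF orth_lin[OF oG]] lin_diff[OF orth_lin[OF oG]]
      G\<phi> by (simp add: e_def Gs[of vm] fun_eq_iff)
  moreover have "nrm I e \<le> 2 * nrm B \<eta> + 2 * nrm B w / K"
  proof -
    have "nrm I e \<le> nrm I (\<lambda>i. spread K \<eta> i + G (spread K \<eta>) i) + 2 * nrm I (\<Lambda>' (spread K (avg vm)))"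
      using nrm_triangle[of I "\<lambda>i. - 1 * (spread K \<eta> i + G (spread K \<eta>) i)" "\<lambda>i. (- 2) * \<Lambda>' (spread K (avg vm)) i"]
      unfolding e_def nrm_scale[of I "- 1"] nrm_scale[of I "- 2"] by (simp only: abs_neg_one abs_neg_numeral mult_1)
    moreover have "nrm I (\<lambda>i. spread K \<eta> i + G (spread K \<eta>) i) \<le> nrm B \<eta> + nrm B \<eta>"
      using nrm_triangle[of I "spread K \<eta>" "G (spread K \<eta>)"] nrm_orth[OF oG sp(1)] nrm_spread[OF B K, of M \<eta>]
      by (simp add: I_def)
    moreover have "nrm I (\<Lambda>' (spread K (avg vm))) = nrm B (avg vm)"
      using nrm_orth[OF o\<Lambda>' sp(2)] nrm_spread[OF B K, of M "avg vm"] by (simp add: I_def)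
    ultimately show ?thesis using avn by simp
  qed
  ultimately show ?thesis unfolding I_def by blast
qed

section \<open>From a dual adversary solution to an algorithm\<close>

text \<open>
  The target state assigns to a set \<open>a\<close> of answers the sign of \<open>c \<in> a\<close>, where \<open>c\<close> is the right
  answer. These sign vectors are orthogonal, so a last unitary can map each of them to its \<open>c\<close>.
\<close>

lemma sum_char_subsets:
  assumes "c < M" "c' < M"
  shows "(\<Sum>a\<in>Pow {..<M}. (if c \<in> a then - 1 else 1) * (if c' \<in> a then - 1 else (1::real))) =
    (if c = c' then 2 ^ M else 0)"
proof (cases "c = c'")
  case True
  have "(\<Sum>a\<in>Pow {..<M}. (if c \<in> a then - 1 else 1) * (if c' \<in> a then - 1 else (1::real))) =
    (\<Sum>a\<in>Pow {..<M}. 1)" using True by (intro sum.cong) auto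
  then show ?thesis using True by (simp add: card_Pow)
next
  case False
  let ?f = "\<lambda>a. (if c \<in> a then - 1 else 1) * (if c' \<in> a then - 1 else (1::real))"
  \<comment> \<open>Toggling the membership of \<open>c\<close> is an involution that reverses the
    sign of each summand, as \<open>c'\<close> is unaffected.\<close>
  let ?t = "\<lambda>a. if c \<in> a then a - {c} else insert c a"
  have "sum ?f (Pow {..<M}) = (\<Sum>a\<in>Pow {..<M}. - ?f a)"
    by (rule sum.reindex_bij_witness[of _ ?t ?t]) (use False assms in \<open>auto split: if_splits\<close>)
  then show ?thesis using False by (simp add: sum_negf)
qed

lemma exec_append: "exec x (ss @ ts) p = exec x ts (exec x ss p)"
  by (simp add: exec_def)

lemma exec_concat: "exec x (concat (map f ss)) p = fold (\<lambda>s. exec x (f s)) ss p"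
  by (induction ss arbitrary: p) (simp_all add: exec_append, simp add: exec_def)

text \<open>A clock-controlled phase query is again one phase query: inactive branches just carry no
  label.\<close>

definition controlled_label :: "nat \<Rightarrow> ('b \<Rightarrow> 'l option) \<Rightarrow> nat + nat \<times> 'b \<Rightarrow> 'l option" where
  "controlled_label s lab i = (case i of Inl c \<Rightarrow> None | Inr (t, b) \<Rightarrow> if s < t then lab b else None)"

lemma phase_controlled_label: "phase (controlled_label s lab) x = controlled s (phase lab x)"
  by (auto simp: phase_def controlled_label_def controlled_def fun_eq_iff split: sum.split option.split)

text \<open>A basis state of \<open>B\<close> holds a set \<open>a\<close> of answers and either
  \<open>None\<close> or a query \<open>q\<close> together with a bit \<open>z\<close>. On sets
  containing the right answer, \<open>U x\<close> fixes \<open>\<phi> x\<close>; on the others it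
  moves \<open>w x\<close> by \<open>2 * vm (ans x)\<close>. By \<open>kickback\<close> exactly the
  sets containing the right answer change sign, up to a small error.\<close>

lemma adversary_algorithm:
  fixes X :: "('l \<Rightarrow> bool) set" and Q :: "'q set" and cell :: "'q \<Rightarrow> 'l"
    and ans :: "('l \<Rightarrow> bool) \<Rightarrow> nat" and \<alpha> \<beta> :: "('l \<Rightarrow> bool) \<Rightarrow> 'q \<Rightarrow> real" and W :: real
  assumes X: "finite X" and Q: "finite Q" and L: "cell ` Q \<subseteq> L"
    and ans: "\<And>x. x \<in> X \<Longrightarrow> ans x < M" and W: "1 \<le> W"
    and \<alpha>: "\<And>x. x \<in> X \<Longrightarrow> (\<Sum>q\<in>Q. (\<alpha> x q)\<^sup>2) \<le> W"
    and \<beta>: "\<And>x. x \<in> X \<Longrightarrow> (\<Sum>q\<in>Q. (\<beta> x q)\<^sup>2) \<le> W"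
    and adv: "\<And>x y. x \<in> X \<Longrightarrow> y \<in> X \<Longrightarrow> ans x \<noteq> ans y \<Longrightarrow>
      (\<Sum>q | q \<in> Q \<and> x (cell q) \<noteq> y (cell q). \<alpha> x q * \<beta> y q) = 1"
  shows "\<exists>(I :: (nat + nat \<times> nat set \<times> ('q \<times> bool) option) set) i0 steps.
    finite I \<and> i0 \<in> I \<and> (\<forall>s\<in>set steps. wf_step I L s) \<and>
    real (sum_list (map step_cost steps)) \<le> 404 * W \<and>
    (\<forall>x\<in>X. (\<Sum>i\<in>I - {Inl (ans x)}. (exec x steps (delta i0) i)\<^sup>2) \<le> 1 / 10)"
proof -
  \<comment> \<open>The clock length makes \<open>2 * nrm B (w x) / K\<close> at most
    \<open>40.2 W / (201 W) = 1 / 5\<close>. With \<open>2 * nrm B (\<eta> x) \<le> 1 / 10\<close>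
    the final error vector has norm at most 3/10, and its square is below 1/10.\<close>
  define K where "K = nat \<lceil>201 * W\<rceil>"
  have "real K = of_int \<lceil>201 * W\<rceil>" using W by (simp add: K_def)
  then have K1: "201 * W \<le> real K" and K2: "real K \<le> 202 * W" using W by linarith+
  then have K: "0 < K" using W by (cases K) auto
  define B :: "(nat set \<times> ('q \<times> bool) option) set"
    where "B = Pow {..<M} \<times> insert None (Some ` (Q \<times> UNIV))"
  have B: "finite B" using Q by (simp add: B_def)
  define I where "I = clock_index M K B"
  have I: "finite I" using finite_clock_index[OF B] by (simp add: I_def)
  define sA where "sA = sqrt (2 ^ M)"
  have sA: "0 < sA" "sA * sA = 2 ^ M" by (simp_all add: sA_def)
  \<comment> \<open>Scaling \<open>\<alpha>\<close> by \<open>\<kappa>\<close> and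
    \<open>\<beta>\<close> by \<open>1 / \<kappa>\<close> keeps their products. It shortens
    \<open>\<eta>\<close> to norm 1/20, at the price of a \<open>w\<close> of norm up to
    \<open>20.1 W\<close>.\<close>
  define \<kappa> where "\<kappa> = 1 / (20 * sqrt W)"
  have \<kappa>: "0 < \<kappa>" "\<kappa> * \<kappa> = 1 / (400 * W)" using W by (simp_all add: \<kappa>_def field_simps)
  have ipB: "ip B p q = (\<Sum>a\<in>Pow {..<M}. p (a, None) * q (a, None) +
      (\<Sum>k\<in>Q. p (a, Some (k, False)) * q (a, Some (k, False)) + p (a, Some (k, True)) * q (a, Some (k, True))))"
    for p q :: "nat set \<times> ('q \<times> bool) option \<Rightarrow> real"
  proof -
    have "ip B p q = (\<Sum>a\<in>Pow {..<M}. \<Sum>o'\<in>insert None (Some ` (Q \<times> UNIV)). p (a, o') * q (a, o'))"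
      unfolding ip_def B_def by (simp add: sum.cartesian_product split_def)
    moreover have "(\<Sum>o'\<in>insert None (Some ` (Q \<times> UNIV)). p (a, o') * q (a, o')) =
      p (a, None) * q (a, None) + (\<Sum>k\<in>Q. \<Sum>z\<in>UNIV. p (a, Some (k, z)) * q (a, Some (k, z)))" for a
      using Q by (subst sum.insert) (auto simp: sum.reindex sum.cartesian_product split_def)
    ultimately show ?thesis by (simp add: UNIV_bool)
  qed
  define h where "h = (\<lambda>c (a, o'). if a \<subseteq> {..<M} \<and> o' = (None :: ('q \<times> bool) option)
      then (if c \<in> a then - 1 else 1) / sA else (0::real))"
  define vp where "vp = (\<lambda>c (a, o'). if a \<subseteq> {..<M} \<and> o' = (None :: ('q \<times> bool) option) \<and> c \<in> a
      then 1 / sA else (0::real))"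
  define vm where "vm = (\<lambda>c (a, o'). if a \<subseteq> {..<M} \<and> o' = (None :: ('q \<times> bool) option) \<and> c \<notin> a
      then 1 / sA else (0::real))"
  define v where "v = (\<lambda>(a, o'). if a \<subseteq> {..<M} \<and> o' = (None :: ('q \<times> bool) option)
      then 1 / sA else (0::real))"
  \<comment> \<open>The bit \<open>z\<close> agrees with the input in \<open>\<eta>\<close> and
    disagrees with it in \<open>w\<close>. Hence \<open>\<eta> x\<close> and \<open>w y\<close> meet
    only in queries on which \<open>x\<close> and \<open>y\<close> differ.\<close>
  define \<eta> where "\<eta> = (\<lambda>x (a, o'). if a \<subseteq> {..<M} \<and> ans x \<in> a then
      (case o' of None \<Rightarrow> 0 | Some (q, z) \<Rightarrow> if q \<in> Q \<and> z = x (cell q) then \<kappa> * \<alpha> x q / sA else 0) else 0)"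
  define w where "w = (\<lambda>x (a, o'). if a \<subseteq> {..<M} \<and> ans x \<notin> a then
      (case o' of None \<Rightarrow> 1 / sA | Some (q, z) \<Rightarrow> if q \<in> Q \<and> z \<noteq> x (cell q) then - \<beta> x q / (\<kappa> * sA) else 0) else 0)"
  define \<phi> where "\<phi> = (\<lambda>x b. vp (ans x) b + \<eta> x b)"
  have supp: "h c \<in> supp B" "vp c \<in> supp B" "vm c \<in> supp B" "v \<in> supp B" "\<eta> x \<in> supp B" "w x \<in> supp B" for c x
    by (auto simp: supp_def B_def h_def vp_def vm_def v_def \<eta>_def w_def image_iff split: option.split)
  then have supp\<phi>: "\<phi> x \<in> supp B" for x
    using supp_lin[of "vp (ans x)" B "\<eta> x" 1 1] by (simp add: \<phi>_def)
  have ip\<phi>w: "ip B (\<phi> x) (w y) = 0" if xy: "x \<in> X" "y \<in> X" for x y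
  proof (cases "ans x = ans y")
    case True
    then show ?thesis by (auto simp: ipB \<phi>_def vp_def \<eta>_def w_def intro!: sum.neutral)
  next
    case False
    \<comment> \<open>If \<open>a\<close> contains \<open>ans x\<close> but not
      \<open>ans y\<close>, the \<open>None\<close> entries contribute \<open>1 / (sA * sA)\<close>
      and the queries cancel it by the adversary condition. For any other \<open>a\<close> one of
      the factors vanishes.\<close>
    have "\<phi> x (a, None) * w y (a, None) +
      (\<Sum>k\<in>Q. \<phi> x (a, Some (k, False)) * w y (a, Some (k, False)) + \<phi> x (a, Some (k, True)) * w y (a, Some (k, True))) = 0"
      if a: "a \<subseteq> {..<M}" for a
    proof (cases "ans x \<in> a \<and> ans y \<notin> a")
      case True
      have "(\<Sum>k\<in>Q. \<phi> x (a, Some (k, False)) * w y (a, Some (k, False)) + \<phi> x (a, Some (k, True)) * w y (a, Some (k, True)))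
        = (\<Sum>k\<in>Q. - (1 / (sA * sA)) * (if x (cell k) \<noteq> y (cell k) then \<alpha> x k * \<beta> y k else 0))"
        using True a \<kappa>(1) sA(1) by (intro sum.cong refl) (auto simp: \<phi>_def vp_def \<eta>_def w_def)
      also have "\<dots> = - (1 / (sA * sA)) * (\<Sum>k | k \<in> Q \<and> x (cell k) \<noteq> y (cell k). \<alpha> x k * \<beta> y k)"
        using Q by (simp only: sum_distrib_left[symmetric] sum.inter_filter)
      also have "\<dots> = - (1 / (sA * sA))" using adv[OF xy False] by simp
      finally show ?thesis using True a by (simp add: \<phi>_def vp_def \<eta>_def w_def)
    next
      case False
      then show ?thesis using a by (auto simp: \<phi>_def vp_def \<eta>_def w_def)
    qed
    then show ?thesis unfolding ipB by (intro sum.neutral) auto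
  qed
  have nrm\<eta>: "nrm B (\<eta> x) \<le> 1 / 20" if "x \<in> X" for x
  proof -
    have "ip B (\<eta> x) (\<eta> x) \<le> (\<Sum>a\<in>Pow {..<M}. \<kappa> * \<kappa> * W / 2 ^ M)"
      unfolding ipB
    proof (intro sum_mono)
      fix a assume "a \<in> Pow {..<M}"
      then have a: "a \<subseteq> {..<M}" by simp
      have \<eta>0: "\<eta> x (a, None) = 0" by (simp add: \<eta>_def)
      have "(\<Sum>k\<in>Q. \<eta> x (a, Some (k, False)) * \<eta> x (a, Some (k, False)) + \<eta> x (a, Some (k, True)) * \<eta> x (a, Some (k, True)))
        \<le> (\<Sum>k\<in>Q. \<kappa> * \<kappa> / (sA * sA) * (\<alpha> x k)\<^sup>2)"
      proof (intro sum_mono)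
        fix k assume "k \<in> Q"
        have "0 \<le> \<kappa> * \<kappa> / (sA * sA) * (\<alpha> x k)\<^sup>2"
          using \<kappa>(1) sA(1) by (intro mult_nonneg_nonneg divide_nonneg_nonneg) simp_all
        then show "\<eta> x (a, Some (k, False)) * \<eta> x (a, Some (k, False)) + \<eta> x (a, Some (k, True)) * \<eta> x (a, Some (k, True))
          \<le> \<kappa> * \<kappa> / (sA * sA) * (\<alpha> x k)\<^sup>2"
          by (cases "ans x \<in> a") (auto simp: \<eta>_def power2_eq_square algebra_simps)
      qed
      also have "\<dots> = \<kappa> * \<kappa> / (sA * sA) * (\<Sum>k\<in>Q. (\<alpha> x k)\<^sup>2)" by (simp only: sum_distrib_left)
      also have "\<dots> \<le> \<kappa> * \<kappa> / (sA * sA) * W" using \<kappa>(1) sA(1) by (intro mult_left_mono \<alpha> that) simp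
      finally show "\<eta> x (a, None) * \<eta> x (a, None) + (\<Sum>k\<in>Q. \<eta> x (a, Some (k, False)) * \<eta> x (a, Some (k, False)) + \<eta> x (a, Some (k, True)) * \<eta> x (a, Some (k, True)))
        \<le> \<kappa> * \<kappa> * W / 2 ^ M" unfolding \<eta>0 sA(2) by simp
    qed
    also have "\<dots> = (1 / 20)\<^sup>2" using W by (simp add: card_Pow \<kappa>(2) power2_eq_square)
    finally show ?thesis unfolding nrm_def by (rule real_le_lsqrt[rotated]) simp
  qed
  have nrmw: "nrm B (w x) \<le> 20.1 * W" if "x \<in> X" for x
  proof -
    have "ip B (w x) (w x) \<le> (\<Sum>a\<in>Pow {..<M}. (1 + W / (\<kappa> * \<kappa>)) / 2 ^ M)"
      unfolding ipB
    proof (intro sum_mono)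
      fix a assume "a \<in> Pow {..<M}"
      then have a: "a \<subseteq> {..<M}" by simp
      have "(\<Sum>k\<in>Q. w x (a, Some (k, False)) * w x (a, Some (k, False)) + w x (a, Some (k, True)) * w x (a, Some (k, True)))
        \<le> (\<Sum>k\<in>Q. 1 / (\<kappa> * \<kappa> * (sA * sA)) * (\<beta> x k)\<^sup>2)"
      proof (intro sum_mono)
        fix k assume "k \<in> Q"
        have "0 \<le> 1 / (\<kappa> * \<kappa> * (sA * sA)) * (\<beta> x k)\<^sup>2"
          using \<kappa>(1) sA(1) by (intro mult_nonneg_nonneg divide_nonneg_nonneg) simp_all
        then show "w x (a, Some (k, False)) * w x (a, Some (k, False)) + w x (a, Some (k, True)) * w x (a, Some (k, True))
          \<le> 1 / (\<kappa> * \<kappa> * (sA * sA)) * (\<beta> x k)\<^sup>2"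
          by (cases "ans x \<in> a") (auto simp: w_def power2_eq_square algebra_simps)
      qed
      also have "\<dots> = 1 / (\<kappa> * \<kappa> * (sA * sA)) * (\<Sum>k\<in>Q. (\<beta> x k)\<^sup>2)" by (simp only: sum_distrib_left)
      also have "\<dots> \<le> 1 / (\<kappa> * \<kappa> * (sA * sA)) * W" using \<kappa>(1) sA(1) by (intro mult_left_mono \<beta> that) simp
      finally have 1: "(\<Sum>k\<in>Q. w x (a, Some (k, False)) * w x (a, Some (k, False)) + w x (a, Some (k, True)) * w x (a, Some (k, True)))
        \<le> W / (\<kappa> * \<kappa>) / 2 ^ M" unfolding sA(2) by simp
      have 2: "w x (a, None) * w x (a, None) \<le> 1 / 2 ^ M"
        using a sA by (simp add: w_def)
      show "w x (a, None) * w x (a, None) + (\<Sum>k\<in>Q. w x (a, Some (k, False)) * w x (a, Some (k, False)) + w x (a, Some (k, True)) * w x (a, Some (k, True)))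
        \<le> (1 + W / (\<kappa> * \<kappa>)) / 2 ^ M" using add_mono[OF 2 1] by (simp only: add_divide_distrib)
    qed
    also have "\<dots> = 1 + 400 * W\<^sup>2" using W by (simp add: card_Pow \<kappa>(2) power2_eq_square)
    also have "\<dots> \<le> 404.01 * W\<^sup>2" using one_le_power[OF W, of 2] by simp
    also have "\<dots> = (20.1 * W)\<^sup>2" by (simp only: power_mult_distrib) (simp add: power2_eq_square)
    finally show ?thesis unfolding nrm_def by (rule real_le_lsqrt[rotated]) (use W in simp)
  qed
  have "w ` X \<subseteq> supp B" using supp by auto
  note R_ex = reflection_exists[OF B finite_imageI[OF X] this]
  obtain R :: "(nat set \<times> ('q \<times> bool) option \<Rightarrow> real) \<Rightarrow> nat set \<times> ('q \<times> bool) option \<Rightarrow> real"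
    where R: "orth B R" "\<And>p. R (R p) = p" "\<And>y. y \<in> w ` X \<Longrightarrow> R y = (\<lambda>i. - y i)"
      "\<forall>p. (\<forall>y\<in>w ` X. ip B p y = 0) \<longrightarrow> R p = p"
    by (rule R_ex) (rule that)
  \<comment> \<open>One reflection serves all inputs: it negates every \<open>w x\<close> and, by
    the orthogonality just shown, fixes every \<open>\<phi> x\<close>.\<close>
  have R\<phi>: "R (\<phi> x) = \<phi> x" if "x \<in> X" for x using R(4) ip\<phi>w[OF that] by blast
  have Rw: "R (w x) = (\<lambda>b. - w x b)" if "x \<in> X" for x using that by (intro R(3)) simp
  define Z :: "(nat set \<times> ('q \<times> bool) option \<Rightarrow> real) \<Rightarrow> nat set \<times> ('q \<times> bool) option \<Rightarrow> real"
    where "Z = phase (\<lambda>(a, o'). case o' of None \<Rightarrow> None | Some (q, z) \<Rightarrow> if z then Some () else None) (\<lambda>_. True)"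
  define lab :: "nat set \<times> ('q \<times> bool) option \<Rightarrow> 'l option"
    where "lab = (\<lambda>(a, o'). case o' of None \<Rightarrow> None | Some (q, z) \<Rightarrow> Some (cell q))"
  have Z: "orth B Z" "Z (Z p) = p" for p unfolding Z_def by (rule orth_phase phase_phase)+
  define U where "U = (\<lambda>x p. phase lab x (Z (R p)))"
  define V where "V = (\<lambda>x p. R (Z (phase lab x p)))"
  have U: "orth B (U x)" and V: "orth B (V x)" for x
    unfolding U_def V_def by (rule orth_comp[OF orth_phase orth_comp[OF Z(1) R(1)]] orth_comp[OF R(1) orth_comp[OF Z(1) orth_phase]])+
  have VU: "V x (U x p) = p" for x p by (simp add: U_def V_def phase_phase Z(2) R(2))
  \<comment> \<open>The sign for \<open>z\<close> and the sign of the phase query multiply to a test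
    whether \<open>z\<close> equals the queried bit. \<open>None\<close> is left alone.\<close>
  have PZ: "phase lab x (Z p) (a, o') = (case o' of None \<Rightarrow> p (a, o') | Some (q, z) \<Rightarrow> if z = x (cell q) then p (a, o') else - p (a, o'))" for x p a o'
    by (auto simp: phase_def Z_def lab_def split: option.split)
  have U\<phi>: "U x (\<phi> x) = \<phi> x" if "x \<in> X" for x
  proof (rule ext)
    fix b :: "nat set \<times> ('q \<times> bool) option"
    obtain a o' where b: "b = (a, o')" by force
    show "U x (\<phi> x) b = \<phi> x b"
      unfolding b U_def R\<phi>[OF that] PZ by (auto simp: \<phi>_def vp_def \<eta>_def split: option.split)
  qed
  have Uw: "U x (w x) = (\<lambda>b. w x b - 2 * vm (ans x) b)" if "x \<in> X" for x
  proof (rule ext)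
    fix b :: "nat set \<times> ('q \<times> bool) option"
    obtain a o' where b: "b = (a, o')" by force
    show "U x (w x) b = w x b - 2 * vm (ans x) b"
      unfolding b U_def Rw[OF that] PZ by (auto simp: w_def vm_def split: option.split)
  qed
  have v_split: "v = (\<lambda>b. \<phi> x b - \<eta> x b + vm (ans x) b)" for x
    by (auto simp: fun_eq_iff \<phi>_def v_def vp_def vm_def)
  have h_split: "h (ans x) = (\<lambda>b. vm (ans x) b - (\<phi> x b - \<eta> x b))" for x
    by (auto simp: fun_eq_iff \<phi>_def h_def vp_def vm_def)
  have ip_v: "ip B v v = 1"
    by (simp add: ipB v_def sA card_Pow)
  have ip_h: "ip B (h c) (h c') = of_bool (c = c')" if "c < M" "c' < M" for c c'
  proof -
    have "ip B (h c) (h c') = (\<Sum>a\<in>Pow {..<M}. (if c \<in> a then - 1 else 1) * (if c' \<in> a then - 1 else 1)) / 2 ^ M"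
      unfolding ipB sum_divide_distrib by (intro sum.cong refl) (auto simp: h_def sA(2))
    then show ?thesis using sum_char_subsets[OF that] by simp
  qed
  have InlI: "Inl c \<in> I" if "c \<le> M" for c using that by (simp add: I_def clock_index_def)
  have spI: "spread K u \<in> supp I" if "u \<in> supp B" for u using spread_supp[OF that] by (simp add: I_def)
  have ipI: "ip I (spread K u) (spread K u') = ip B u u'" for u u'
    unfolding I_def by (rule ip_spread[OF B K])
  \<comment> \<open>State preparation. With a single pair of unit vectors the cross condition of
    \<open>swap_exists\<close> is mere symmetry.\<close>
  obtain Ti where Ti: "orth I Ti" "Ti (delta (Inl M)) = spread K v"
  proof (rule swap_exists[of I "{()}" "\<lambda>_. delta (Inl M)" "\<lambda>_. spread K v"])
    show "ip I (delta (Inl M)) (delta (Inl M)) = ip I (spread K v) (spread K v)"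
      using ip_delta[OF I InlI[of M]] by (simp add: ipI ip_v) (simp add: delta_def)
    show "ip I (delta (Inl M)) (spread K v) = ip I (spread K v) (delta (Inl M))" by (rule ip_comm)
  qed (auto simp: I intro!: delta_supp InlI spI supp)
  have ip_sd: "ip I (spread K u) (delta (Inl c)) = 0" if "c < M" for u c
    unfolding ip_comm[of I "spread K u"] using ip_delta[OF I InlI[of c]] that by (simp add: spread_def)
  \<comment> \<open>The sign vectors \<open>h c\<close> are orthonormal and live on the clock part,
    hence are orthogonal to the states \<open>Inl c\<close>; so all pairs can be exchanged at
    once.\<close>
  obtain Tf where Tf: "orth I Tf" "\<And>c. c \<in> {..<M} \<Longrightarrow> Tf (spread K (h c)) = delta (Inl c)"
  proof (rule swap_exists[of I "{..<M}" "\<lambda>c. spread K (h c)" "\<lambda>c. delta (Inl c)"])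
    show "ip I (spread K (h c)) (spread K (h c')) = ip I (delta (Inl c)) (delta (Inl c'))"
      if "c \<in> {..<M}" "c' \<in> {..<M}" for c c'
      using ip_delta[OF I InlI[of c]] that by (simp add: ipI ip_h) (simp add: delta_def)
    show "ip I (spread K (h c)) (delta (Inl c')) = ip I (delta (Inl c)) (spread K (h c'))"
      if "c \<in> {..<M}" "c' \<in> {..<M}" for c c'
      using that by (simp add: ip_sd ip_comm[of I "delta (Inl c)"])
  qed (auto simp: I intro!: delta_supp InlI spI supp)
  \<comment> \<open>A forward block is a controlled \<open>U x\<close>, a backward block a
    controlled \<open>V x\<close>. Each makes one query, \<open>2 * (K - 1)\<close> in
    total.\<close>
  define fwd where "fwd = (\<lambda>s. [Op (controlled s R), Op (controlled s Z), Qry (controlled_label s lab)])"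
  define bwd where "bwd = (\<lambda>s. [Qry (controlled_label s lab), Op (controlled s Z), Op (controlled s R)])"
  define steps where "steps = [Op Ti] @ concat (map fwd [0..<K-1]) @ [Op (clock_reflection K)] @
    concat (map bwd (rev [0..<K-1])) @ [Op Tf]"
  have fwd: "exec x (fwd s) = controlled s (U x)" and bwd: "exec x (bwd s) = controlled s (V x)" for x s
    by (simp_all add: fun_eq_iff exec_def fwd_def bwd_def phase_controlled_label controlled_comp U_def V_def)
  have "wf_step I L s" if "s \<in> set steps" for s
  proof -
    have "l \<in> L" if "i \<in> I" "controlled_label t lab i = Some l" for i t l
      using that L by (auto simp: I_def clock_index_def B_def controlled_label_def lab_def split: if_splits)
    then show ?thesis
      using that Ti(1) Tf(1) orth_clock_reflection[OF B K, of M] orth_controlled[OF R(1) B] orth_controlled[OF Z(1) B]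
      by (auto simp: steps_def fwd_def bwd_def I_def)
  qed
  moreover have "real (sum_list (map step_cost steps)) \<le> 404 * W"
  proof -
    have "sum_list (map step_cost (concat (map f ss))) = length ss"
      if "\<And>s. sum_list (map step_cost (f s)) = 1"
      for f :: "nat \<Rightarrow> (nat + nat \<times> nat set \<times> ('q \<times> bool) option, 'l) step list" and ss
      using that by (induction ss) simp_all
    then have "sum_list (map step_cost steps) = 2 * (K - 1)"
      by (simp add: steps_def fwd_def bwd_def)
    then show ?thesis using K2 by linarith
  qed
  moreover have "(\<Sum>i\<in>I - {Inl (ans x)}. (exec x steps (delta (Inl M)) i)\<^sup>2) \<le> 1 / 10" if x: "x \<in> X" for x
  proof -
    note kb = kickback[where U = "U x" and V = "V x" and \<phi> = "\<phi> x" and \<eta> = "\<eta> x" and w = "w x"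
        and vm = "vm (ans x)" and M = M, OF B K U V VU supp\<phi> supp(5) supp(6) U\<phi>[OF x] Uw[OF x]]
    from kb[folded I_def, folded v_split[of x] h_split[of x]]
    obtain e where e: "e \<in> supp I"
      "fold (\<lambda>s. controlled s (V x)) (rev [0..<K-1]) (clock_reflection K (fold (\<lambda>s. controlled s (U x)) [0..<K-1] (spread K v)))
        = (\<lambda>i. spread K (h (ans x)) i + e i)"
      "nrm I e \<le> 2 * nrm B (\<eta> x) + 2 * nrm B (w x) / K"
      by (elim bexE conjE) (rule that)
    have "exec x steps (delta (Inl M)) = Tf (\<lambda>i. spread K (h (ans x)) i + e i)"
      unfolding e(2)[symmetric] steps_def exec_append exec_concat fwd bwd
      by (simp add: exec_def Ti(2))
    \<comment> \<open>The ideal final state is sent to the outcome \<open>Inl (ans x)\<close>, so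
      all probability elsewhere stems from \<open>Tf e\<close>.\<close>
    also have "\<dots> = (\<lambda>i. delta (Inl (ans x)) i + Tf e i)"
      using Tf(2)[of "ans x"] ans[OF x] by (simp add: lin_add[OF orth_lin[OF Tf(1)]])
    finally have "(\<Sum>i\<in>I - {Inl (ans x)}. (exec x steps (delta (Inl M)) i)\<^sup>2) = (\<Sum>i\<in>I - {Inl (ans x)}. Tf e i * Tf e i)"
      by (intro sum.cong) (simp_all add: delta_def power2_eq_square)
    also have "\<dots> \<le> ip I (Tf e) (Tf e)"
      unfolding ip_def using I by (intro sum_mono2) auto
    also have "\<dots> = (nrm I (Tf e))\<^sup>2" by (simp add: nrm_def ip_def sum_nonneg)
    also have "\<dots> = (nrm I e)\<^sup>2" by (simp add: nrm_orth[OF Tf(1) e(1)])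
    also have "\<dots> \<le> (3 / 10)\<^sup>2"
    proof (rule power_mono[OF _ nrm_ge_0])
      have "2 * nrm B (w x) \<le> 1 / 5 * (201 * W)" using nrmw[OF x] by simp
      also have "\<dots> \<le> 1 / 5 * K" using K1 by simp
      finally have "2 * nrm B (w x) / K \<le> 1 / 5" using K by (simp add: divide_le_eq)
      then show "nrm I e \<le> 3 / 10" using e(3) nrm\<eta>[OF x] by simp
    qed
    finally show ?thesis by (simp add: power2_eq_square)
  qed
  ultimately show ?thesis using I InlI[of M] by blast
qed

section \<open>Query circuits\<close>

definition circ :: "nat \<Rightarrow> nat \<Rightarrow> complex mat \<Rightarrow> complex mat list \<Rightarrow> qcircuit" where
  "circ N w U Us = \<lparr>inputs = N, workdim = w, init_op = U, step_ops = Us\<rparr>"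

lemma circ_simps [simp]:
  "inputs (circ N w U Us) = N" "workdim (circ N w U Us) = w"
  "init_op (circ N w U Us) = U" "step_ops (circ N w U Us) = Us"
  "state_dim (circ N w U Us) = N * 2 * w" "num_queries (circ N w U Us) = length Us"
  by (simp_all add: circ_def state_dim_def num_queries_def)

lemma query_mat_cong:
  "inputs A = inputs B \<Longrightarrow> workdim A = workdim B \<Longrightarrow> query_mat A x = query_mat B x"
  by (simp add: query_mat_def query_image_def basis_index_def state_dim_def)

lemma query_mat_carrier: "query_mat A x \<in> carrier_mat (state_dim A) (state_dim A)"
  by (simp add: query_mat_def)

lemma unitary_carrier: "unitary_mat N U \<Longrightarrow> U \<in> carrier_mat N N"
  by (simp add: unitary_mat_def)

lemma foldl_carrier:
  assumes "Q \<in> carrier_mat D D" "\<forall>U\<in>set Us. U \<in> carrier_mat D D" "v \<in> carrier_vec D"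
  shows "foldl (\<lambda>u U. U *\<^sub>v (Q *\<^sub>v u)) v Us \<in> carrier_vec D"
  using assms(2,3)
proof (induction Us arbitrary: v)
  case (Cons U Us)
  then show ?case using mult_mat_vec_carrier[OF _ mult_mat_vec_carrier[OF assms(1) Cons.prems(2)], of U D] by simp
qed simp

lemma run_carrier:
  assumes "wf_qcircuit A" "v \<in> carrier_vec (state_dim A)"
  shows "run A x v \<in> carrier_vec (state_dim A)"
  unfolding run_def using assms unitary_carrier query_mat_carrier[of A x]
  by (intro foldl_carrier) (auto simp: wf_qcircuit_def intro!: mult_mat_vec_carrier)

lemma mat_adjoint_carrier: "U \<in> carrier_mat N K \<Longrightarrow> mat_adjoint U \<in> carrier_mat K N"
  by (auto simp: mat_adjoint_def)

lemma mat_adjoint_index: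
  "U \<in> carrier_mat N K \<Longrightarrow> r < K \<Longrightarrow> c < N \<Longrightarrow> mat_adjoint U $$ (r, c) = cnj (U $$ (c, r))"
  by (auto simp: mat_adjoint_def mat_of_rows_def)

lemma unitary_mat_mult:
  assumes "unitary_mat N U" "unitary_mat N V"
  shows "unitary_mat N (U * V)"
proof -
  note c = unitary_carrier[OF assms(1)] unitary_carrier[OF assms(2)]
  note ca = mat_adjoint_carrier[OF c(1)] mat_adjoint_carrier[OF c(2)]
  have adj: "mat_adjoint (U * V) = mat_adjoint V * mat_adjoint U"
  proof (rule eq_matI)
    fix i j assume "i < dim_row (mat_adjoint V * mat_adjoint U)" "j < dim_col (mat_adjoint V * mat_adjoint U)"
    then have ij: "i < N" "j < N" using ca by auto
    have "mat_adjoint (U * V) $$ (i, j) = cnj (\<Sum>k<N. U $$ (j, k) * V $$ (k, i))"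
      using ij c by (subst mat_adjoint_index[OF mult_carrier_mat[OF c]])
        (auto simp: scalar_prod_def atLeast0LessThan)
    also have "\<dots> = (mat_adjoint V * mat_adjoint U) $$ (i, j)"
      using ij c ca by (auto simp: scalar_prod_def atLeast0LessThan mat_adjoint_index[OF c(1)]
          mat_adjoint_index[OF c(2)] mult.commute intro!: sum.cong)
    finally show "mat_adjoint (U * V) $$ (i, j) = (mat_adjoint V * mat_adjoint U) $$ (i, j)" .
  qed (use c ca mat_adjoint_carrier[OF mult_carrier_mat[OF c]] in auto)
  have "mat_adjoint V * mat_adjoint U * (U * V) = mat_adjoint V * (mat_adjoint U * U) * V"
    using c ca by (simp add: assoc_mult_mat[where n\<^sub>1=N and n\<^sub>2=N and n\<^sub>3=N and n\<^sub>4=N] mult_carrier_mat[where n=N])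
  also have "\<dots> = 1\<^sub>m N" using assms c ca by (simp add: unitary_mat_def)
  finally have "mat_adjoint (U * V) * (U * V) = 1\<^sub>m N" unfolding adj .
  then show ?thesis
    using mult_carrier_mat[OF c] mat_mult_left_right_inverse[OF mat_adjoint_carrier[OF mult_carrier_mat[OF c]] mult_carrier_mat[OF c]]
    by (simp add: unitary_mat_def)
qed

text \<open>\<open>S\<close> is a partial specification that one circuit meets for all its inputs
  and states at once. Only listed states matter, so registers may be assumed to be zero.\<close>

definition implementable :: "nat \<Rightarrow> nat \<Rightarrow> nat \<Rightarrow> ((nat \<Rightarrow> bool) \<times> complex vec \<times> complex vec) set \<Rightarrow> bool" where
  "implementable N w q S \<longleftrightarrow> (\<exists>U Us. wf_qcircuit (circ N w U Us) \<and> length Us = q \<and>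
     (\<forall>(x, v, v')\<in>S. v \<in> carrier_vec (N * 2 * w) \<and> run (circ N w U Us) x v = v'))"

lemma implementable_unitary:
  assumes "0 < N" "0 < w" "unitary_mat (N * 2 * w) U"
    and "\<And>x v v'. (x, v, v') \<in> S \<Longrightarrow> v \<in> carrier_vec (N * 2 * w) \<and> U *\<^sub>v v = v'"
  shows "implementable N w 0 S"
  unfolding implementable_def using assms
  by (intro exI[of _ U] exI[of _ "[]"]) (auto simp: wf_qcircuit_def run_def)

text \<open>Concatenation merges the initial unitary of the second circuit into the last unitary of
  the first. This is the initial one if the first circuit makes no query, hence the two
  cases.\<close>

lemma implementable_comp:
  assumes "implementable N w q S" "implementable N w q' S'"
    and "\<And>x v v'. (x, v, v') \<in> T \<Longrightarrow> \<exists>u. (x, v, u) \<in> S \<and> (x, u, v') \<in> S'"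
  shows "implementable N w (q + q') T"
proof -
  let ?D = "N * 2 * w"
  obtain U Us where 1: "wf_qcircuit (circ N w U Us)" "length Us = q"
    "\<forall>(x, v, v')\<in>S. v \<in> carrier_vec ?D \<and> run (circ N w U Us) x v = v'"
    using assms(1) unfolding implementable_def by blast
  obtain V Vs where 2: "wf_qcircuit (circ N w V Vs)" "length Vs = q'"
    "\<forall>(x, v, v')\<in>S'. v \<in> carrier_vec ?D \<and> run (circ N w V Vs) x v = v'"
    using assms(2) unfolding implementable_def by blast
  have u: "unitary_mat ?D U" "\<And>L. L \<in> set Us \<Longrightarrow> unitary_mat ?D L" "0 < N" "0 < w"
    using 1(1) by (auto simp: wf_qcircuit_def)
  have v: "unitary_mat ?D V" "\<And>L. L \<in> set Vs \<Longrightarrow> unitary_mat ?D L"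
    using 2(1) by (auto simp: wf_qcircuit_def)
  have "\<exists>W Ws. wf_qcircuit (circ N w W Ws) \<and> length Ws = q + q' \<and>
    (\<forall>x y. y \<in> carrier_vec ?D \<longrightarrow> run (circ N w W Ws) x y = run (circ N w V Vs) x (run (circ N w U Us) x y))"
  proof (cases Us rule: rev_cases)
    case Nil
    have "wf_qcircuit (circ N w (V * U) Vs)"
      using u v unitary_mat_mult[OF v(1) u(1)] by (auto simp: wf_qcircuit_def)
    moreover have "run (circ N w (V * U) Vs) x y = run (circ N w V Vs) x (run (circ N w U Us) x y)"
      if "y \<in> carrier_vec ?D" for x y
      unfolding run_def query_mat_cong[of "circ N w (V * U) Vs" "circ N w V Vs", simplified]
      using Nil assoc_mult_mat_vec[OF unitary_carrier[OF v(1)] unitary_carrier[OF u(1)] that] by simp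
    ultimately show ?thesis using 1(2) 2(2) Nil by (intro exI[of _ "V * U"] exI[of _ Vs]) simp
  next
    case (snoc Us' L)
    have L: "unitary_mat ?D L" using u(2) snoc by simp
    have "wf_qcircuit (circ N w U (Us' @ [V * L] @ Vs))"
      using u v unitary_mat_mult[OF v(1) L] snoc by (auto simp: wf_qcircuit_def)
    moreover have "run (circ N w U (Us' @ [V * L] @ Vs)) x y = run (circ N w V Vs) x (run (circ N w U Us) x y)"
      if y: "y \<in> carrier_vec ?D" for x y
    proof -
      define Q where "Q = query_mat (circ N w V Vs) x"
      have Q: "query_mat (circ N w W Ws) x = Q" for W Ws
        unfolding Q_def by (rule query_mat_cong) simp_all
      have Qc: "Q \<in> carrier_mat ?D ?D" using query_mat_carrier[of "circ N w V Vs" x] by (simp add: Q_def)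
      define z where "z = Q *\<^sub>v foldl (\<lambda>u U. U *\<^sub>v (Q *\<^sub>v u)) (U *\<^sub>v y) Us'"
      have "z \<in> carrier_vec ?D"
        unfolding z_def using u(1,2) snoc y Qc
        by (intro mult_mat_vec_carrier[OF Qc] foldl_carrier) (auto intro!: unitary_carrier mult_mat_vec_carrier)
      then have "(V * L) *\<^sub>v z = V *\<^sub>v (L *\<^sub>v z)"
        by (rule assoc_mult_mat_vec[OF unitary_carrier[OF v(1)] unitary_carrier[OF L]])
      then show ?thesis unfolding run_def Q using snoc by (simp add: z_def)
    qed
    ultimately show ?thesis using 1(2) 2(2) snoc by (intro exI[of _ U] exI[of _ "Us' @ [V * L] @ Vs"]) simp
  qed
  then obtain W Ws where 3: "wf_qcircuit (circ N w W Ws)" "length Ws = q + q'"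
    "\<And>x y. y \<in> carrier_vec ?D \<Longrightarrow> run (circ N w W Ws) x y = run (circ N w V Vs) x (run (circ N w U Us) x y)"
    by blast
  have "v \<in> carrier_vec ?D \<and> run (circ N w W Ws) x v = v'" if "(x, v, v') \<in> T" for x v v'
    using assms(3)[OF that] 1(3) 2(3) 3(3)[of v x] by fastforce
  then show ?thesis unfolding implementable_def using 3(1,2) by blast
qed

section \<open>Adding a register to a circuit\<close>

lemma mult_unit_vec:
  fixes U :: "complex mat"
  shows "U \<in> carrier_mat N K \<Longrightarrow> j < K \<Longrightarrow> U *\<^sub>v unit_vec K j = col U j"
  by (intro eq_vecI) auto

text \<open>
  The basis index \<open>b * M + m\<close> stands for \<open>|b\<rangle>|m\<rangle>\<close>; a slice fixes the second register.
\<close>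

definition slice :: "nat \<Rightarrow> nat \<Rightarrow> nat \<Rightarrow> complex vec \<Rightarrow> complex vec" where
  "slice d M m v = vec d (\<lambda>b. v $ (b * M + m))"

text \<open>The unitary on the first register controlled by the value of the second.\<close>

definition block_diag :: "nat \<Rightarrow> nat \<Rightarrow> (nat \<Rightarrow> complex mat) \<Rightarrow> complex mat" where
  "block_diag d M F = mat (d * M) (d * M)
     (\<lambda>(r, c). if r mod M = c mod M then F (r mod M) $$ (r div M, c div M) else 0)"

lemma mult_add_less: "b < d \<Longrightarrow> m < M \<Longrightarrow> b * M + m < d * (M :: nat)"
proof -
  assume "b < d" "m < M"
  then have "b * M + m < Suc b * M" by simp
  also have "\<dots> \<le> d * M" using \<open>b < d\<close> by (intro mult_right_mono) auto
  finally show ?thesis .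
qed

lemma sum_div_mod:
  fixes g :: "nat \<Rightarrow> 'a :: comm_monoid_add"
  shows "(\<Sum>c<d * M. g c) = (\<Sum>b<d. \<Sum>m<M. g (b * M + m))"
proof -
  have "(\<Sum>c<d * M. g c) = (\<Sum>b<d. sum g {b * M..<b * M + M})" by (rule sum.nat_group[symmetric])
  also have "\<dots> = (\<Sum>b<d. \<Sum>m<M. g (b * M + m))"
  proof (rule sum.cong[OF refl])
    fix b show "sum g {b * M..<b * M + M} = (\<Sum>m<M. g (b * M + m))"
      using sum.shift_bounds_nat_ivl[of g 0 "b * M" M] by (simp add: atLeast0LessThan add.commute)
  qed
  finally show ?thesis .
qed

lemma slice_eqI:
  assumes "u \<in> carrier_vec (d * M)" "v \<in> carrier_vec (d * M)"
    and "\<And>m. m < M \<Longrightarrow> slice d M m u = slice d M m v"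
  shows "u = v"
proof (rule eq_vecI)
  fix r assume "r < dim_vec v"
  then have r: "r < d * M" using assms by simp
  then have M: "r mod M < M" by (cases "M = 0") auto
  have d: "r div M < d" using r by (simp add: less_mult_imp_div_less)
  have "slice d M (r mod M) u $ (r div M) = slice d M (r mod M) v $ (r div M)"
    using assms(3)[OF M] by simp
  then show "u $ r = v $ r" using d by (simp add: slice_def)
qed (use assms in auto)

lemma block_diag_carrier: "block_diag d M F \<in> carrier_mat (d * M) (d * M)"
  by (simp add: block_diag_def)

lemma slice_carrier: "slice d M m v \<in> carrier_vec d"
  by (simp add: slice_def)

lemma slice_block_diag:
  assumes "v \<in> carrier_vec (d * M)" "m < M" "F m \<in> carrier_mat d d"
  shows "slice d M m (block_diag d M F *\<^sub>v v) = F m *\<^sub>v slice d M m v"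
proof (rule eq_vecI)
  fix b assume "b < dim_vec (F m *\<^sub>v slice d M m v)"
  then have b: "b < d" using assms by simp
  note lt = mult_add_less[OF b assms(2)]
  have "slice d M m (block_diag d M F *\<^sub>v v) $ b = (\<Sum>c<d * M. block_diag d M F $$ (b * M + m, c) * v $ c)"
    using b lt assms(1) by (simp add: slice_def scalar_prod_def atLeast0LessThan block_diag_def)
  also have "\<dots> = (\<Sum>b'<d. \<Sum>m'<M. if m' = m then F m $$ (b, b') * v $ (b' * M + m') else 0)"
    unfolding sum_div_mod using lt assms(2) mult_add_less[of _ d _ M]
    by (intro sum.cong refl) (auto simp: block_diag_def)
  also have "\<dots> = (\<Sum>b'<d. F m $$ (b, b') * v $ (b' * M + m))"
    using assms(2) by simp
  also have "\<dots> = (F m *\<^sub>v slice d M m v) $ b"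
    using b assms(3) by (auto simp: slice_def scalar_prod_def atLeast0LessThan)
  finally show "slice d M m (block_diag d M F *\<^sub>v v) $ b = (F m *\<^sub>v slice d M m v) $ b" .
qed (use assms in \<open>auto simp: slice_def\<close>)

lemma unitary_block_diag:
  assumes "\<And>m. m < M \<Longrightarrow> unitary_mat d (F m)"
  shows "unitary_mat (d * M) (block_diag d M F)"
proof -
  note c = unitary_carrier[OF assms]
  have adj: "mat_adjoint (block_diag d M F) = block_diag d M (\<lambda>m. mat_adjoint (F m))"
  proof (rule eq_matI)
    fix i j assume "i < dim_row (block_diag d M (\<lambda>m. mat_adjoint (F m)))" "j < dim_col (block_diag d M (\<lambda>m. mat_adjoint (F m)))"
    then have ij: "i < d * M" "j < d * M" by (auto simp: block_diag_def)
    then have "i mod M < M" "j mod M < M" by (cases "M = 0"; simp)+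
    moreover have "i div M < d" "j div M < d" using ij by (simp_all add: less_mult_imp_div_less)
    ultimately show "mat_adjoint (block_diag d M F) $$ (i, j) = block_diag d M (\<lambda>m. mat_adjoint (F m)) $$ (i, j)"
      unfolding mat_adjoint_index[OF block_diag_carrier ij] using ij
      by (auto simp: block_diag_def mat_adjoint_index[OF c])
  qed (use mat_adjoint_carrier[OF block_diag_carrier[of d M F]] in \<open>auto simp: block_diag_def\<close>)
  have "block_diag d M (\<lambda>m. mat_adjoint (F m)) * block_diag d M F = 1\<^sub>m (d * M)"
  proof (rule mat_col_eqI)
    fix j assume "j < dim_col (1\<^sub>m (d * M) :: complex mat)"
    then have j: "j < d * M" by simp
    let ?u = "col (block_diag d M F) j"
    have "block_diag d M (\<lambda>m. mat_adjoint (F m)) *\<^sub>v (block_diag d M F *\<^sub>v unit_vec (d * M) j) = unit_vec (d * M) j"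
    proof (rule slice_eqI[of _ d M])
      fix m assume m: "m < M"
      have "slice d M m (block_diag d M (\<lambda>m. mat_adjoint (F m)) *\<^sub>v (block_diag d M F *\<^sub>v unit_vec (d * M) j)) =
        mat_adjoint (F m) *\<^sub>v (F m *\<^sub>v slice d M m (unit_vec (d * M) j))"
        using m by (simp add: slice_block_diag mat_adjoint_carrier[OF c] c mult_mat_vec_carrier[OF block_diag_carrier])
      also have "\<dots> = slice d M m (unit_vec (d * M) j)"
        using assms[OF m] slice_carrier[of d M m]
        by (simp add: unitary_mat_def assoc_mult_mat_vec[OF mat_adjoint_carrier[OF c[OF m]] c[OF m] slice_carrier, symmetric])
      finally show "slice d M m (block_diag d M (\<lambda>m. mat_adjoint (F m)) *\<^sub>v (block_diag d M F *\<^sub>v unit_vec (d * M) j)) =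
        slice d M m (unit_vec (d * M) j)" .
    qed (auto intro!: mult_mat_vec_carrier block_diag_carrier)
    moreover have "block_diag d M F *\<^sub>v unit_vec (d * M) j = ?u"
      by (rule mult_unit_vec[OF block_diag_carrier j])
    ultimately show "col (block_diag d M (\<lambda>m. mat_adjoint (F m)) * block_diag d M F) j = col (1\<^sub>m (d * M)) j"
      using col_mult2[OF block_diag_carrier block_diag_carrier j] j by simp
  qed (simp_all add: block_diag_def)
  then have "mat_adjoint (block_diag d M F) * block_diag d M F = 1\<^sub>m (d * M)" by (simp add: adj)
  then show ?thesis
    using mat_mult_left_right_inverse[OF mat_adjoint_carrier[OF block_diag_carrier] block_diag_carrier] block_diag_carrier
    by (simp add: unitary_mat_def)
qed

lemma query_mat_block_diag:
  assumes "0 < M" "inputs A = inputs E" "workdim A = workdim E * M"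
  shows "query_mat A x = block_diag (state_dim E) M (\<lambda>_. query_mat E x)"
proof (rule eq_matI)
  have dim: "state_dim A = state_dim E * M" using assms by (simp add: state_dim_def)
  fix r c assume "r < dim_row (block_diag (state_dim E) M (\<lambda>_. query_mat E x))"
    "c < dim_col (block_diag (state_dim E) M (\<lambda>_. query_mat E x))"
  then have rc: "r < state_dim E * M" "c < state_dim E * M" by (auto simp: block_diag_def)
  have "c div (2 * (workdim E * M)) = c div M div (2 * workdim E)"
    by (simp add: div_mult2_eq[symmetric] mult_ac)
  moreover have "c div (workdim E * M) = c div M div workdim E"
    by (simp add: div_mult2_eq[symmetric] mult_ac)
  moreover have "c mod (workdim E * M) = M * (c div M mod workdim E) + c mod M"
    by (simp add: mod_mult2_eq mult.commute)
  ultimately have qi: "query_image A x c = query_image E x (c div M) * M + c mod M"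
    by (simp add: query_image_def basis_index_def assms Let_def algebra_simps)
  have "r = query_image A x c \<longleftrightarrow> r mod M = c mod M \<and> r div M = query_image E x (c div M)"
    unfolding qi using assms(1) by (metis div_mult_mod_eq div_mult_self3 mod_div_trivial mod_less_divisor
        mod_mult_self3 mod_mod_trivial add_0 not_less_zero div_less add.right_neutral)
  then show "query_mat A x $$ (r, c) = block_diag (state_dim E) M (\<lambda>_. query_mat E x) $$ (r, c)"
    using rc by (simp add: query_mat_def dim block_diag_def less_mult_imp_div_less)
qed (use assms in \<open>auto simp: query_mat_def block_diag_def state_dim_def\<close>)

text \<open>All unitaries and queries of \<open>E\<close> act on the slices separately, so each
  slice undergoes its own run of \<open>E\<close>.\<close>

lemma implementable_tensor:
  fixes E :: qcircuit
  assumes E: "wf_qcircuit E" and M: "0 < M"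
    and S: "\<And>x v v'. (x, v, v') \<in> S \<Longrightarrow> v \<in> carrier_vec (state_dim E * M) \<and> v' \<in> carrier_vec (state_dim E * M) \<and>
      (\<forall>m<M. slice (state_dim E) M m v' = run E x (slice (state_dim E) M m v))"
  shows "implementable (inputs E) (workdim E * M) (num_queries E) S"
proof -
  let ?d = "state_dim E"
  define T where "T = (\<lambda>U. block_diag ?d M (\<lambda>_. U))"
  define A where "A = circ (inputs E) (workdim E * M) (T (init_op E)) (map T (step_ops E))"
  have A: "init_op A = T (init_op E)" "step_ops A = map T (step_ops E)" by (simp_all add: A_def)
  have dim: "state_dim A = ?d * M" by (simp add: A_def state_dim_def)
  have c: "init_op E \<in> carrier_mat ?d ?d" "\<And>U. U \<in> set (step_ops E) \<Longrightarrow> U \<in> carrier_mat ?d ?d"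
    using E by (auto simp: wf_qcircuit_def intro: unitary_carrier)
  have wf: "wf_qcircuit A"
    using E M unfolding wf_qcircuit_def dim by (auto simp: A_def T_def intro!: unitary_block_diag)
  have Q: "query_mat A x = T (query_mat E x)" for x
    unfolding T_def using M by (intro query_mat_block_diag) (simp_all add: A_def)
  have sl: "slice ?d M m (T U *\<^sub>v v) = U *\<^sub>v slice ?d M m v"
    if "U \<in> carrier_mat ?d ?d" "v \<in> carrier_vec (?d * M)" "m < M" for U v m
    unfolding T_def using that by (intro slice_block_diag) auto
  have Tc: "T U *\<^sub>v v \<in> carrier_vec (?d * M)" if "v \<in> carrier_vec (?d * M)" for U v
    unfolding T_def by (rule mult_mat_vec_carrier[OF block_diag_carrier that])
  have fold: "slice ?d M m (foldl (\<lambda>u U. U *\<^sub>v (query_mat A x *\<^sub>v u)) v (map T Us)) =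
      foldl (\<lambda>u U. U *\<^sub>v (query_mat E x *\<^sub>v u)) (slice ?d M m v) Us"
    if "v \<in> carrier_vec (?d * M)" "m < M" "\<forall>U\<in>set Us. U \<in> carrier_mat ?d ?d" for v m Us x
    using that(1,3)
  proof (induction Us arbitrary: v)
    case (Cons U Us)
    then show ?case
      using that(2) by (simp add: Q Tc sl query_mat_carrier)
  qed simp
  have "run A x v = v'" if "(x, v, v') \<in> S" for x v v'
  proof (rule slice_eqI[of _ ?d M])
    note S = S[OF that]
    show "run A x v \<in> carrier_vec (?d * M)" using run_carrier[OF wf, of v x] S by (simp add: dim)
    show "v' \<in> carrier_vec (?d * M)" using S by simp
    fix m assume m: "m < M"
    have "slice ?d M m (run A x v) = run E x (slice ?d M m v)"
      unfolding run_def A using S m c by (simp add: fold Tc sl)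
    then show "slice ?d M m (run A x v) = slice ?d M m v'" using S m by simp
  qed
  then show ?thesis
    unfolding implementable_def using wf S
    by (intro exI[of _ "T (init_op E)"] exI[of _ "map T (step_ops E)"])
      (auto simp: A_def num_queries_def state_dim_def mult_ac)
qed

lemma foldl_linear:
  fixes Q :: "complex mat"
  assumes "Q \<in> carrier_mat D D" "\<forall>U\<in>set Us. U \<in> carrier_mat D D" "u \<in> carrier_vec D" "v \<in> carrier_vec D"
  shows "foldl (\<lambda>u U. U *\<^sub>v (Q *\<^sub>v u)) (a \<cdot>\<^sub>v u + b \<cdot>\<^sub>v v) Us =
    a \<cdot>\<^sub>v foldl (\<lambda>u U. U *\<^sub>v (Q *\<^sub>v u)) u Us + b \<cdot>\<^sub>v foldl (\<lambda>u U. U *\<^sub>v (Q *\<^sub>v u)) v Us"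
  using assms(2-)
proof (induction Us arbitrary: u v)
  case (Cons U Us)
  have lin: "U *\<^sub>v (a \<cdot>\<^sub>v u + b \<cdot>\<^sub>v v) = a \<cdot>\<^sub>v (U *\<^sub>v u) + b \<cdot>\<^sub>v (U *\<^sub>v v)"
    if "U \<in> carrier_mat D D" "u \<in> carrier_vec D" "v \<in> carrier_vec D" for U :: "complex mat" and u v
    using that by (simp add: mult_add_distrib_mat_vec[where nr=D and nc=D] mult_mat_vec[where nr=D and nc=D])
  have U: "U \<in> carrier_mat D D" using Cons by simp
  show ?case
    using Cons.IH[of "U *\<^sub>v (Q *\<^sub>v u)" "U *\<^sub>v (Q *\<^sub>v v)"] Cons.prems U assms(1)
    by (simp add: lin mult_mat_vec_carrier[OF U] mult_mat_vec_carrier[OF assms(1)])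
qed simp

lemma run_linear:
  assumes "wf_qcircuit A" "u \<in> carrier_vec (state_dim A)" "v \<in> carrier_vec (state_dim A)"
  shows "run A x (a \<cdot>\<^sub>v u + b \<cdot>\<^sub>v v) = a \<cdot>\<^sub>v run A x u + b \<cdot>\<^sub>v run A x v"
proof -
  let ?D = "state_dim A"
  have c: "init_op A \<in> carrier_mat ?D ?D" "\<forall>U\<in>set (step_ops A). U \<in> carrier_mat ?D ?D"
    using assms(1) by (auto simp: wf_qcircuit_def intro: unitary_carrier)
  have "init_op A *\<^sub>v (a \<cdot>\<^sub>v u + b \<cdot>\<^sub>v v) = a \<cdot>\<^sub>v (init_op A *\<^sub>v u) + b \<cdot>\<^sub>v (init_op A *\<^sub>v v)"
    using assms c by (simp add: mult_add_distrib_mat_vec[where nr="?D" and nc="?D"] mult_mat_vec[where nr="?D" and nc="?D"])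
  then show ?thesis
    unfolding run_def using foldl_linear[OF query_mat_carrier c(2)] assms c
    by (simp add: mult_mat_vec_carrier[OF c(1)])
qed

lemma run_smult:
  assumes "wf_qcircuit A" "u \<in> carrier_vec (state_dim A)"
  shows "run A x (a \<cdot>\<^sub>v u) = a \<cdot>\<^sub>v run A x u"
proof -
  have "a \<cdot>\<^sub>v u = a \<cdot>\<^sub>v u + 0 \<cdot>\<^sub>v u" "a \<cdot>\<^sub>v run A x u = a \<cdot>\<^sub>v run A x u + 0 \<cdot>\<^sub>v run A x u"
    using assms run_carrier[OF assms, of x] by (auto intro!: eq_vecI)
  then show ?thesis using run_linear[OF assms assms(2), of x a 0] by metis
qed

section \<open>Phase queries through an evaluator\<close>

text \<open>Among the indices \<open>b * M + m\<close>, those below \<open>M\<close> have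
  \<open>b = 0\<close>: all registers of a circuit \<open>E\<close> are zero, and the added register
  \<open>m\<close> stands for \<open>enc m\<close>.\<close>

definition pad :: "nat \<Rightarrow> (nat \<Rightarrow> 'i) \<Rightarrow> ('i \<Rightarrow> real) \<Rightarrow> nat \<Rightarrow> real" where
  "pad M enc p = (\<lambda>r. if r < M then p (enc r) else 0)"

lemma pad_supp: "M \<le> D \<Longrightarrow> pad M enc p \<in> supp {..<D}"
  by (auto simp: pad_def supp_def)

text \<open>\<open>T'\<close> is \<open>T\<close> on the first \<open>M\<close> coordinates and the
  identity on the rest.\<close>

lemma orth_transport:
  assumes T: "orth I T" and enc: "bij_betw enc {..<M} I" and D: "M \<le> D"
  obtains T' where "orth {..<D} T'" "\<And>p. p \<in> supp I \<Longrightarrow> T' (pad M enc p) = pad M enc (T p)"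
proof -
  define dec where "dec = inv_into {..<M} enc"
  define \<rho> where "\<rho> = (\<lambda>(p :: nat \<Rightarrow> real) i. if i \<in> I then p (dec i) else 0)"
  define T' where "T' = (\<lambda>p r. if r < M then T (\<rho> p) (enc r) else p r)"
  have dec: "dec (enc r) = r" "enc r \<in> I" if "r < M" for r
    using that enc by (auto simp: dec_def bij_betw_def)
  have dec': "dec i < M" "enc (dec i) = i" if "i \<in> I" for i
    using that enc bij_betw_inv_into_right[OF enc that] bij_betwE[OF bij_betw_inv_into[OF enc]] by (auto simp: dec_def)
  have \<rho>s: "\<rho> p \<in> supp I" for p by (auto simp: \<rho>_def supp_def)
  have \<rho>l: "\<rho> (\<lambda>i. a * p i + b * q i) = (\<lambda>i. a * \<rho> p i + b * \<rho> q i)" for a b p q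
    by (auto simp: \<rho>_def fun_eq_iff)
  have "lin T'"
    unfolding lin_def T'_def \<rho>l linD[OF orth_lin[OF T]] by auto
  moreover have "T' p \<in> supp {..<D}" if "p \<in> supp {..<D}" for p
    using that D by (auto simp: T'_def supp_def)
  moreover have "ip {..<D} (T' p) (T' p) = ip {..<D} p p" for p
  proof -
    have split: "{..<D} = {..<M} \<union> {M..<D}" using D by auto
    have "(\<Sum>r<M. T' p r * T' p r) = (\<Sum>r<M. T (\<rho> p) (enc r) * T (\<rho> p) (enc r))"
      by (simp add: T'_def)
    also have "\<dots> = ip I (T (\<rho> p)) (T (\<rho> p))"
      unfolding ip_def by (rule sum.reindex_bij_betw[OF enc])
    also have "\<dots> = ip I (\<rho> p) (\<rho> p)" by (rule orth_ip[OF T \<rho>s \<rho>s])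
    also have "\<dots> = (\<Sum>r<M. \<rho> p (enc r) * \<rho> p (enc r))"
      unfolding ip_def by (rule sum.reindex_bij_betw[OF enc, symmetric])
    also have "\<dots> = (\<Sum>r<M. p r * p r)" by (intro sum.cong) (auto simp: \<rho>_def dec)
    finally have "(\<Sum>r<M. T' p r * T' p r) = (\<Sum>r<M. p r * p r)" .
    moreover have "(\<Sum>r=M..<D. T' p r * T' p r) = (\<Sum>r=M..<D. p r * p r)"
      by (simp add: T'_def)
    ultimately show ?thesis unfolding ip_def split by (subst (1 2) sum.union_disjoint) auto
  qed
  ultimately have "orth {..<D} T'" by (simp add: orth_def)
  moreover have "T' (pad M enc p) = pad M enc (T p)" if "p \<in> supp I" for p
  proof -
    have "\<rho> (pad M enc p) = p" using that dec' by (auto simp: \<rho>_def pad_def supp_def fun_eq_iff)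
    then have "T' (pad M enc p) = (\<lambda>r. if r < M then T p (enc r) else pad M enc p r)"
      by (simp only: T'_def)
    then show ?thesis by (auto simp: pad_def fun_eq_iff)
  qed
  ultimately show ?thesis by (rule that)
qed

lemma rvec_delta: "rvec N (delta c) = unit_vec N c"
  by (auto simp: rvec_def delta_def unit_vec_def)

lemma slice_pad:
  assumes "0 < M" "m < M" "0 < d"
  shows "slice d M m (rvec (d * M) (pad M enc p)) = complex_of_real (p (enc m)) \<cdot>\<^sub>v unit_vec d 0"
proof (rule eq_vecI)
  fix b assume "b < dim_vec (complex_of_real (p (enc m)) \<cdot>\<^sub>v unit_vec d 0)"
  then have b: "b < d" by simp
  have "b * M + m < M \<longleftrightarrow> b = 0" using assms by (cases b) auto
  then show "slice d M m (rvec (d * M) (pad M enc p)) $ b = (complex_of_real (p (enc m)) \<cdot>\<^sub>v unit_vec d 0) $ b"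
    using b mult_add_less[OF b assms(2)] by (auto simp: slice_def rvec_def pad_def)
qed (simp add: slice_def)

text \<open>
  A phase query is one run of \<open>E\<close> on \<open>|i\<rangle>|j\<rangle>\<close> with the target bit in \<open>|0\<rangle> - |1\<rangle>\<close>. To make no
  query, the target bit is put in \<open>|0\<rangle> + |1\<rangle>\<close> instead, since \<open>E\<close> cannot be switched off.
\<close>

lemma phase_kickback_state:
  fixes E :: qcircuit
  assumes E: "wf_qcircuit E" and wd: "workdim E = n * n * 2 * anc" and anc: "0 < anc" and n: "0 < n"
    and l: "\<And>i j. l = Some (i, j) \<Longrightarrow> i < n \<and> j < n"
  obtains R u where "unitary_mat (state_dim E) R" "u \<in> carrier_vec (state_dim E)"
    "R *\<^sub>v unit_vec (state_dim E) 0 = u" "R *\<^sub>v u = unit_vec (state_dim E) 0"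
    "\<And>x f. evaluates n E x f \<Longrightarrow>
      run E x u = (case l of None \<Rightarrow> 1 | Some (i, j) \<Rightarrow> if f i j then - 1 else 1) \<cdot>\<^sub>v u"
proof -
  let ?d = "state_dim E"
  \<comment> \<open>Without a query to make, cell \<open>(0, 0)\<close> is a dummy; the sign
    \<open>\<sigma>\<close> ensures that its value has no effect.\<close>
  define k where "k = (case l of None \<Rightarrow> 0 | Some (i, j) \<Rightarrow> i * n + j)"
  define \<sigma> :: real where "\<sigma> = (case l of None \<Rightarrow> 1 | Some _ \<Rightarrow> - 1)"
  obtain i j where ij: "i < n" "j < n" "k = i * n + j" "\<And>i' j'. l = Some (i', j') \<Longrightarrow> i' = i \<and> j' = j"
  proof (cases l)
    case None
    then show ?thesis using that[of 0 0] n by (simp add: k_def)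
  next
    case (Some a)
    then show ?thesis using that[of "fst a" "snd a"] l[of "fst a" "snd a"] by (auto simp: k_def split: prod.split)
  qed
  define c where "c = (\<lambda>y. (k * 2 + y) * anc)"
  have wd_le: "workdim E \<le> ?d"
    using E by (auto simp: state_dim_def wf_qcircuit_def)
  have k: "k < n * n" using swap_lt[OF ij(1,2)] ij(3) by simp
  have cl: "c y < ?d" if "y < 2" for y
  proof -
    have "c y < n * n * 2 * anc" unfolding c_def using bit_lt[OF k that] anc by simp
    then show ?thesis using wd_le wd by simp
  qed
  have c01: "c 0 \<noteq> c 1" using anc by (simp add: c_def)
  \<comment> \<open>The target bit in \<open>(|0> + \<sigma> |1>) / sqrt 2\<close>: flipping the bit
    multiplies the state by \<open>\<sigma>\<close>.\<close>
  define \<tau> where "\<tau> = (\<lambda>r. (1 / sqrt 2) * delta (c 0) r + (\<sigma> / sqrt 2) * delta (c 1) r)"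
  have d0: "0 < ?d" using cl[of 0] by simp
  have \<tau>s: "\<tau> \<in> supp {..<?d}" using cl[of 0] cl[of 1] by (auto simp: \<tau>_def supp_def delta_def)
  have \<sigma>2: "\<sigma> * \<sigma> = 1" by (simp add: \<sigma>_def split: option.split)
  have "ip {..<?d} \<tau> \<tau> = 1"
    unfolding \<tau>_def ip_lin ip_lin2 using cl[of 0] cl[of 1] c01 \<sigma>2
    by (simp add: ip_delta) (simp add: delta_def field_simps)
  \<comment> \<open>An involution exchanging the zero state and \<open>\<tau>\<close>, so the same
    unitary prepares and removes the target state.\<close>
  then obtain T where T: "orth {..<?d} T" "\<And>p. T (T p) = p" "T (delta 0) = \<tau>"
  proof (atomize_elim)
    assume 1: "ip {..<?d} \<tau> \<tau> = 1"
    obtain T where "orth {..<?d} T" "\<And>p. T (T p) = p" "\<And>j. j \<in> {()} \<Longrightarrow> T (delta 0) = \<tau>"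
    proof (rule swap_exists[of "{..<?d}" "{()}" "\<lambda>_. delta 0" "\<lambda>_. \<tau>"])
      show "ip {..<?d} (delta 0) (delta 0) = ip {..<?d} \<tau> \<tau>"
        unfolding 1 using d0 by (simp add: ip_delta) (simp add: delta_def)
    qed (use d0 \<tau>s in \<open>auto simp: ip_comm intro!: delta_supp\<close>)
    then show "\<exists>T. orth {..<?d} T \<and> (\<forall>p. T (T p) = p) \<and> T (delta 0) = \<tau>" by blast
  qed
  define u where "u = rvec ?d \<tau>"
  have "T \<tau> = delta 0" using T(2)[of "delta 0"] T(3) by simp
  then have R: "orth_mat ?d T *\<^sub>v unit_vec ?d 0 = u" "orth_mat ?d T *\<^sub>v u = unit_vec ?d 0"
    using orth_mat_mult[OF T(1) delta_supp, of 0] orth_mat_mult[OF T(1) \<tau>s] d0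
    by (simp_all add: u_def rvec_delta T(3))
  define a b where "a = complex_of_real (1 / sqrt 2)" and "b = complex_of_real (\<sigma> / sqrt 2)"
  have u: "u = a \<cdot>\<^sub>v unit_vec ?d (c 0) + b \<cdot>\<^sub>v unit_vec ?d (c 1)"
    unfolding u_def rvec_delta[symmetric] by (auto simp: rvec_def \<tau>_def a_def b_def)
  have "run E x u = (case l of None \<Rightarrow> 1 | Some (i, j) \<Rightarrow> if f i j then - 1 else 1) \<cdot>\<^sub>v u"
    if ev: "evaluates n E x f" for x f
  proof -
    obtain anc' where anc': "anc' > 0" "workdim E = n * n * 2 * anc'"
      "\<forall>i<n. \<forall>j<n. \<forall>y<2. run E x (ket E 0 0 (((i * n + j) * 2 + y) * anc')) =
          ket E 0 0 (((i * n + j) * 2 + (y + of_bool (f i j)) mod 2) * anc')"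
      using ev unfolding evaluates_def by blast
    \<comment> \<open>\<open>evaluates\<close> hides the ancilla dimension, but
      \<open>workdim E\<close> determines it because \<open>n > 0\<close>.\<close>
    have "anc' = anc" using anc'(2) wd n by simp
    then have ev': "run E x (unit_vec ?d (c y)) = unit_vec ?d (c ((y + of_bool (f i j)) mod 2))" if "y < 2" for y
      using anc'(3) ij(1,2) that by (simp add: ket_def basis_index_def c_def ij(3))
    have run_u: "run E x u = a \<cdot>\<^sub>v unit_vec ?d (c (of_bool (f i j) mod 2)) + b \<cdot>\<^sub>v unit_vec ?d (c ((1 + of_bool (f i j)) mod 2))"
      unfolding u run_linear[OF E unit_vec_carrier unit_vec_carrier] using ev'[of 0] ev'[of 1] by simp
    show ?thesis
    proof (cases "f i j")
      case False
      then show ?thesis using run_u u ij(4) by (auto split: option.split)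
    next
      case f: True
      have ru: "run E x u = a \<cdot>\<^sub>v unit_vec ?d (c 1) + b \<cdot>\<^sub>v unit_vec ?d (c 0)"
        using run_u f by simp
      show ?thesis
      proof (cases l)
        case None
        then have "b = a" by (simp add: a_def b_def \<sigma>_def)
        then show ?thesis using ru u None by (simp add: comm_add_vec[of _ ?d])
      next
        case (Some p)
        then have "b = - a" by (simp add: a_def b_def \<sigma>_def)
        then have "run E x u = (- 1) \<cdot>\<^sub>v u" unfolding ru by (auto simp: u intro!: eq_vecI)
        then show ?thesis using Some f ij(4) by (auto split: prod.split)
      qed
    qed
  qed
  moreover have "u \<in> carrier_vec ?d" by (simp add: u_def rvec_def)
  ultimately show ?thesis using that[OF orth_mat_unitary[OF T(1)] _ R] by blast
qed

section \<open>Translation of steps into a circuit\<close>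

lemma exec_step_supp: "wf_step I L s \<Longrightarrow> p \<in> supp I \<Longrightarrow> exec_step x s p \<in> supp I"
  by (cases s) (simp_all add: orth_supp orth_supp[OF orth_phase])

text \<open>Circuits start in basis index 0, so the start state has to be enumerated first.\<close>

lemma bij_enum_from:
  assumes "finite I" "i0 \<in> I"
  obtains enc :: "nat \<Rightarrow> 'i" where "bij_betw enc {..<card I} I" "enc 0 = i0"
proof -
  have "0 < card I" using assms by (auto simp: card_gt_0_iff)
  then have "card ({..<card I} - {0}) = card (I - {i0})" using assms by simp
  then obtain h where h: "bij_betw h ({..<card I} - {0}) (I - {i0})"
    using finite_same_card_bij[of "{..<card I} - {0}" "I - {i0}"] assms(1) by auto
  define enc where "enc = (\<lambda>r. if r = 0 then i0 else h r)"
  have "bij_betw enc ({..<card I} - {0}) (I - {i0})"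
    using h by (rule bij_betw_cong[THEN iffD1, rotated]) (auto simp: enc_def)
  moreover have "bij_betw enc {0} {i0}" by (simp add: enc_def bij_betw_def)
  ultimately have "bij_betw enc (({..<card I} - {0}) \<union> {0}) ((I - {i0}) \<union> {i0})"
    by (rule bij_betw_combine) auto
  moreover have "({..<card I} - {0}) \<union> {0} = {..<card I}" using \<open>0 < card I\<close> by auto
  moreover have "(I - {i0}) \<union> {i0} = I" using assms by auto
  ultimately show ?thesis using that[of enc] by (simp add: enc_def)
qed

text \<open>The state of the steps is kept in an added register, with the registers of
  \<open>E\<close> at zero between steps. An \<open>Op\<close> costs nothing; a \<open>Qry\<close>
  prepares kickback states, runs \<open>E\<close> once and removes them. The circuit does not depend
  on \<open>x\<close> and \<open>f\<close>.\<close>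

lemma qalgorithm_of_steps:
  fixes E :: qcircuit and g :: "'i \<Rightarrow> 'r"
  assumes E: "wf_qcircuit E" and wd: "workdim E = n * n * 2 * anc" and anc: "0 < anc" and n: "0 < n"
    and I: "finite I" "i0 \<in> I" and steps: "\<forall>s\<in>set steps. wf_step I ({..<n} \<times> {..<n}) s"
  shows "\<exists>A :: 'r qalgorithm. wf_qcircuit A \<and> inputs A = inputs E \<and>
    num_queries A = sum_list (map step_cost steps) * num_queries E \<and>
    (\<forall>x f correct. evaluates n E x f \<longrightarrow> error_prob A x correct \<le>
      (\<Sum>i | i \<in> I \<and> \<not> correct (g i). (exec (\<lambda>(i, j). f i j) steps (delta i0) i)\<^sup>2))"
proof -
  define M where "M = card I"
  obtain enc where enc: "bij_betw enc {..<M} I" "enc 0 = i0"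
    using bij_enum_from[OF I] M_def by metis
  have M: "0 < M" using I by (auto simp: M_def card_gt_0_iff)
  let ?d = "state_dim E"
  let ?N = "inputs E" and ?W = "workdim E * M"
  let ?F = "\<lambda>f (i, j). f i j"
  have NW: "0 < ?N" "0 < ?W" using E M by (auto simp: wf_qcircuit_def)
  have d: "0 < ?d" using E by (auto simp: wf_qcircuit_def state_dim_def)
  have dim: "?N * 2 * ?W = ?d * M" by (simp add: state_dim_def)
  have Md: "M \<le> ?d * M" using d by simp
  define emb where "emb = (\<lambda>p. rvec (?d * M) (pad M enc p))"
  have embc: "emb p \<in> carrier_vec (?d * M)" for p by (simp add: emb_def rvec_def)
  have op: "implementable ?N ?W 0 {(x, emb p, emb (T p)) |x f p. evaluates n E x f \<and> p \<in> supp I}"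
    if T: "orth I T" for T
  proof -
    obtain T' where T': "orth {..<?d * M} T'" "\<And>p. p \<in> supp I \<Longrightarrow> T' (pad M enc p) = pad M enc (T p)"
      using orth_transport[OF T enc(1) Md] by blast
    show ?thesis
    proof (rule implementable_unitary[OF NW])
      show "unitary_mat (?N * 2 * ?W) (orth_mat (?d * M) T')"
        unfolding dim by (rule orth_mat_unitary[OF T'(1)])
      show "v \<in> carrier_vec (?N * 2 * ?W) \<and> orth_mat (?d * M) T' *\<^sub>v v = v'"
        if "(x, v, v') \<in> {(x, emb p, emb (T p)) |x f p. evaluates n E x f \<and> p \<in> supp I}" for x v v'
        using that unfolding dim by (auto simp: embc) (simp add: emb_def orth_mat_mult[OF T'(1) pad_supp[OF Md]] T'(2))
    qed
  qed
  have qry: "implementable ?N ?W (num_queries E)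
      {(x, emb p, emb (phase lab (?F f) p)) |x f p. evaluates n E x f \<and> p \<in> supp I}"
    if lab: "wf_step I ({..<n} \<times> {..<n}) (Qry lab)" for lab
  proof -
    define sg where "sg = (\<lambda>(f :: nat \<Rightarrow> nat \<Rightarrow> bool) l. case l of None \<Rightarrow> 1 | Some (i, j) \<Rightarrow> if f i j then - 1 else (1 :: real))"
    have ph: "phase lab (?F f) p i = sg f (lab i) * p i" for f p i
      by (simp add: phase_def sg_def split: option.split prod.split)
    define P where "P = (\<lambda>m R u. unitary_mat ?d R \<and> u \<in> carrier_vec ?d \<and>
      R *\<^sub>v unit_vec ?d 0 = u \<and> R *\<^sub>v u = unit_vec ?d 0 \<and>
      (\<forall>x f. evaluates n E x f \<longrightarrow> run E x u = complex_of_real (sg f (lab (enc m))) \<cdot>\<^sub>v u))"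
    have "\<forall>m. \<exists>R u. m < M \<longrightarrow> P m R u"
    proof (intro allI)
      fix m
      show "\<exists>R u. m < M \<longrightarrow> P m R u"
      proof (cases "m < M")
        case True
        then have "enc m \<in> I" using enc(1) by (auto simp: bij_betw_def)
        then have l: "i < n \<and> j < n" if "lab (enc m) = Some (i, j)" for i j
          using lab that by auto
        obtain R u where "unitary_mat ?d R" "u \<in> carrier_vec ?d"
          "R *\<^sub>v unit_vec ?d 0 = u" "R *\<^sub>v u = unit_vec ?d 0"
          "\<And>x f. evaluates n E x f \<Longrightarrow>
            run E x u = (case lab (enc m) of None \<Rightarrow> 1 | Some (i, j) \<Rightarrow> if f i j then - 1 else 1) \<cdot>\<^sub>v u"
          by (rule phase_kickback_state[OF E wd anc n, of "lab (enc m)"]) (use l in blast, rule that)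
        moreover have "(case l of None \<Rightarrow> 1 | Some (i, j) \<Rightarrow> if f i j then - 1 else 1) = complex_of_real (sg f l)" for l f
          by (auto simp: sg_def split: option.split prod.split)
        ultimately have "P m R u" by (simp add: P_def)
        then show ?thesis by blast
      qed simp
    qed
    then obtain R u where "\<forall>m. m < M \<longrightarrow> P m (R m) (u m)" by metis
    then have R: "unitary_mat ?d (R m)" "u m \<in> carrier_vec ?d" "R m *\<^sub>v unit_vec ?d 0 = u m"
      "R m *\<^sub>v u m = unit_vec ?d 0"
      "\<And>x f. evaluates n E x f \<Longrightarrow> run E x (u m) = complex_of_real (sg f (lab (enc m))) \<cdot>\<^sub>v u m"
      if "m < M" for m using that unfolding P_def by blast+
    \<comment> \<open>Index \<open>m\<close> gets its own kickback state \<open>u m\<close>, on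
      which a run of \<open>E\<close> acts as multiplication by the sign of the phase query.\<close>
    define \<R> where "\<R> = block_diag ?d M R"
    have \<R>: "unitary_mat (?N * 2 * ?W) \<R>"
      unfolding dim \<R>_def by (rule unitary_block_diag) (rule R(1))
    have \<R>c: "\<R> *\<^sub>v v \<in> carrier_vec (?d * M)" if "v \<in> carrier_vec (?d * M)" for v
      unfolding \<R>_def by (rule mult_mat_vec_carrier[OF block_diag_carrier that])
    have sl: "slice ?d M m (\<R> *\<^sub>v v) = R m *\<^sub>v slice ?d M m v" if "v \<in> carrier_vec (?d * M)" "m < M" for v m
      unfolding \<R>_def using that R(1) by (intro slice_block_diag) (auto intro: unitary_carrier)
    have sl_emb: "slice ?d M m (\<R> *\<^sub>v emb p) = complex_of_real (p (enc m)) \<cdot>\<^sub>v u m" if "m < M" for p m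
      unfolding sl[OF embc that] unfolding emb_def slice_pad[OF M that d]
      by (simp add: mult_mat_vec[OF unitary_carrier[OF R(1)[OF that]]] R(3)[OF that])
    have inv: "\<R> *\<^sub>v (\<R> *\<^sub>v emb p) = emb p" for p
    proof (rule slice_eqI[of _ ?d M])
      fix m assume m: "m < M"
      show "slice ?d M m (\<R> *\<^sub>v (\<R> *\<^sub>v emb p)) = slice ?d M m (emb p)"
        unfolding sl[OF \<R>c[OF embc] m] sl_emb[OF m] unfolding emb_def slice_pad[OF M m d]
        by (simp add: mult_mat_vec[OF unitary_carrier[OF R(1)[OF m]] R(2)[OF m]] R(4)[OF m])
    qed (intro \<R>c embc)+
    let ?G = "\<lambda>(Q :: (nat \<Rightarrow> bool) \<Rightarrow> (nat \<Rightarrow> nat \<Rightarrow> bool) \<Rightarrow> ('i \<Rightarrow> real) \<Rightarrow> complex vec \<times> complex vec).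
      {(x, Q x f p) |x f p. evaluates n E x f \<and> p \<in> supp I}"
    have 1: "implementable ?N ?W 0 (?G (\<lambda>x f p. (emb p, \<R> *\<^sub>v emb p)))"
      by (rule implementable_unitary[OF NW \<R>]) (auto simp: dim embc[unfolded dim])
    have 2: "implementable ?N ?W (num_queries E) (?G (\<lambda>x f p. (\<R> *\<^sub>v emb p, \<R> *\<^sub>v emb (phase lab (?F f) p))))"
    proof (rule implementable_tensor[OF E M])
      fix x v v'
      assume "(x, v, v') \<in> ?G (\<lambda>x f p. (\<R> *\<^sub>v emb p, \<R> *\<^sub>v emb (phase lab (?F f) p)))"
      then obtain f p where fp: "evaluates n E x f" "v = \<R> *\<^sub>v emb p" "v' = \<R> *\<^sub>v emb (phase lab (?F f) p)" by auto
      have "slice ?d M m v' = run E x (slice ?d M m v)" if m: "m < M" for m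
        unfolding fp(2,3) sl_emb[OF m] ph run_smult[OF E R(2)[OF m]] R(5)[OF m fp(1)]
        by (simp add: smult_smult_assoc mult.commute)
      then show "v \<in> carrier_vec (?d * M) \<and> v' \<in> carrier_vec (?d * M) \<and>
        (\<forall>m<M. slice ?d M m v' = run E x (slice ?d M m v))"
        unfolding fp(2,3) using \<R>c embc by blast
    qed
    have 3: "implementable ?N ?W 0 (?G (\<lambda>x f p. (\<R> *\<^sub>v emb (phase lab (?F f) p), emb (phase lab (?F f) p))))"
      by (rule implementable_unitary[OF NW \<R>]) (auto simp: dim inv \<R>c embc)
    have 12: "implementable ?N ?W (0 + num_queries E) (?G (\<lambda>x f p. (emb p, \<R> *\<^sub>v emb (phase lab (?F f) p))))"
      by (rule implementable_comp[OF 1 2]) auto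
    have "implementable ?N ?W (0 + num_queries E + 0) (?G (\<lambda>x f p. (emb p, emb (phase lab (?F f) p))))"
      by (rule implementable_comp[OF 12 3]) auto
    then show ?thesis by simp
  qed
  have "implementable ?N ?W (sum_list (map step_cost steps) * num_queries E)
    {(x, emb p, emb (exec (?F f) steps p)) |x f p. evaluates n E x f \<and> p \<in> supp I}"
    using steps
  proof (induction steps)
    case Nil
    have "orth I (\<lambda>p. p)" by (simp add: orth_def lin_def)
    from op[OF this] show ?case by (simp add: exec_def)
  next
    case (Cons s ss)
    have s: "wf_step I ({..<n} \<times> {..<n}) s" using Cons.prems by simp
    have 1: "implementable ?N ?W (step_cost s * num_queries E)
      {(x, emb p, emb (exec_step (?F f) s p)) |x f p. evaluates n E x f \<and> p \<in> supp I}"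
      using op qry s by (cases s) auto
    have 2: "implementable ?N ?W (sum_list (map step_cost ss) * num_queries E)
      {(x, emb p, emb (exec (?F f) ss p)) |x f p. evaluates n E x f \<and> p \<in> supp I}"
      using Cons by simp
    have "implementable ?N ?W (step_cost s * num_queries E + sum_list (map step_cost ss) * num_queries E)
      {(x, emb p, emb (exec (?F f) (s # ss) p)) |x f p. evaluates n E x f \<and> p \<in> supp I}"
    proof (rule implementable_comp[OF 1 2])
      fix x v v' assume "(x, v, v') \<in> {(x, emb p, emb (exec (?F f) (s # ss) p)) |x f p. evaluates n E x f \<and> p \<in> supp I}"
      then obtain f p where "evaluates n E x f" "p \<in> supp I" "v = emb p" "v' = emb (exec (?F f) (s # ss) p)"
        by blast
      then show "\<exists>u. (x, v, u) \<in> {(x, emb p, emb (exec_step (?F f) s p)) |x f p. evaluates n E x f \<and> p \<in> supp I} \<and>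
        (x, u, v') \<in> {(x, emb p, emb (exec (?F f) ss p)) |x f p. evaluates n E x f \<and> p \<in> supp I}"
        using exec_step_supp[OF s, of p "?F f"]
        by (intro exI[of _ "emb (exec_step (?F f) s p)"]) (auto simp: exec_def)
    qed
    then show ?case by (simp add: algebra_simps)
  qed
  then obtain U Us where U: "wf_qcircuit (circ ?N ?W U Us)"
    "length Us = sum_list (map step_cost steps) * num_queries E"
    "\<forall>(x, v, v')\<in>{(x, emb p, emb (exec (?F f) steps p)) |x f p. evaluates n E x f \<and> p \<in> supp I}.
      v \<in> carrier_vec (?N * 2 * ?W) \<and> run (circ ?N ?W U Us) x v = v'"
    unfolding implementable_def by (elim exE conjE) (rule that)
  have U_run: "run (circ ?N ?W U Us) x (emb p) = emb (exec (?F f) steps p)"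
    if "evaluates n E x f" "p \<in> supp I" for x f p
  proof -
    have "(x, emb p, emb (exec (?F f) steps p)) \<in> {(x, emb p, emb (exec (?F f) steps p)) |x f p. evaluates n E x f \<and> p \<in> supp I}"
      using that by blast
    from bspec[OF U(3) this] show ?thesis by simp
  qed
  define A where "A = \<lparr>inputs = ?N, workdim = ?W, init_op = U, step_ops = Us, outcome = \<lambda>b. g (enc b)\<rparr>"
  have dimA: "state_dim A = ?d * M" by (simp add: A_def state_dim_def)
  have "wf_qcircuit A" using U(1) unfolding wf_qcircuit_def dimA by (simp add: A_def dim[symmetric])
  moreover have "error_prob A x correct \<le> (\<Sum>i | i \<in> I \<and> \<not> correct (g i). (exec (?F f) steps (delta i0) i)\<^sup>2)"
    if ev: "evaluates n E x f" for x f correct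
  proof -
    have "pad M enc (delta i0) = delta 0"
      using enc M by (auto simp: pad_def delta_def fun_eq_iff bij_betw_def inj_on_def)
    then have "ket A 0 0 0 = emb (delta i0)"
      by (simp add: ket_def dimA basis_index_def emb_def rvec_delta)
    moreover have "run A x v = run (circ ?N ?W U Us) x v" for v
      using query_mat_cong[of A "circ ?N ?W U Us" x] by (simp add: run_def A_def)
    ultimately have run: "run A x (ket A 0 0 0) = emb (exec (?F f) steps (delta i0))"
      using U_run[OF ev delta_supp[OF I(2)]] by simp
    have "error_prob A x correct = (\<Sum>b | b < ?d * M \<and> \<not> correct (g (enc b)). (pad M enc (exec (?F f) steps (delta i0)) b)\<^sup>2)"
      unfolding error_prob_def run dimA
      by (intro sum.cong) (auto simp: A_def emb_def rvec_def)
    also have "\<dots> = (\<Sum>b | b < M \<and> \<not> correct (g (enc b)). (exec (?F f) steps (delta i0) (enc b))\<^sup>2)"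
      \<comment> \<open>Amplitudes beyond the first \<open>M\<close> indices vanish.\<close>
      by (intro sum.mono_neutral_cong_right) (auto simp: pad_def dest: less_le_trans[OF _ Md])
    also have "\<dots> = (\<Sum>i | i \<in> I \<and> \<not> correct (g i). (exec (?F f) steps (delta i0) i)\<^sup>2)"
    proof (rule sum.reindex_bij_betw)
      have "bij_betw enc {b \<in> {..<M}. \<not> correct (g (enc b))} {i \<in> I. \<not> correct (g i)}"
        using enc(1) by (auto simp: bij_betw_def inj_on_def)
      then show "bij_betw enc {b. b < M \<and> \<not> correct (g (enc b))} {i. i \<in> I \<and> \<not> correct (g i)}" by simp
    qed
    finally show ?thesis by simp
  qed
  moreover have "inputs A = inputs E" "num_queries A = sum_list (map step_cost steps) * num_queries E"
    using U(2) by (simp_all add: A_def num_queries_def)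
  ultimately show ?thesis by blast
qed

section \<open>Binary search and scans\<close>

text \<open>The numbers with which a binary search for \<open>c\<close> in
  \<open>{b..<b + 2 ^ m}\<close> compares, one midpoint per round.\<close>

primrec thresholds :: "nat \<Rightarrow> nat \<Rightarrow> nat \<Rightarrow> nat set" where
  "thresholds 0 b c = {}"
| "thresholds (Suc m) b c = insert (b + 2 ^ m) (if b + 2 ^ m \<le> c then thresholds m (b + 2 ^ m) c else thresholds m b c)"

lemma thresholds_range: "t \<in> thresholds m b c \<Longrightarrow> b < t \<and> t < b + 2 ^ m"
proof (induction m arbitrary: b)
  case (Suc m)
  have "(0::nat) < 2 ^ m" by simp
  then show ?case using Suc.IH[of b] Suc.IH[of "b + 2 ^ m"] Suc.prems
    unfolding thresholds.simps power_Suc by (auto split: if_splits)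
qed simp

lemma finite_thresholds: "finite (thresholds m b c)"
  by (induction m arbitrary: b) auto

lemma card_thresholds: "card (thresholds m b c) \<le> m"
proof (induction m arbitrary: b)
  case (Suc m)
  have "card (thresholds (Suc m) b c) \<le> Suc (card (if b + 2 ^ m \<le> c then thresholds m (b + 2 ^ m) c else thresholds m b c))"
    using card_insert_le_m1[of "Suc (card (if b + 2 ^ m \<le> c then thresholds m (b + 2 ^ m) c else thresholds m b c))"]
    by (simp add: card_insert_if finite_thresholds)
  also have "\<dots> \<le> Suc m" using Suc.IH by simp
  finally show ?case .
qed simp

text \<open>The two search paths coincide up to the first midpoint that lies between
  \<open>c\<close> and \<open>c'\<close>. From then on they run in intervals on either side of it,
  so by \<open>thresholds_range\<close> they share no further threshold.\<close>

lemma thresholds_separates: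
  assumes "b \<le> c" "c < b + 2 ^ m" "b \<le> c'" "c' < b + 2 ^ m" "c \<noteq> c'"
  shows "\<exists>t. {t \<in> thresholds m b c \<inter> thresholds m b c'. (t \<le> c) \<noteq> (t \<le> c')} = {t}"
  using assms
proof (induction m arbitrary: b)
  case (Suc m)
  let ?t = "b + 2 ^ m"
  consider "c < ?t" "?t \<le> c'" | "c' < ?t" "?t \<le> c" | "c < ?t" "c' < ?t" | "?t \<le> c" "?t \<le> c'" by linarith
  then show ?case
  proof cases
    case 1
    have "{t \<in> thresholds (Suc m) b c \<inter> thresholds (Suc m) b c'. (t \<le> c) \<noteq> (t \<le> c')} = {?t}"
      using 1 thresholds_range[of _ m b c] thresholds_range[of _ m ?t c'] by fastforce
    then show ?thesis by blast
  next
    case 2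
    have "{t \<in> thresholds (Suc m) b c \<inter> thresholds (Suc m) b c'. (t \<le> c) \<noteq> (t \<le> c')} = {?t}"
      using 2 thresholds_range[of _ m b c'] thresholds_range[of _ m ?t c] by fastforce
    then show ?thesis by blast
  next
    case 3
    then have "{t \<in> thresholds (Suc m) b c \<inter> thresholds (Suc m) b c'. (t \<le> c) \<noteq> (t \<le> c')} =
      {t \<in> thresholds m b c \<inter> thresholds m b c'. (t \<le> c) \<noteq> (t \<le> c')}" by auto
    then show ?thesis using Suc.IH[of b] Suc.prems 3 by simp
  next
    case 4
    then have "{t \<in> thresholds (Suc m) b c \<inter> thresholds (Suc m) b c'. (t \<le> c) \<noteq> (t \<le> c')} =
      {t \<in> thresholds m ?t c \<inter> thresholds m ?t c'. (t \<le> c) \<noteq> (t \<le> c')}" by auto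
    then show ?thesis using Suc.IH[of ?t] Suc.prems 4 by (simp add: mult_2 add.assoc)
  qed
qed simp

section \<open>Scans that stop at the first marked position\<close>

definition stop :: "nat \<Rightarrow> (nat \<Rightarrow> bool) \<Rightarrow> nat" where
  "stop a F = (LEAST p. a \<le> p \<or> F p)"

lemma stop_le: "stop a F \<le> a"
  unfolding stop_def by (rule Least_le) simp

lemma stop_not: "p < stop a F \<Longrightarrow> \<not> F p"
  unfolding stop_def by (drule not_less_Least) simp

lemma stop_hit: "stop a F < a \<Longrightarrow> F (stop a F)"
  using LeastI[of "\<lambda>p. a \<le> p \<or> F p" a] unfolding stop_def by auto

lemma le_stop_iff: "e \<le> a \<Longrightarrow> e \<le> stop a F \<longleftrightarrow> (\<forall>p<e. \<not> F p)"
proof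
  assume "e \<le> a" and F: "\<forall>p<e. \<not> F p"
  show "e \<le> stop a F"
  proof (rule ccontr)
    assume "\<not> e \<le> stop a F"
    then show False using stop_hit[of a F] F \<open>e \<le> a\<close> by auto
  qed
qed (use stop_not less_le_trans in blast)

text \<open>Before both stops neither scan sees a mark. At the earlier stop one sees a mark and the
  other does not, unless the stops coincide.\<close>

lemma stop_diff:
  "{p. p < a \<and> p \<le> stop a F \<and> p \<le> stop a G \<and> F p \<noteq> G p} =
    (if stop a F = stop a G then {} else {min (stop a F) (stop a G)})"
proof -
  have *: "p = min (stop a F) (stop a G) \<and> stop a F \<noteq> stop a G"
    if "p < a" "p \<le> stop a F" "p \<le> stop a G" "F p \<noteq> G p" for p
    using that stop_not[of p a F] stop_not[of p a G] stop_hit[of a F] stop_hit[of a G]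
    by (cases "stop a F" "stop a G" rule: linorder_cases) (auto simp: min_def le_less)
  have "stop a F < a \<and> F (stop a F) \<and> \<not> G (stop a F)" if "stop a F < stop a G"
    using that stop_not[OF that] stop_le[of a G] stop_hit[of a F] by auto
  moreover have "stop a G < a \<and> G (stop a G) \<and> \<not> F (stop a G)" if "stop a G < stop a F"
    using that stop_not[OF that] stop_le[of a F] stop_hit[of a G] by auto
  ultimately show ?thesis
    using * by (cases "stop a F" "stop a G" rule: linorder_cases) (auto simp: min_def)
qed

text \<open>
  The scan of \<open>F\<close> is followed by the scan of \<open>G\<close>. A vertex of the second scan records where the first
  one stopped, so that two inputs share a vertex only while their histories agree.
\<close>

definition verts :: "nat \<Rightarrow> nat \<Rightarrow> (nat \<Rightarrow> bool) \<Rightarrow> (nat \<Rightarrow> bool) \<Rightarrow> (nat \<times> nat) set" where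
  "verts a a' F G = {0} \<times> {p. p < a \<and> p \<le> stop a F} \<union> {Suc (stop a F)} \<times> {p. p < a' \<and> p \<le> stop a' G}"

definition label :: "(nat \<Rightarrow> bool) \<Rightarrow> (nat \<Rightarrow> bool) \<Rightarrow> nat \<times> nat \<Rightarrow> bool" where
  "label F G v = (if fst v = 0 then F (snd v) else G (snd v))"

text \<open>If the first scans stop at different places, \<open>stop_diff\<close> gives one vertex
  there, and the recorded stops keep the second scans disjoint. Otherwise the first scans do not
  differ and the one vertex lies in the second scan.\<close>

lemma verts_separates:
  assumes "stop a F \<noteq> stop a F' \<or> stop a' G \<noteq> stop a' G'"
  shows "\<exists>v. {v \<in> verts a a' F G \<inter> verts a a' F' G'. label F G v \<noteq> label F' G' v} = {v}"
proof -
  have "{v \<in> verts a a' F G \<inter> verts a a' F' G'. label F G v \<noteq> label F' G' v} =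
    {0} \<times> {p. p < a \<and> p \<le> stop a F \<and> p \<le> stop a F' \<and> F p \<noteq> F' p} \<union>
    (if stop a F = stop a F' then {Suc (stop a F)} \<times> {p. p < a' \<and> p \<le> stop a' G \<and> p \<le> stop a' G' \<and> G p \<noteq> G' p} else {})"
    by (auto simp: verts_def label_def)
  also have "\<exists>v. \<dots> = {v}"
    unfolding stop_diff using assms by (cases "stop a F = stop a F'") auto
  finally show ?thesis .
qed

lemma finite_verts: "finite (verts a a' F G)"
  by (simp add: verts_def)

text \<open>A scan meets a mark only where it stops.\<close>

lemma card_verts_label: "card {v \<in> verts a a' F G. label F G v} \<le> 2"
proof -
  have "{v \<in> verts a a' F G. label F G v} \<subseteq> {(0, stop a F), (Suc (stop a F), stop a' G)}"
    using stop_not[of _ a F] stop_not[of _ a' G] by (fastforce simp: verts_def label_def le_less)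
  from card_mono[OF _ this] show ?thesis by simp
qed

lemma card_verts: "card (verts a a' F G) \<le> a + a'"
proof -
  have "card {p. p < a \<and> p \<le> stop a F} \<le> a" for a F
    using card_mono[of "{..<a}" "{p. p < a \<and> p \<le> stop a F}"] by auto
  note 1 = this[of a F] this[of a' G]
  have "card (verts a a' F G) \<le> card ({0::nat} \<times> {p. p < a \<and> p \<le> stop a F}) + card ({Suc (stop a F)} \<times> {p. p < a' \<and> p \<le> stop a' G})"
    unfolding verts_def by (rule card_Un_le)
  also have "\<dots> \<le> a + a'" using 1 by (simp add: card_cartesian_product)
  finally show ?thesis .
qed

section \<open>Codes of empty rectangles\<close>

lemma mod_mult_add_less: "e < d \<Longrightarrow> (q * d + e) mod d = (e :: nat)"
  and div_mult_add_less: "e < d \<Longrightarrow> (q * d + e) div d = (q :: nat)"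
  by simp_all

definition valid :: "nat \<Rightarrow> nat \<Rightarrow> (nat \<times> nat \<Rightarrow> bool) \<Rightarrow> nat \<Rightarrow> nat \<Rightarrow> nat \<Rightarrow> bool" where
  "valid n d x h r y \<longleftrightarrow> 1 \<le> h \<and> r + d \<le> n \<and> y + h \<le> n \<and> (\<forall>i\<in>{r..<r + d}. \<forall>j\<in>{y..<y + h}. \<not> x (i, j))"

text \<open>Base \<open>n\<close> with the height as leading part: the order of codes refines the
  order of heights, and the corner can be read off.\<close>

definition code :: "nat \<Rightarrow> nat \<Rightarrow> nat \<Rightarrow> nat \<Rightarrow> nat" where
  "code n h r y = (h * n + r) * n + y"

text \<open>0 signals that there is no rectangle. It is not the code of a valid one, whose height is
  at least 1.\<close>

definition best :: "nat \<Rightarrow> nat \<Rightarrow> (nat \<times> nat \<Rightarrow> bool) \<Rightarrow> nat" where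
  "best n d x = Max (insert 0 {code n h r y |h r y. valid n d x h r y})"

lemma code_div:
  assumes "r < n" "y < n"
  shows "code n h r y div n div n = h" "code n h r y div n mod n = r" "code n h r y mod n = y"
  using assms by (simp_all add: code_def)

lemma valid_bounds: "valid n d x h r y \<Longrightarrow> 1 \<le> d \<Longrightarrow> h \<le> n \<and> r < n \<and> y < n"
  by (auto simp: valid_def)

lemma code_bound:
  assumes "h \<le> n" "r < n" "y < n"
  shows "code n h r y < 2 * n ^ 3"
proof -
  have "h * n + r < n * n + n" using assms by (intro add_le_less_mono) auto
  then have "code n h r y < (n * n + n) * n"
    unfolding code_def using assms(3) by (intro mult_add_less)
  also have "\<dots> \<le> 2 * n ^ 3"
  proof -
    have "n * n \<le> n * n * n" using assms(2) by (cases n) auto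
    then show ?thesis by (simp add: power3_eq_cube algebra_simps)
  qed
  finally show ?thesis .
qed

lemma finite_codes: "1 \<le> d \<Longrightarrow> finite {code n h r y |h r y. valid n d x h r y}"
  by (rule finite_subset[of _ "{..<2 * n ^ 3}"]) (auto dest!: valid_bounds intro: code_bound)

lemma code_le_best: "1 \<le> d \<Longrightarrow> valid n d x h r y \<Longrightarrow> code n h r y \<le> best n d x"
  unfolding best_def by (rule Max_ge) (auto simp: finite_codes)

lemma best_cases:
  assumes "1 \<le> d"
  shows "best n d x = 0 \<or> (\<exists>h r y. valid n d x h r y \<and> best n d x = code n h r y)"
  using Max_in[of "insert 0 {code n h r y |h r y. valid n d x h r y}"] finite_codes[OF assms, of n x]
  unfolding best_def by auto

lemma best_bound: "1 \<le> d \<Longrightarrow> 1 \<le> n \<Longrightarrow> best n d x < 2 * n ^ 3"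
  using best_cases[of d n x] by (auto dest!: valid_bounds intro: code_bound)

lemma le_best_iff:
  "1 \<le> d \<Longrightarrow> 1 \<le> t \<Longrightarrow> t \<le> best n d x \<longleftrightarrow> (\<exists>h r y. valid n d x h r y \<and> t \<le> code n h r y)"
  using best_cases[of d n x] code_le_best[of d n x] by fastforce

section \<open>Instances of the two-sided scan\<close>

definition height :: "nat \<Rightarrow> nat \<Rightarrow> nat" where
  "height n t = max 1 (t div n div n)"

text \<open>For \<open>t < n * n\<close> the quotient is 0, but every valid rectangle has height at
  least 1, and columns are spaced by \<open>H\<close>.\<close>

lemma height_ge_1: "1 \<le> height n t"
  by (simp add: height_def)

text \<open>Scans proceed column by column, \<open>d\<close> cells each, away from the column
  \<open>b * H\<close>: tag 0 to the left beginning with \<open>b * H - 1\<close>, the nonzero tags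
  of \<open>verts\<close> to the right beginning with \<open>b * H\<close>.\<close>

definition cell :: "nat \<Rightarrow> nat \<Rightarrow> nat \<times> nat \<Rightarrow> nat \<times> nat \<Rightarrow> nat \<times> nat" where
  "cell H d k v = (fst k + snd v mod d,
     if fst v = 0 then snd k * H - 1 - snd v div d else snd k * H + snd v div d)"

text \<open>The right scan is cut off at the edge \<open>n\<close>. The left one has room for
  \<open>H\<close> columns, since instances have \<open>snd k \<ge> 1\<close>.\<close>

definition ahead :: "nat \<Rightarrow> nat \<Rightarrow> nat \<Rightarrow> nat \<times> nat \<Rightarrow> nat" where
  "ahead n H d k = min H (n - snd k * H) * d"

definition reachL :: "nat \<Rightarrow> nat \<Rightarrow> (nat \<times> nat \<Rightarrow> bool) \<Rightarrow> nat \<times> nat \<Rightarrow> nat" where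
  "reachL H d x k = stop (H * d) (\<lambda>p. x (cell H d k (0, p)))"

definition reachR :: "nat \<Rightarrow> nat \<Rightarrow> nat \<Rightarrow> (nat \<times> nat \<Rightarrow> bool) \<Rightarrow> nat \<times> nat \<Rightarrow> nat" where
  "reachR n H d x k = stop (ahead n H d k) (\<lambda>p. x (cell H d k (1, p)))"

text \<open>The verdict is a function of the two stop positions alone, so inputs with different
  verdicts differ in one of them. The extents are limited by \<open>H\<close> because the scans go
  no further.\<close>

definition hit :: "nat \<Rightarrow> nat \<Rightarrow> nat \<Rightarrow> nat \<times> nat \<Rightarrow> nat \<Rightarrow> nat \<Rightarrow> bool" where
  "hit n d t k a a' \<longleftrightarrow> (let H = height n t; c = snd k * H in \<exists>h y. t \<le> code n h (fst k) y \<and>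
     fst k + d \<le> n \<and> 1 \<le> h \<and> y + h \<le> n \<and> y \<le> c \<and> c \<le> y + h \<and> c - y \<le> H \<and> y + h - c \<le> H \<and>
     (c - y) * d \<le> a \<and> (y + h - c) * d \<le> a')"

definition instances :: "nat \<Rightarrow> nat \<Rightarrow> nat \<Rightarrow> (nat \<times> nat) set" where
  "instances n d H = {r. r + d \<le> n} \<times> {1..n div H}"

lemma finite_instances: "finite (instances n d H)"
  unfolding instances_def by (rule finite_cartesian_product[OF finite_subset[of _ "{..n}"]]) auto

text \<open>The first \<open>(c - y) * d\<close> positions of the left scan are exactly the cells in
  columns \<open>y\<close> to \<open>c - 1\<close>, the first \<open>(y + h - c) * d\<close> of the
  right scan those in columns \<open>c\<close> to \<open>y + h - 1\<close>.\<close>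

lemma reach_empty:
  assumes d: "1 \<le> d" and y: "y \<le> c" "c \<le> y + h" "c - y \<le> H" "y + h - c \<le> H" "y + h \<le> n" and c: "c = snd k * H"
  shows "(c - y) * d \<le> reachL H d x k \<and> (y + h - c) * d \<le> reachR n H d x k \<longleftrightarrow>
    (\<forall>i\<in>{fst k..<fst k + d}. \<forall>j\<in>{y..<y + h}. \<not> x (i, j))"
proof -
  have "(c - y) * d \<le> reachL H d x k \<longleftrightarrow> (\<forall>p<(c - y) * d. \<not> x (cell H d k (0, p)))"
    unfolding reachL_def using y by (intro le_stop_iff mult_right_mono) auto
  also have "\<dots> \<longleftrightarrow> (\<forall>i\<in>{fst k..<fst k + d}. \<forall>j\<in>{y..<c}. \<not> x (i, j))"
  proof (intro iffI ballI allI impI)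
    fix i j assume *: "\<forall>p<(c - y) * d. \<not> x (cell H d k (0, p))" "i \<in> {fst k..<fst k + d}" "j \<in> {y..<c}"
    define p where "p = (c - 1 - j) * d + (i - fst k)"
    have "i - fst k < d" using *(2) by auto
    then have pd: "p mod d = i - fst k" "p div d = (c - 1 - j)"
      unfolding p_def by (rule mod_mult_add_less, rule div_mult_add_less)
    have "p < (c - y) * d" unfolding p_def using *(2,3) by (intro mult_add_less) auto
    moreover have "cell H d k (0, p) = (i, j)" using *(2,3) pd by (auto simp: cell_def c[symmetric])
    ultimately show "\<not> x (i, j)" using *(1) by metis
  next
    fix p assume *: "\<forall>i\<in>{fst k..<fst k + d}. \<forall>j\<in>{y..<c}. \<not> x (i, j)" "p < (c - y) * d"
    have "p div d < c - y" using *(2) by (simp add: less_mult_imp_div_less)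
    moreover have "p mod d < d" using d by simp
    ultimately show "\<not> x (cell H d k (0, p))" using *(1) by (auto simp: cell_def c[symmetric])
  qed
  finally have 1: "(c - y) * d \<le> reachL H d x k \<longleftrightarrow> (\<forall>i\<in>{fst k..<fst k + d}. \<forall>j\<in>{y..<c}. \<not> x (i, j))" .
  have "(y + h - c) * d \<le> reachR n H d x k \<longleftrightarrow> (\<forall>p<(y + h - c) * d. \<not> x (cell H d k (1, p)))"
    unfolding reachR_def ahead_def using y c by (intro le_stop_iff mult_right_mono) auto
  also have "\<dots> \<longleftrightarrow> (\<forall>i\<in>{fst k..<fst k + d}. \<forall>j\<in>{c..<y + h}. \<not> x (i, j))"
  proof (intro iffI ballI allI impI)
    fix i j assume *: "\<forall>p<(y + h - c) * d. \<not> x (cell H d k (1, p))" "i \<in> {fst k..<fst k + d}" "j \<in> {c..<y + h}"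
    define p where "p = (j - c) * d + (i - fst k)"
    have "i - fst k < d" using *(2) by auto
    then have pd: "p mod d = i - fst k" "p div d = (j - c)"
      unfolding p_def by (rule mod_mult_add_less, rule div_mult_add_less)
    have "p < (y + h - c) * d" unfolding p_def using *(2,3) by (intro mult_add_less) auto
    moreover have "cell H d k (1, p) = (i, j)" using *(2,3) pd by (auto simp: cell_def c[symmetric])
    ultimately show "\<not> x (i, j)" using *(1) by metis
  next
    fix p assume *: "\<forall>i\<in>{fst k..<fst k + d}. \<forall>j\<in>{c..<y + h}. \<not> x (i, j)" "p < (y + h - c) * d"
    have "p div d < y + h - c" using *(2) by (simp add: less_mult_imp_div_less)
    moreover have "p mod d < d" using d by simp
    ultimately show "\<not> x (cell H d k (1, p))" using *(1) by (auto simp: cell_def c[symmetric])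
  qed
  finally have 2: "(y + h - c) * d \<le> reachR n H d x k \<longleftrightarrow> (\<forall>i\<in>{fst k..<fst k + d}. \<forall>j\<in>{c..<y + h}. \<not> x (i, j))" .
  have "{y..<y + h} = {y..<c} \<union> {c..<y + h}" using y by auto
  then show ?thesis unfolding 1 2 by auto
qed

text \<open>
  A rectangle of height \<open>H\<close> or \<open>H + 1\<close> crosses a column \<open>b * H\<close>, and these two heights suffice
  to attain a code of at least \<open>t\<close>.
\<close>

lemma le_best_iff_hit:
  fixes n d t :: nat
  assumes d: "1 \<le> d" and t: "1 \<le> t"
  defines "H \<equiv> height n t"
  shows "t \<le> best n d x \<longleftrightarrow> (\<exists>k\<in>instances n d H. hit n d t k (reachL H d x k) (reachR n H d x k))"
proof
  assume "t \<le> best n d x"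
  then obtain h r y where v: "valid n d x h r y" "t \<le> code n h r y" using le_best_iff[OF d t] by blast
  note b = valid_bounds[OF v(1) d]
  have "t div n div n \<le> code n h r y div n div n" using v(2) by (intro div_le_mono)
  then have Hh: "H \<le> h" using v(1) code_div(1)[of r n y h] b by (auto simp: H_def height_def valid_def)
  \<comment> \<open>A taller rectangle is cut to height \<open>H + 1\<close>. As
    \<open>t < (H + 1) * n * n\<close>, every code of this height is large enough.\<close>
  obtain h' where h': "valid n d x h' r y" "t \<le> code n h' r y" "H \<le> h'" "h' \<le> H + 1"
  proof (cases "h \<le> H + 1")
    case True
    then show ?thesis using that v Hh by blast
  next
    case False
    have v': "valid n d x (H + 1) r y" using v(1) False by (auto simp: valid_def)
    have "t < (H + 1) * n * n"
    proof -
      have "t div n div n < H + 1" by (simp add: H_def height_def)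
      then have "t div (n * n) < H + 1" by (simp add: div_mult2_eq)
      then have "t < (H + 1) * (n * n)" using b by (subst (asm) div_less_iff_less_mult) auto
      then show ?thesis by (simp only: mult.assoc)
    qed
    moreover have "(H + 1) * n * n \<le> code n (H + 1) r y"
      unfolding code_def by (simp only: add_mult_distrib[of "(H + 1) * n" r n])
    ultimately have "t \<le> code n (H + 1) r y" by linarith
    then show ?thesis using that v' by simp
  qed
  \<comment> \<open>\<open>c\<close> is the first multiple of \<open>H\<close> beyond
    \<open>y\<close>, so \<open>y < c \<le> y + H\<close>. Strictness allows for the height
    \<open>H + 1\<close>: at most \<open>H\<close> columns remain from \<open>c\<close> on.\<close>
  define b where "b = y div H + 1"
  define c where "c = b * H"
  have H1: "1 \<le> H" unfolding H_def by (rule height_ge_1)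
  have "y < c" unfolding c_def b_def using H1 div_less_iff_less_mult[of H y "y div H + 1"] by simp
  have "y div H * H \<le> y" by simp
  then have "c \<le> y + H" unfolding c_def b_def by (simp add: algebra_simps)
  have cn: "c \<le> n" using \<open>c \<le> y + H\<close> h'(1,3) by (auto simp: valid_def)
  have "b \<le> n div H" using cn H1 unfolding c_def by (simp add: less_eq_div_iff_mult_less_eq)
  then have "(r, b) \<in> instances n d H" using h'(1) by (auto simp: instances_def valid_def b_def)
  moreover have "hit n d t (r, b) (reachL H d x (r, b)) (reachR n H d x (r, b))"
  proof -
    have y: "y \<le> c" "c \<le> y + h'" "c - y \<le> H" "y + h' - c \<le> H" "y + h' \<le> n"
      using \<open>y < c\<close> \<open>c \<le> y + H\<close> h' by (auto simp: valid_def)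
    have "(c - y) * d \<le> reachL H d x (r, b) \<and> (y + h' - c) * d \<le> reachR n H d x (r, b)"
      using h'(1) by (subst reach_empty[OF d y]) (auto simp: c_def valid_def)
    then show ?thesis
      unfolding hit_def Let_def H_def[symmetric] using y h'(1,2)
      by (intro exI[of _ h'] exI[of _ y]) (auto simp: c_def valid_def)
  qed
  ultimately show "\<exists>k\<in>instances n d H. hit n d t k (reachL H d x k) (reachR n H d x k)" by blast
next
  assume "\<exists>k\<in>instances n d H. hit n d t k (reachL H d x k) (reachR n H d x k)"
  then obtain k where "hit n d t k (reachL H d x k) (reachR n H d x k)" by blast
  then obtain h y where *: "t \<le> code n h (fst k) y" "fst k + d \<le> n" "1 \<le> h" "y + h \<le> n"
     "y \<le> snd k * H" "snd k * H \<le> y + h" "snd k * H - y \<le> H" "y + h - snd k * H \<le> H"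
     "(snd k * H - y) * d \<le> reachL H d x k" "(y + h - snd k * H) * d \<le> reachR n H d x k"
    unfolding hit_def Let_def H_def[symmetric] by blast
  then have "valid n d x h (fst k) y"
    using reach_empty[OF d *(5-8) *(4) refl, of x] by (simp add: valid_def)
  then show "t \<le> best n d x" using *(1) code_le_best[OF d] le_trans by blast
qed

section \<open>A dual adversary solution\<close>

definition scan_verts :: "nat \<Rightarrow> nat \<Rightarrow> nat \<Rightarrow> (nat \<times> nat \<Rightarrow> bool) \<Rightarrow> nat \<times> nat \<Rightarrow> (nat \<times> nat) set" where
  "scan_verts n d H x k = verts (H * d) (ahead n H d k) (\<lambda>p. x (cell H d k (0, p))) (\<lambda>p. x (cell H d k (1, p)))"

text \<open>An input-independent superset of the vertices, containing every possible record of the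
  first stop.\<close>

definition scan_domain :: "nat \<Rightarrow> nat \<Rightarrow> nat \<Rightarrow> nat \<times> nat \<Rightarrow> (nat \<times> nat) set" where
  "scan_domain n d H k = {0} \<times> {..<H * d} \<union> {1..Suc (H * d)} \<times> {..<ahead n H d k}"

lemma label_cell: "label (\<lambda>p. x (cell H d k (0, p))) (\<lambda>p. x (cell H d k (1, p))) v = x (cell H d k v)"
  by (simp add: label_def cell_def)

lemma scan_verts_scan_domain: "scan_verts n d H x k \<subseteq> scan_domain n d H k"
  using stop_le[of "H * d"] by (auto simp: scan_verts_def scan_domain_def verts_def)

lemma finite_scan_domain: "finite (scan_domain n d H k)"
  by (simp add: scan_domain_def)

lemma finite_scan_verts: "finite (scan_verts n d H x k)"
  by (simp add: scan_verts_def finite_verts)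

lemma card_scan_verts: "card (scan_verts n d H x k) \<le> 2 * H * d"
proof -
  have "ahead n H d k \<le> H * d" by (simp add: ahead_def)
  moreover have "card (scan_verts n d H x k) \<le> H * d + ahead n H d k" unfolding scan_verts_def by (rule card_verts)
  ultimately show ?thesis by simp
qed

lemma card_scan_verts_label: "card {v \<in> scan_verts n d H x k. x (cell H d k v)} \<le> 2"
  using card_verts_label[of "H * d" "ahead n H d k" "\<lambda>p. x (cell H d k (0, p))" "\<lambda>p. x (cell H d k (1, p))"]
  unfolding scan_verts_def label_cell .

text \<open>\<open>hit\<close> sees the input only through the stop positions, so these differ and
  \<open>verts_separates\<close> applies.\<close>

lemma scan_verts_separates:
  assumes "hit n d t k (reachL H d x k) (reachR n H d x k)" "\<not> hit n d t k (reachL H d y k) (reachR n H d y k)"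
  shows "\<exists>v. {v \<in> scan_verts n d H x k \<inter> scan_verts n d H y k. x (cell H d k v) \<noteq> y (cell H d k v)} = {v}"
proof -
  have "reachL H d x k \<noteq> reachL H d y k \<or> reachR n H d x k \<noteq> reachR n H d y k" using assms by metis
  then show ?thesis
    unfolding scan_verts_def reachL_def reachR_def by (rule verts_separates[where F = "\<lambda>p. x (cell H d k (0, p))" and G = "\<lambda>p. x (cell H d k (1, p))"
        and F' = "\<lambda>p. y (cell H d k (0, p))" and G' = "\<lambda>p. y (cell H d k (1, p))", unfolded label_cell])
qed

lemma cell_range:
  assumes "1 \<le> d" "1 \<le> H" "k \<in> instances n d H" "v \<in> scan_domain n d H k"
  shows "cell H d k v \<in> {..<n} \<times> {..<n}"
proof -
  obtain r b where k: "k = (r, b)" by force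
  obtain s p where v: "v = (s, p)" by force
  have rb: "r + d \<le> n" "1 \<le> b" "b \<le> n div H" using assms(3) by (auto simp: instances_def k)
  have "b * H \<le> n div H * H" using rb(3) by simp
  then have bH: "b * H \<le> n" using div_times_less_eq_dividend[of n H] by linarith
  \<comment> \<open>With \<open>b * H \<le> n\<close> this puts the first column
    \<open>b * H - 1\<close> of the left scan below \<open>n\<close>.\<close>
  have "0 < b * H" using rb(2) assms(2) by simp
  have row: "r + p mod d < n" using rb(1) assms(1) mod_less_divisor[of d p] by linarith
  show ?thesis
  proof (cases "s = 0")
    case True
    then show ?thesis using row bH \<open>0 < b * H\<close> by (auto simp: cell_def k v)
  next
    case False
    then have "p < (n - b * H) * d" using assms(4)
      by (auto simp: scan_domain_def k v ahead_def min_def split: if_splits intro: less_le_trans)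
    then have "p div d < n - b * H" by (simp add: less_mult_imp_div_less)
    then show ?thesis using row False by (simp add: cell_def k v)
  qed
qed

text \<open>
  Bits that stop a scan are rare (two per instance) and get the large weight \<open>1 / \<theta>\<close>; the scale
  \<open>s\<close> balances the single instance used when \<open>t\<close> is attained against all instances otherwise.
\<close>

definition amp :: "nat \<Rightarrow> nat \<Rightarrow> nat \<Rightarrow> (nat \<times> nat \<Rightarrow> bool) \<Rightarrow> (nat \<times> nat) \<times> nat \<times> nat \<Rightarrow> real" where
  "amp n d t x = (\<lambda>(k, v). let H = height n t; s = sqrt (n / sqrt H); \<theta> = sqrt (1 / sqrt (2 * H * d)) in
     if v \<in> scan_verts n d H x k \<and>
       (t \<le> best n d x \<longrightarrow> k = (SOME k. k \<in> instances n d H \<and> hit n d t k (reachL H d x k) (reachR n H d x k)))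
     then (if t \<le> best n d x then s else 1 / s) * (if x (cell H d k v) then 1 / \<theta> else \<theta>) else 0)"

definition amp_domain :: "nat \<Rightarrow> nat \<Rightarrow> nat \<Rightarrow> ((nat \<times> nat) \<times> nat \<times> nat) set" where
  "amp_domain n d t = Sigma (instances n d (height n t)) (scan_domain n d (height n t))"

lemma finite_amp_domain: "finite (amp_domain n d t)"
  by (simp add: amp_domain_def finite_instances finite_scan_domain)

lemma card_instances: "1 \<le> d \<Longrightarrow> card (instances n d H) \<le> n * (n div H)"
proof -
  assume "1 \<le> d"
  then have "card {r. r + d \<le> n} \<le> card {..<n}" by (intro card_mono) auto
  then show ?thesis by (simp add: instances_def card_cartesian_product)
qed

text \<open>With \<open>R = sqrt (2 * H * d)\<close> an instance weighs at most
  \<open>2 * H * d / R + 2 * R = 3 * R\<close>. One instance scaled by \<open>n / sqrt H\<close>, or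
  at most \<open>n * (n / H)\<close> instances scaled by the inverse \<open>sqrt H / n\<close>, give
  the same bound.\<close>

lemma amp_norm:
  assumes n: "1 \<le> n" and d: "1 \<le> d" and t: "1 \<le> t"
  shows "(\<Sum>q\<in>amp_domain n d t. (amp n d t x q)\<^sup>2) \<le> 3 * sqrt 2 * n * sqrt d"
proof -
  define H where "H = height n t"
  define s where "s = sqrt (n / sqrt H)"
  define \<theta> where "\<theta> = sqrt (1 / sqrt (2 * H * d))"
  define R where "R = sqrt (2 * H * d)"
  define pick where "pick = (SOME k. k \<in> instances n d H \<and> hit n d t k (reachL H d x k) (reachR n H d x k))"
  define wt where "wt = (\<lambda>k v. if x (cell H d k v) then 1 / \<theta> else \<theta>)"
  define P where "P = (t \<le> best n d x)"
  have H: "1 \<le> H" unfolding H_def by (rule height_ge_1)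
  have R: "0 < R" "R * R = 2 * H * d" using H d by (simp_all add: R_def)
  have s: "0 < s" "s\<^sup>2 = n / sqrt H" using H n by (simp_all add: s_def)
  have "\<theta> = sqrt (1 / R)" unfolding \<theta>_def R_def ..
  then have \<theta>: "0 < \<theta>" "\<theta>\<^sup>2 = 1 / R" using R(1) by simp_all
  have amp: "amp n d t x (k, v) = (if v \<in> scan_verts n d H x k \<and> (P \<longrightarrow> k = pick) then (if P then s else 1 / s) * wt k v else 0)" for k v
    unfolding amp_def Let_def prod.case H_def[symmetric] s_def[symmetric] \<theta>_def[symmetric] pick_def[symmetric] P_def[symmetric] wt_def ..
  have wt: "(\<Sum>v\<in>scan_verts n d H x k. (wt k v)\<^sup>2) \<le> 3 * R" for k
  proof -
    have "(\<Sum>v\<in>scan_verts n d H x k. (wt k v)\<^sup>2) \<le> (\<Sum>v\<in>scan_verts n d H x k. 1 / R + (if x (cell H d k v) then R else 0))"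
      using R(1) by (intro sum_mono) (auto simp: wt_def power_divide \<theta>(2))
    also have "\<dots> = card (scan_verts n d H x k) / R + card {v \<in> scan_verts n d H x k. x (cell H d k v)} * R"
      by (simp add: sum.distrib sum.inter_filter[symmetric] finite_scan_verts)
    also have "\<dots> \<le> (2 * H * d) / R + 2 * R"
    proof (intro add_mono divide_right_mono mult_right_mono)
      show "real (card (scan_verts n d H x k)) \<le> real (2 * H * d)" using card_scan_verts of_nat_le_iff by blast
      show "real (card {v \<in> scan_verts n d H x k. x (cell H d k v)}) \<le> 2" using card_scan_verts_label[of n d H x k] by simp
    qed (use R(1) in simp_all)
    also have "\<dots> = 3 * R" using R by (simp add: field_simps)
    finally show ?thesis .
  qed
  have inner: "(\<Sum>v\<in>scan_domain n d H k. (amp n d t x (k, v))\<^sup>2) \<le> (if P \<longrightarrow> k = pick then (if P then s\<^sup>2 else 1 / s\<^sup>2) * (3 * R) else 0)" for k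
  proof (cases "P \<longrightarrow> k = pick")
    case True
    have "(\<Sum>v\<in>scan_domain n d H k. (amp n d t x (k, v))\<^sup>2) = (\<Sum>v\<in>scan_verts n d H x k. (if P then s\<^sup>2 else 1 / s\<^sup>2) * (wt k v)\<^sup>2)"
      using True scan_verts_scan_domain by (intro sum.mono_neutral_cong_right finite_scan_domain) (auto simp: amp power_mult_distrib power_divide)
    also have "\<dots> \<le> (if P then s\<^sup>2 else 1 / s\<^sup>2) * (3 * R)"
      unfolding sum_distrib_left[symmetric] by (intro mult_left_mono wt) auto
    finally show ?thesis using True by simp
  next
    case False
    then show ?thesis by (auto simp: amp)
  qed
  have RH: "R = sqrt 2 * sqrt H * sqrt d" by (simp add: R_def real_sqrt_mult)
  have sH: "sqrt H * sqrt H = H" "0 < sqrt H" using H by simp_all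
  have "(\<Sum>q\<in>amp_domain n d t. (amp n d t x q)\<^sup>2) = (\<Sum>k\<in>instances n d H. \<Sum>v\<in>scan_domain n d H k. (amp n d t x (k, v))\<^sup>2)"
    unfolding amp_domain_def H_def[symmetric] by (subst sum.Sigma) (auto simp: finite_instances finite_scan_domain)
  also have "\<dots> \<le> (\<Sum>k\<in>instances n d H. if P \<longrightarrow> k = pick then (if P then s\<^sup>2 else 1 / s\<^sup>2) * (3 * R) else 0)"
    by (intro sum_mono inner)
  also have "\<dots> \<le> 3 * sqrt 2 * n * sqrt d"
  proof (cases P)
    case True
    have "(\<Sum>k\<in>instances n d H. if P \<longrightarrow> k = pick then (if P then s\<^sup>2 else 1 / s\<^sup>2) * (3 * R) else 0) \<le> s\<^sup>2 * (3 * R)"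
      using True R(1) by (simp add: finite_instances)
    also have "\<dots> = 3 * sqrt 2 * n * sqrt d" unfolding s(2) RH using sH(2) by simp
    finally show ?thesis .
  next
    case False
    then have "(\<Sum>k\<in>instances n d H. if P \<longrightarrow> k = pick then (if P then s\<^sup>2 else 1 / s\<^sup>2) * (3 * R) else 0) = card (instances n d H) * (1 / s\<^sup>2 * (3 * R))"
      by simp
    also have "\<dots> \<le> (n * (n / H)) * (1 / s\<^sup>2 * (3 * R))"
    proof (intro mult_right_mono)
      have "real (card (instances n d H)) \<le> real (n * (n div H))" using card_instances[OF d] of_nat_le_iff by blast
      also have "\<dots> \<le> n * (n / H)" unfolding of_nat_mult by (intro mult_left_mono of_nat_div_le_of_nat) simp
      finally show "real (card (instances n d H)) \<le> n * (n / H)" .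
    qed (use R(1) in simp)
    also have "\<dots> = n * (sqrt H * sqrt H / H) * (3 * sqrt 2 * sqrt d)"
      unfolding s(2) RH using n by (simp add: field_simps)
    also have "\<dots> = 3 * sqrt 2 * n * sqrt d" using H by simp
    finally show ?thesis .
  qed
  finally show ?thesis .
qed

text \<open>The instance picked for \<open>x\<close> is hit by \<open>x\<close> but not by
  \<open>y\<close>, so the two inputs share exactly one vertex of it with different bits. All other
  products vanish.\<close>

lemma amp_separates:
  assumes n: "1 \<le> n" and d: "1 \<le> d" and t: "1 \<le> t" and x: "t \<le> best n d x" and y: "\<not> t \<le> best n d y"
  defines "c \<equiv> \<lambda>q. cell (height n t) d (fst q) (snd q)"
  shows "(\<Sum>q | q \<in> amp_domain n d t \<and> x (c q) \<noteq> y (c q). amp n d t x q * amp n d t y q) = 1"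
proof -
  define H where "H = height n t"
  define s where "s = sqrt (n / sqrt H)"
  define \<theta> where "\<theta> = sqrt (1 / sqrt (2 * H * d))"
  define pick where "pick = (SOME k. k \<in> instances n d H \<and> hit n d t k (reachL H d x k) (reachR n H d x k))"
  have H: "1 \<le> H" unfolding H_def by (rule height_ge_1)
  have s: "0 < s" and \<theta>: "0 < \<theta>" using H n d by (simp_all add: s_def \<theta>_def)
  have ampx: "amp n d t x (k, v) = (if v \<in> scan_verts n d H x k \<and> k = pick then s * (if x (cell H d k v) then 1 / \<theta> else \<theta>) else 0)" for k v
    using x unfolding amp_def Let_def prod.case H_def[symmetric] s_def[symmetric] \<theta>_def[symmetric] pick_def[symmetric] by auto
  have ampy: "amp n d t y (k, v) = (if v \<in> scan_verts n d H y k then 1 / s * (if y (cell H d k v) then 1 / \<theta> else \<theta>) else 0)" for k v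
    using y unfolding amp_def Let_def prod.case H_def[symmetric] s_def[symmetric] \<theta>_def[symmetric] by auto
  have "\<exists>k. k \<in> instances n d H \<and> hit n d t k (reachL H d x k) (reachR n H d x k)"
    using x le_best_iff_hit[OF d t, of n x] unfolding H_def by blast
  then have pick: "pick \<in> instances n d H" "hit n d t pick (reachL H d x pick) (reachR n H d x pick)"
    unfolding pick_def by (rule someI2_ex, blast)+
  have "\<not> hit n d t pick (reachL H d y pick) (reachR n H d y pick)"
    using y pick(1) le_best_iff_hit[OF d t, of n y] unfolding H_def by blast
  from scan_verts_separates[OF pick(2) this] obtain v where
    v: "{v \<in> scan_verts n d H x pick \<inter> scan_verts n d H y pick. x (cell H d pick v) \<noteq> y (cell H d pick v)} = {v}" by blast
  have "(\<Sum>q | q \<in> amp_domain n d t \<and> x (c q) \<noteq> y (c q). amp n d t x q * amp n d t y q) =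
    (\<Sum>q\<in>{(pick, v)}. amp n d t x q * amp n d t y q)"
  proof (rule sum.mono_neutral_right)
    show "finite {q. q \<in> amp_domain n d t \<and> x (c q) \<noteq> y (c q)}" using finite_amp_domain by simp
    show "{(pick, v)} \<subseteq> {q. q \<in> amp_domain n d t \<and> x (c q) \<noteq> y (c q)}"
      using v pick(1) scan_verts_scan_domain[of n d H x pick] by (auto simp: amp_domain_def H_def[symmetric] c_def)
    show "\<forall>q\<in>{q. q \<in> amp_domain n d t \<and> x (c q) \<noteq> y (c q)} - {(pick, v)}. amp n d t x q * amp n d t y q = 0"
    proof
      fix q assume q: "q \<in> {q. q \<in> amp_domain n d t \<and> x (c q) \<noteq> y (c q)} - {(pick, v)}"
      obtain k u where ku: "q = (k, u)" by (cases q)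
      have "\<not> (k = pick \<and> u \<in> scan_verts n d H x pick \<inter> scan_verts n d H y pick)"
        using q v by (auto simp: ku c_def H_def[symmetric])
      then show "amp n d t x q * amp n d t y q = 0" unfolding ku ampx ampy by auto
    qed
  qed
  \<comment> \<open>The bits at \<open>v\<close> differ, so one weight is
    \<open>1 / \<theta>\<close> and the other \<open>\<theta>\<close>; likewise \<open>s\<close>
    meets \<open>1 / s\<close>.\<close>
  also have "\<dots> = 1"
  proof -
    have "v \<in> scan_verts n d H x pick" "v \<in> scan_verts n d H y pick" "x (cell H d pick v) \<noteq> y (cell H d pick v)" using v by blast+
    then show ?thesis using s \<theta> by (simp add: ampx ampy)
  qed
  finally show ?thesis .
qed

section \<open>The algorithm\<close>

text \<open>
  The bit \<open>\<tau>\<close> removes the thresholds on which two inputs agree from the adversary sum; of the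
  thresholds on both search paths exactly one remains.
\<close>

lemma lrecw_adversary:
  fixes n d m :: nat
  assumes n: "1 \<le> n" and d: "1 \<le> d" and m: "1 \<le> m" "2 * n ^ 3 \<le> 2 ^ m"
  defines "W \<equiv> real m * (3 * sqrt 2 * n * sqrt d)"
  shows "\<exists>(I :: (nat + nat \<times> nat set \<times> ((nat \<times> bool \<times> (nat \<times> nat) \<times> nat \<times> nat) \<times> bool) option) set) i0 steps.
    finite I \<and> i0 \<in> I \<and> (\<forall>s\<in>set steps. wf_step I ({..<n} \<times> {..<n}) s) \<and>
    real (sum_list (map step_cost steps)) \<le> 404 * W \<and>
    (\<forall>x. (\<forall>i j. x (i, j) \<longrightarrow> i < n \<and> j < n) \<longrightarrow>
      (\<Sum>i\<in>I - {Inl (best n d x)}. (exec x steps (delta i0) i)\<^sup>2) \<le> 1 / 10)"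
proof -
  \<comment> \<open>Fixing the bits outside the square to 0 leaves finitely many inputs.\<close>
  define X :: "(nat \<times> nat \<Rightarrow> bool) set" where "X = {x. \<forall>i j. x (i, j) \<longrightarrow> i < n \<and> j < n}"
  define Q where "Q = Sigma {1..<2 ^ m} (\<lambda>t. (UNIV :: bool set) \<times> amp_domain n d t)"
  define c where "c = (\<lambda>(t, \<tau> :: bool, k, v). cell (height n t) d k v)"
  define T where "T = (\<lambda>x. thresholds m 0 (best n d x))"
  define \<alpha> where "\<alpha> = (\<lambda>x (t, \<tau>, q). if t \<in> T x \<and> \<tau> = (t \<le> best n d x) then amp n d t x q else 0)"
  define \<beta> where "\<beta> = (\<lambda>x (t, \<tau>, q). if t \<in> T x \<and> \<tau> \<noteq> (t \<le> best n d x) then amp n d t x q else 0)"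
  have X: "finite X"
  proof (rule finite_subset)
    show "X \<subseteq> (\<lambda>S p. p \<in> S) ` Pow ({..<n} \<times> {..<n})"
    proof
      fix x assume "x \<in> X"
      then show "x \<in> (\<lambda>S p. p \<in> S) ` Pow ({..<n} \<times> {..<n})"
        by (intro image_eqI[of _ _ "{p. x p}"]) (auto simp: X_def)
    qed
  qed simp
  have Q: "finite Q" by (simp add: Q_def finite_amp_domain)
  have L: "c ` Q \<subseteq> {..<n} \<times> {..<n}"
  proof
    fix l assume "l \<in> c ` Q"
    then obtain t \<tau> k v where "l = c (t, \<tau>, k, v)" "(t, \<tau>, k, v) \<in> Q" by auto
    then show "l \<in> {..<n} \<times> {..<n}"
      using cell_range[OF d height_ge_1, of k n n t v] by (simp add: c_def Q_def amp_domain_def)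
  qed
  have best: "best n d x < 2 ^ m" for x using best_bound[OF d n, of x] m(2) by simp
  have T: "T x \<subseteq> {1..<2 ^ m}" for x using thresholds_range[of _ m 0 "best n d x"] by (fastforce simp: T_def)
  have sumQ: "(\<Sum>q\<in>Q. f q) = (\<Sum>t\<in>{1..<2 ^ m}. (\<Sum>q\<in>amp_domain n d t. f (t, False, q)) + (\<Sum>q\<in>amp_domain n d t. f (t, True, q)))"
    for f :: "nat \<times> bool \<times> (nat \<times> nat) \<times> nat \<times> nat \<Rightarrow> real"
  proof -
    have "(\<Sum>q\<in>Q. f q) = (\<Sum>t\<in>{1..<2 ^ m}. \<Sum>p\<in>UNIV \<times> amp_domain n d t. f (t, p))"
      unfolding Q_def by (subst sum.Sigma) (auto simp: finite_amp_domain)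
    also have "\<dots> = (\<Sum>t\<in>{1..<2 ^ m}. \<Sum>\<tau>\<in>UNIV. \<Sum>q\<in>amp_domain n d t. f (t, \<tau>, q))"
      by (intro sum.cong refl) (simp add: sum.cartesian_product split_def)
    finally show ?thesis by (simp add: UNIV_bool)
  qed
  have norm: "(\<Sum>t\<in>{1..<2 ^ m}. if t \<in> T x then \<Sum>q\<in>amp_domain n d t. (amp n d t x q)\<^sup>2 else 0) \<le> W" for x
  proof -
    have "(\<Sum>t\<in>{1..<2 ^ m}. if t \<in> T x then \<Sum>q\<in>amp_domain n d t. (amp n d t x q)\<^sup>2 else 0) =
      (\<Sum>t\<in>T x. \<Sum>q\<in>amp_domain n d t. (amp n d t x q)\<^sup>2)"
      using T[of x] by (intro sum.mono_neutral_cong_right) auto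
    also have "\<dots> \<le> (\<Sum>t\<in>T x. 3 * sqrt 2 * n * sqrt d)"
      using T[of x] by (intro sum_mono amp_norm[OF n d]) auto
    also have "\<dots> \<le> W" unfolding W_def sum_constant
      using card_thresholds[of m 0 "best n d x"] by (intro mult_right_mono) (simp_all add: T_def)
    finally show ?thesis .
  qed
  have "(\<Sum>q\<in>Q. (\<alpha> x q)\<^sup>2) = (\<Sum>t\<in>{1..<2 ^ m}. if t \<in> T x then \<Sum>q\<in>amp_domain n d t. (amp n d t x q)\<^sup>2 else 0)"
    and "(\<Sum>q\<in>Q. (\<beta> x q)\<^sup>2) = (\<Sum>t\<in>{1..<2 ^ m}. if t \<in> T x then \<Sum>q\<in>amp_domain n d t. (amp n d t x q)\<^sup>2 else 0)" for x
  proof -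
    have "(\<Sum>q\<in>amp_domain n d t. (\<alpha> x (t, False, q))\<^sup>2) + (\<Sum>q\<in>amp_domain n d t. (\<alpha> x (t, True, q))\<^sup>2) =
        (if t \<in> T x then \<Sum>q\<in>amp_domain n d t. (amp n d t x q)\<^sup>2 else 0)"
      and "(\<Sum>q\<in>amp_domain n d t. (\<beta> x (t, False, q))\<^sup>2) + (\<Sum>q\<in>amp_domain n d t. (\<beta> x (t, True, q))\<^sup>2) =
        (if t \<in> T x then \<Sum>q\<in>amp_domain n d t. (amp n d t x q)\<^sup>2 else 0)" for t
      by (cases "t \<le> best n d x"; simp add: \<alpha>_def \<beta>_def)+
    then show "(\<Sum>q\<in>Q. (\<alpha> x q)\<^sup>2) = (\<Sum>t\<in>{1..<2 ^ m}. if t \<in> T x then \<Sum>q\<in>amp_domain n d t. (amp n d t x q)\<^sup>2 else 0)"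
      and "(\<Sum>q\<in>Q. (\<beta> x q)\<^sup>2) = (\<Sum>t\<in>{1..<2 ^ m}. if t \<in> T x then \<Sum>q\<in>amp_domain n d t. (amp n d t x q)\<^sup>2 else 0)"
      unfolding sumQ by simp_all
  qed
  note norms = this[THEN eq_refl, THEN order_trans, OF norm]
  have adv: "(\<Sum>q | q \<in> Q \<and> x (c q) \<noteq> y (c q). \<alpha> x q * \<beta> y q) = 1" if ne: "best n d x \<noteq> best n d y" for x y
  proof -
    define D where "D = (\<lambda>t. t \<in> T x \<inter> T y \<and> (t \<le> best n d x) \<noteq> (t \<le> best n d y))"
    define c' where "c' = (\<lambda>t q. cell (height n t) d (fst q) (snd q))"
    have cc: "c (t, \<tau>, q) = c' t q" for t \<tau> q by (cases q) (simp add: c_def c'_def)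
    \<comment> \<open>The sum over thresholds collapses to the single comparison where the two
      searches part.\<close>
    obtain t0 where t0: "{t. D t} = {t0}"
      using thresholds_separates[of 0 "best n d x" m "best n d y"] best ne unfolding D_def T_def by auto
    have Dt: "D t \<longleftrightarrow> t = t0" for t using t0 by blast
    have prods: "\<alpha> x (t, False, q) * \<beta> y (t, False, q) = (if D t \<and> \<not> t \<le> best n d x then amp n d t x q * amp n d t y q else 0)"
      "\<alpha> x (t, True, q) * \<beta> y (t, True, q) = (if D t \<and> t \<le> best n d x then amp n d t x q * amp n d t y q else 0)" for t q
      by (auto simp: \<alpha>_def \<beta>_def D_def)
    have "(\<Sum>q | q \<in> Q \<and> x (c q) \<noteq> y (c q). \<alpha> x q * \<beta> y q) =
      (\<Sum>q\<in>Q. if x (c q) \<noteq> y (c q) then \<alpha> x q * \<beta> y q else 0)"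
      by (rule sum.inter_filter[OF Q])
    also have "\<dots> = (\<Sum>t\<in>{1..<2 ^ m}. if D t then
        \<Sum>q\<in>amp_domain n d t. if x (c' t q) \<noteq> y (c' t q) then amp n d t x q * amp n d t y q else 0 else 0)"
      unfolding sumQ cc
    proof (intro sum.cong refl)
      fix t
      show "(\<Sum>q\<in>amp_domain n d t. if x (c' t q) \<noteq> y (c' t q) then \<alpha> x (t, False, q) * \<beta> y (t, False, q) else 0) +
        (\<Sum>q\<in>amp_domain n d t. if x (c' t q) \<noteq> y (c' t q) then \<alpha> x (t, True, q) * \<beta> y (t, True, q) else 0) =
        (if D t then \<Sum>q\<in>amp_domain n d t. if x (c' t q) \<noteq> y (c' t q) then amp n d t x q * amp n d t y q else 0 else 0)"
        unfolding prods by (cases "D t"; cases "t \<le> best n d x") (auto intro!: sum.cong)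
    qed
    also have "\<dots> = (\<Sum>t\<in>{t0}. \<Sum>q\<in>amp_domain n d t. if x (c' t q) \<noteq> y (c' t q) then amp n d t x q * amp n d t y q else 0)"
    proof (rule sum.mono_neutral_cong_right)
      have "t0 \<in> T x" using Dt[of t0] by (simp add: D_def)
      then show "{t0} \<subseteq> {1..<2 ^ m}" using T[of x] by blast
    qed (simp_all add: Dt)
    also have "\<dots> = (\<Sum>q | q \<in> amp_domain n d t0 \<and> x (c' t0 q) \<noteq> y (c' t0 q). amp n d t0 x q * amp n d t0 y q)"
      by (simp add: sum.inter_filter[OF finite_amp_domain])
    also have "\<dots> = 1"
    proof -
      have D: "D t0" by (simp add: Dt)
      then have "t0 \<in> T x" by (simp add: D_def)
      then have t: "1 \<le> t0" using T[of x] by (meson atLeastLessThan_iff subsetD)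
      show ?thesis
      proof (cases "t0 \<le> best n d x")
        case True
        then have "\<not> t0 \<le> best n d y" using D by (simp add: D_def)
        then show ?thesis unfolding c'_def by (rule amp_separates[OF n d t True])
      next
        case False
        then have "t0 \<le> best n d y" using D by (simp add: D_def)
        \<comment> \<open>The threshold is attained by \<open>y\<close> this time, so
          \<open>x\<close> and \<open>y\<close> trade places.\<close>
        from amp_separates[OF n d t this False]
        have "(\<Sum>q | q \<in> amp_domain n d t0 \<and> y (c' t0 q) \<noteq> x (c' t0 q). amp n d t0 y q * amp n d t0 x q) = 1"
          unfolding c'_def .
        moreover have "{q. q \<in> amp_domain n d t0 \<and> y (c' t0 q) \<noteq> x (c' t0 q)} = {q. q \<in> amp_domain n d t0 \<and> x (c' t0 q) \<noteq> y (c' t0 q)}"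
          by blast
        ultimately show ?thesis by (simp only: mult.commute)
      qed
    qed
    finally show ?thesis .
  qed
  have W: "1 \<le> W"
  proof -
    have ge: "1 \<le> a * b" if "1 \<le> a" "1 \<le> b" for a b :: real
      using mult_mono[OF that] that by simp
    have "1 \<le> 3 * sqrt (2 :: real)" using real_sqrt_ge_one[of 2] by linarith
    then show ?thesis unfolding W_def using n d m(1) by (intro ge) simp_all
  qed
  from adversary_algorithm[where X = X and Q = Q and cell = c and L = "{..<n} \<times> {..<n}" and ans = "best n d"
      and M = "2 ^ m" and W = W and \<alpha> = \<alpha> and \<beta> = \<beta>, OF X Q L best W norms adv]
  show ?thesis unfolding X_def by blast
qed

section \<open>Decoding the answer and counting queries\<close>

definition decode :: "nat \<Rightarrow> nat \<Rightarrow> nat \<Rightarrow> rect option" where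
  "decode n d c = (if c = 0 then None else
     Some (c div n mod n, c mod n, c div n mod n + d - 1, c mod n + c div n div n - 1))"

text \<open>At width \<open>d\<close> the area is \<open>d\<close> times the height, and a largest
  code has a largest height. Corners are inclusive, hence the \<open>- 1\<close> in
  \<open>decode\<close>.\<close>

lemma decode_best:
  assumes d: "1 \<le> d" and x: "\<And>i j. i < n \<Longrightarrow> j < n \<Longrightarrow> x (i, j) = f i j"
  shows "solves_lrecw n f d (decode n d (best n d x))"
proof -
  have valid: "valid n d x (y2 - y1 + 1) x1 y1"
    if "empty_rectangle n f (x1, y1, x2, y2)" "rect_width (x1, y1, x2, y2) = d" for x1 y1 x2 y2
    using that x by (auto simp: valid_def)
  show ?thesis
  proof (cases "best n d x = 0")
    case True
    have False if R: "empty_rectangle n f R" "rect_width R = d" for R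
    proof -
      obtain x1 y1 x2 y2 where "R = (x1, y1, x2, y2)" by (cases R)
      then have v: "valid n d x (y2 - y1 + 1) x1 y1" using valid R by simp
      then have "0 < code n (y2 - y1 + 1) x1 y1" using valid_bounds[OF v d] by (auto simp: code_def)
      then show False using code_le_best[OF d v] True by simp
    qed
    then show ?thesis unfolding decode_def True if_P[OF refl] solves_lrecw.simps by blast
  next
    case False
    then obtain h r y where v: "valid n d x h r y" "best n d x = code n h r y" using best_cases[OF d, of n x] by auto
    note b = valid_bounds[OF v(1) d]
    have dec: "decode n d (best n d x) = Some (r, y, r + d - 1, y + h - 1)"
      using False b by (simp add: decode_def v(2) code_div)
    have "empty_rectangle n f (r, y, r + d - 1, y + h - 1)"
      using v(1) d x by (auto simp: valid_def)
    moreover have "rect_width (r, y, r + d - 1, y + h - 1) = d" using d by simp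
    moreover have "rect_area R \<le> rect_area (r, y, r + d - 1, y + h - 1)"
      if R: "empty_rectangle n f R" "rect_width R = d" for R
    proof -
      obtain x1 y1 x2 y2 where R': "R = (x1, y1, x2, y2)" by (cases R)
      then have v': "valid n d x (y2 - y1 + 1) x1 y1" using valid R by simp
      have "code n (y2 - y1 + 1) x1 y1 \<le> code n h r y" using code_le_best[OF d v'] v(2) by simp
      then have "code n (y2 - y1 + 1) x1 y1 div n div n \<le> code n h r y div n div n" by (intro div_le_mono)
      then have "y2 - y1 + 1 \<le> h" using valid_bounds[OF v' d] b by (simp add: code_div)
      then have "d * (y2 - y1 + 1) \<le> d * h" by (rule mult_le_mono2)
      moreover have "rect_area R = d * (y2 - y1 + 1)" using R(2) unfolding R' by simp
      moreover have "rect_area (r, y, r + d - 1, y + h - 1) = d * h" using d v(1) by (simp add: valid_def)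
      ultimately show ?thesis by simp
    qed
    ultimately show ?thesis unfolding dec by simp
  qed
qed

text \<open>\<open>m\<close> is the number of search rounds. For \<open>n \<ge> 4\<close> the
  logarithm is at least 2, which absorbs the additive constants, and the iterated logarithm is at
  least 1 and can be multiplied in.\<close>

lemma bits_bound:
  assumes "4 \<le> n"
  defines "m \<equiv> 3 * nat \<lceil>log 2 (real n)\<rceil> + 1"
  shows "real m \<le> 5 * (log 2 n * log 2 (log 2 n))"
proof -
  have l: "2 \<le> log 2 (real n)" using assms(1) by (simp add: le_log_iff)
  then have ll: "1 \<le> log 2 (log 2 (real n))" by (subst le_log_iff) simp_all
  have "real m \<le> 3 * (log 2 n + 1) + 1" unfolding m_def using l by (simp, linarith)
  also have "\<dots> \<le> 5 * log 2 n" using l by simp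
  also have "\<dots> \<le> 5 * (log 2 n * log 2 (log 2 n))" using l ll by simp
  finally show ?thesis .
qed

text \<open>Together with \<open>best_bound\<close> this lets \<open>m\<close> rounds cover all
  codes.\<close>

lemma power_bits:
  assumes "1 \<le> n"
  shows "2 * n ^ 3 \<le> 2 ^ (3 * nat \<lceil>log 2 (real n)\<rceil> + 1)"
proof -
  have "0 \<le> log 2 (real n)" using assms by simp
  then have "log 2 (real n) \<le> real (nat \<lceil>log 2 (real n)\<rceil>)" by linarith
  then have "real n \<le> 2 powr real (nat \<lceil>log 2 (real n)\<rceil>)" using assms by (subst (asm) log_le_iff) auto
  then have "real n \<le> real (2 ^ nat \<lceil>log 2 (real n)\<rceil>)" by (simp add: powr_realpow)
  then have "n \<le> 2 ^ nat \<lceil>log 2 (real n)\<rceil>" by (simp only: of_nat_le_iff)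
  then have "n ^ 3 \<le> (2 ^ nat \<lceil>log 2 (real n)\<rceil>) ^ 3" by (rule power_mono) simp
  then show ?thesis by (simp add: power_mult[symmetric] mult.commute)
qed

text \<open>The constant is \<open>404 * 5 * 3 = 6060\<close>, times \<open>sqrt 2\<close>. If
  \<open>workdim E\<close> does not have the layout of \<open>evaluates\<close>, then
  \<open>E\<close> evaluates nothing and an algorithm without queries meets the claim.\<close>

lemma lrecw_algorithm:
  fixes E :: qcircuit
  assumes d: "1 \<le> d" "d \<le> n" and E: "wf_qcircuit E"
  shows "\<exists>A :: rect option qalgorithm. wf_qcircuit A \<and> inputs A = inputs E \<and>
    (n \<ge> 4 \<longrightarrow> real (num_queries A) \<le>
      6060 * sqrt 2 * (real n * sqrt (real d) * log 2 (real n) * log 2 (log 2 (real n)) * real (num_queries E))) \<and>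
    (\<forall>x f. evaluates n E x f \<longrightarrow> error_prob A x (solves_lrecw n f d) \<le> 0.1)"
proof (cases "\<exists>anc>0. workdim E = n * n * 2 * anc")
  case True
  then obtain anc where anc: "0 < anc" "workdim E = n * n * 2 * anc" by blast
  have n: "1 \<le> n" using d by simp
  define m where "m = 3 * nat \<lceil>log 2 (real n)\<rceil> + 1"
  define W where "W = real m * (3 * sqrt 2 * n * sqrt d)"
  have "1 \<le> m" by (simp add: m_def)
  from lrecw_adversary[OF n d(1) this power_bits[OF n, folded m_def], folded W_def]
  obtain I :: "(nat + nat \<times> nat set \<times> ((nat \<times> bool \<times> (nat \<times> nat) \<times> nat \<times> nat) \<times> bool) option) set"
    and i0 steps where I: "finite I" "i0 \<in> I" "\<forall>s\<in>set steps. wf_step I ({..<n} \<times> {..<n}) s"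
      "real (sum_list (map step_cost steps)) \<le> 404 * W"
      "\<forall>x. (\<forall>i j. x (i, j) \<longrightarrow> i < n \<and> j < n) \<longrightarrow>
        (\<Sum>i\<in>I - {Inl (best n d x)}. (exec x steps (delta i0) i)\<^sup>2) \<le> 1 / 10"
    by (elim exE conjE) (rule that)
  \<comment> \<open>Clock outcomes are errors anyway, so \<open>None\<close> is an arbitrary value
    for them.\<close>
  define g where "g = (\<lambda>i. case i of Inl c \<Rightarrow> decode n d c
    | Inr (_ :: nat \<times> nat set \<times> ((nat \<times> bool \<times> (nat \<times> nat) \<times> nat \<times> nat) \<times> bool) option) \<Rightarrow> None)"
  have n0: "0 < n" using n by simp
  from qalgorithm_of_steps[OF E anc(2,1) n0 I(1-3), of g]
  obtain A :: "rect option qalgorithm" where A: "wf_qcircuit A" "inputs A = inputs E"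
    "num_queries A = sum_list (map step_cost steps) * num_queries E"
    "\<forall>x f correct. evaluates n E x f \<longrightarrow> error_prob A x correct \<le>
      (\<Sum>i | i \<in> I \<and> \<not> correct (g i). (exec (\<lambda>(i, j). f i j) steps (delta i0) i)\<^sup>2)"
    by (elim exE conjE) (rule that)
  have "real (num_queries A) \<le>
      6060 * sqrt 2 * (real n * sqrt (real d) * log 2 (real n) * log 2 (log 2 (real n)) * real (num_queries E))"
    if "n \<ge> 4"
  proof -
    have "real (sum_list (map step_cost steps)) \<le> 404 * (5 * (log 2 n * log 2 (log 2 n)) * (3 * sqrt 2 * n * sqrt d))"
    proof -
      have "W \<le> 5 * (log 2 n * log 2 (log 2 n)) * (3 * sqrt 2 * n * sqrt d)"
        unfolding W_def by (rule mult_right_mono[OF bits_bound[OF that, folded m_def]]) simp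
      then show ?thesis using I(4) by linarith
    qed
    from mult_right_mono[OF this, of "real (num_queries E)"] show ?thesis
      unfolding A(3) by (simp add: mult_ac)
  qed
  moreover have "error_prob A x (solves_lrecw n f d) \<le> 0.1" if ev: "evaluates n E x f" for x f
  proof -
    \<comment> \<open>\<open>f\<close> is cut off outside the square, as the adversary bound covers
      only such inputs. Both \<open>evaluates\<close> and the correct answers are
      unaffected.\<close>
    define f' where "f' = (\<lambda>i j. i < n \<and> j < n \<and> f i j)"
    define z where "z = (\<lambda>(i, j). f' i j)"
    have "evaluates n E x f'" using ev unfolding evaluates_def f'_def by simp
    then have "error_prob A x (solves_lrecw n f d) \<le>
      (\<Sum>i | i \<in> I \<and> \<not> solves_lrecw n f d (g i). (exec z steps (delta i0) i)\<^sup>2)"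
      using A(4) unfolding z_def by blast
    also have "\<dots> \<le> (\<Sum>i\<in>I - {Inl (best n d z)}. (exec z steps (delta i0) i)\<^sup>2)"
    proof (rule sum_mono2)
      have "solves_lrecw n f d (decode n d (best n d z))"
        by (rule decode_best[OF d(1)]) (simp add: z_def f'_def)
      then show "{i. i \<in> I \<and> \<not> solves_lrecw n f d (g i)} \<subseteq> I - {Inl (best n d z)}"
        by (auto simp: g_def)
    qed (use I(1) in auto)
    also have "\<dots> \<le> 1 / 10" using I(5) by (auto simp: z_def f'_def)
    finally show ?thesis by simp
  qed
  ultimately show ?thesis using A(1,2) by blast
next
  case False
  define A :: "rect option qalgorithm" where "A = \<lparr>inputs = inputs E, workdim = workdim E,
    init_op = init_op E, step_ops = [], outcome = (\<lambda>_. None)\<rparr>"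
  have "wf_qcircuit A" using E by (simp add: wf_qcircuit_def A_def state_dim_def)
  moreover have "\<not> evaluates n E x f" for x f using False unfolding evaluates_def by blast
  moreover have "0 \<le> log 2 (real n)" "0 \<le> log 2 (log 2 (real n))" if "n \<ge> 4"
  proof -
    have "2 \<le> log 2 (real n)" using that by (simp add: le_log_iff)
    then show "0 \<le> log 2 (real n)" "0 \<le> log 2 (log 2 (real n))" by simp_all
  qed
  ultimately show ?thesis by (intro exI[of _ A]) (auto simp: A_def num_queries_def)
qed

theorem theorem6:
  shows "\<exists>(alg :: nat \<Rightarrow> nat \<Rightarrow> qcircuit \<Rightarrow> rect option qalgorithm) (C :: real) (n0 :: nat).
    \<forall>n d E. 1 \<le> d \<and> d \<le> n \<and> wf_qcircuit E \<longrightarrow>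
      wf_qcircuit (alg n d E) \<and> inputs (alg n d E) = inputs E \<and>
      (n \<ge> n0 \<longrightarrow>
        real (num_queries (alg n d E)) \<le>
          C * (real n * sqrt (real d) * log 2 (real n) * log 2 (log 2 (real n))
               * real (num_queries E))) \<and>
      (\<forall>x f. evaluates n E x f \<longrightarrow>
        error_prob (alg n d E) x (solves_lrecw n f d) \<le> 0.1)"
proof -
  define spec where "spec = (\<lambda>n d (E :: qcircuit) (A :: rect option qalgorithm). wf_qcircuit A \<and> inputs A = inputs E \<and>
    (n \<ge> 4 \<longrightarrow> real (num_queries A) \<le>
      6060 * sqrt 2 * (real n * sqrt (real d) * log 2 (real n) * log 2 (log 2 (real n)) * real (num_queries E))) \<and>
    (\<forall>x f. evaluates n E x f \<longrightarrow> error_prob A x (solves_lrecw n f d) \<le> 0.1))"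
  \<comment> \<open>The choice is made from \<open>n\<close>, \<open>d\<close> and \<open>E\<close>
    only, so the algorithm cannot depend on \<open>x\<close> or \<open>f\<close>.\<close>
  define alg where "alg = (\<lambda>n d E. SOME A. spec n d E A)"
  have spec: "1 \<le> d \<and> d \<le> n \<and> wf_qcircuit E \<longrightarrow> spec n d E (alg n d E)" for n d E
  proof
    assume "1 \<le> d \<and> d \<le> n \<and> wf_qcircuit E"
    then have "\<exists>A. spec n d E A" unfolding spec_def by (elim conjE) (rule lrecw_algorithm)
    then show "spec n d E (alg n d E)" unfolding alg_def by (rule someI_ex)
  qed
  show ?thesis
    by (rule exI[of _ alg], rule exI[of _ "6060 * sqrt 2"], rule exI[of _ 4], intro allI)
      (rule spec[unfolded spec_def])
qed

end
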